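(* Let $\{P_\theta\}_{\theta\in\Theta}$ be a family as described in the context, which is continuously differentiable in quadratic mean, satisfies: for every compact $K\subset\Theta$ and every $h\in\mathbb{R}^m$, $\sup_{\theta\in K}\mathrm{E}_\theta e^{h^T\ell_\theta}<\infty$, and has $J_\theta$ nonsingular for all $\theta$. Let $\Theta_0$ be a countable subset of $\Theta$ and $(\Omega',\mathcal{X}'):=(\mathbb{R}^m\times[0,1],\mathcal{B}(\mathbb{R}^m\times[0,1]))$. Then there exist, for every $\theta$ and $n\ge1$, a probability measure $\tilde P^n_\theta$ on $(\Omega^n\times\Omega',\mathcal{X}^{\otimes n}\otimes\mathcal{X}')$ whose marginal on $\Omega^n$ is $P^n_\theta$, and a Markov kernel $x\mapsto R^n_\theta(\cdot|x)$ from $\mathbb{R}^m$ to $\Omega^n\times\Omega'$ (which may depend on $\theta$ and $n$ but not on $h$), such that, with random variables $\lambda^n_h$ of law $\mathrm{N}(h,J_\theta^{-1})$ and \[ Q^n_{\theta,h}(A):=\mathrm{E}^{\lambda^n_h}R^n_\theta(A|\lambda^n_h)=\int R^n_\theta(A|x)\,\mathrm{N}(h,J_\theta^{-1})(dx), \] one has, for every compact $K\subset\Theta$ and every compact $K'\subset\mathbb{R}^m$, \[ \lim_{n\to\infty}\sup_{h\in K'}\sup_{\theta\in K\cap\Theta_0}\left\Vert\tilde P^n_{\theta+hn^{-1/2}}-Q^n_{\theta,h}\right\Vert_1=0 . \]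
   Context: $\Theta$ is an open subset of $\mathbb{R}^m$, $(\Omega,\mathcal{X})$ is a Polish space with its Borel $\sigma$-algebra, each $P_\theta$ has density $p_\theta$ with respect to a fixed measure $\mu$, and $P^n_\theta:=P_\theta^{\otimes n}$; $\mathrm{E}_\theta$ is expectation under $P_\theta$. Differentiability in quadratic mean: there is a measurable $\ell_\theta:\Omega\to\mathbb{R}^m$ with $\lim_{h\to0}\Vert h\Vert^{-2}\int\big(\sqrt{p_{\theta+h}}-\sqrt{p_\theta}-\tfrac12 h^T\ell_\theta\sqrt{p_\theta}\big)^2d\mu=0$ for all $\theta$; continuous if moreover $\theta\mapsto\ell_\theta$ is continuous. $J_\theta:=[\mathrm{E}_\theta\ell_{\theta,i}\ell_{\theta,j}]_{i,j}$ (Fisher information). $\mathrm{N}(\mu,\Sigma)$ is the Gaussian law; $\Vert\cdot\Vert_1$ is the total variation ($L^1$) norm. *)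

theory Defs
  imports "HOL-Probability.Probability"
begin

definition model :: "'a measure \<Rightarrow> ('p \<Rightarrow> 'a \<Rightarrow> real) \<Rightarrow> 'p \<Rightarrow> 'a measure" where
  "model \<mu> p \<theta> = density \<mu> (\<lambda>x. ennreal (p \<theta> x))"

definition dqm :: "'a measure \<Rightarrow> ('n::finite) itself \<Rightarrow> (real^'n) set \<Rightarrow> (real^'n \<Rightarrow> 'a \<Rightarrow> real)
    \<Rightarrow> (real^'n \<Rightarrow> 'a \<Rightarrow> real^'n) \<Rightarrow> bool" where
  "dqm \<mu> _ \<Theta> p l \<longleftrightarrow> (\<forall>\<theta>\<in>\<Theta>.
     ((\<lambda>h. (\<integral>\<^sup>+ x. ennreal ((sqrt (p (\<theta> + h) x) - sqrt (p \<theta> x)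
                   - (1/2) * (h \<bullet> l \<theta> x) * sqrt (p \<theta> x))\<^sup>2) \<partial>\<mu>)
            / ennreal ((norm h)\<^sup>2)) \<longlongrightarrow> 0) (at 0))"

definition continuous_dqm :: "'a measure \<Rightarrow> (real^'n::finite) set \<Rightarrow> (real^'n \<Rightarrow> 'a \<Rightarrow> real)
    \<Rightarrow> (real^'n \<Rightarrow> 'a \<Rightarrow> real^'n) \<Rightarrow> bool" where
  "continuous_dqm \<mu> \<Theta> p l \<longleftrightarrow> dqm \<mu> TYPE('n) \<Theta> p l \<and> (\<forall>x\<in>space \<mu>. continuous_on \<Theta> (\<lambda>\<theta>. l \<theta> x))"

definition fisher_info :: "'a measure \<Rightarrow> (real^'n::finite \<Rightarrow> 'a \<Rightarrow> real)
    \<Rightarrow> (real^'n \<Rightarrow> 'a \<Rightarrow> real^'n) \<Rightarrow> real^'n \<Rightarrow> real^'n^'n" where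
  "fisher_info \<mu> p l \<theta> = (\<chi> i j. \<integral> x. (l \<theta> x $ i) * (l \<theta> x $ j) \<partial>(model \<mu> p \<theta>))"

definition gaussian :: "real^'n::finite \<Rightarrow> real^'n^'n \<Rightarrow> (real^'n) measure" where
  "gaussian m \<Sigma> = density lborel (\<lambda>x. ennreal
     ((2 * pi) powr (- real CARD('n) / 2) / sqrt (det \<Sigma>)
        * exp (- ((x - m) \<bullet> (matrix_inv \<Sigma> *v (x - m))) / 2)))"

definition tv_norm :: "'a measure \<Rightarrow> 'a measure \<Rightarrow> ennreal" where
  "tv_norm M N = (SUP \<A>\<in>{\<A>. finite \<A> \<and> \<A> \<subseteq> sets M \<and> disjoint \<A>}.
      ennreal (\<Sum>A\<in>\<A>. \<bar>measure M A - measure N A\<bar>))"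

end

theory Submission
  imports Defs
begin

text \<open>
  The auxiliary factor \<open>\<Omega>'\<close> can be filled with a point mass, so it suffices to approximate the
  product measures themselves, and the kernel may be chosen separately for every \<open>\<theta>\<close>. Write \<open>\<Delta>\<close> for
  the normalised score sum \<open>n\<^sup>-\<^sup>1\<^sup>/\<^sup>2 \<Sum> \<ell>\<^sub>\<theta>(x\<^sub>i)\<close>. Given \<open>x\<close>, the kernel draws from the law of the
  data under \<open>P\<^sup>n\<^sub>\<theta>\<close> conditioned on \<open>\<Delta> + \<delta>\<^sub>n Z = J x\<close> with an independent standard normal \<open>Z\<close>; owing to
  the noise this law has an explicit density and no disintegration is needed.

  By uniform differentiability in quadratic mean the local product measures are Hellinger-close to the
  product of the tilted densities proportional to \<open>exp (h \<bullet> \<ell>\<^sub>\<theta> / \<surd>n) p\<^sub>\<theta>\<close>, whose density with respect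
  to \<open>P\<^sup>n\<^sub>\<theta>\<close> is proportional to \<open>exp (h \<bullet> \<Delta>)\<close>. Passing such a tilt through the noise multiplies it only
  by \<open>exp (\<delta>\<^sub>n\<^sup>2 |h|\<^sup>2 / 2)\<close>, so everything reduces to the \<open>L\<^sup>1\<close>-convergence of the density of
  \<open>\<Delta> + \<delta>\<^sub>n Z\<close>. Pointwise convergence follows by Fourier inversion for \<open>\<delta>\<^sub>n\<close> tending to \<open>0\<close> slowly, and
  Scheffe's lemma upgrades it, since the total masses converge. Uniformity on compact sets is obtained
  by arguing along convergent sequences of parameters.
\<close>

section \<open>Linear changes of variables and Gaussian integrals\<close>

text \<open>The score sum may be lattice valued, in which case its law does not approach a Gaussian
  in total variation; this is what the added noise repairs. The noise has to vanish, but slowly: the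
  characteristic function of the score sum differs from its Gaussian limit by at most C (1 + |u|^4)
  / sqrt n, and integrating this error against the Fourier transform of the noise costs the noise
  level to the power -(m + 4), where m is the dimension. The level n^(-1 / (4 (m + 4))) turns that
  cost into n^(1/4) and leaves an error of order n^(-1/4). The tilted products are the right
  intermediary because their density depends on the data only through the score sum, so conditioning
  on the (noisy) score sum removes h and one kernel serves all h. Conditioning at J x rather than x
  matches the scales: under the local parameter h the score sum is asymptotically N(J h, J), the law
  of J x for x distributed as N(h, J^-1). Differentiability in quadratic mean is assumed at each
  parameter separately. Uniformity comes from continuity of the scores and the moment bounds, which
  make sqrt(p) l continuous in L^2, so that a mean value argument controls the remainder near every
  parameter.\<close>

lemma matrix_inv_mult:
  fixes A :: "real^'n::finite^'n"
  assumes "invertible A"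
  shows "A ** matrix_inv A = mat 1" "matrix_inv A ** A = mat 1"
  using someI_ex[OF assms[unfolded invertible_def]] unfolding matrix_inv_def by auto

section \<open>Factorization of positive definite matrices\<close>

text \<open>Gram-Schmidt for the inner product \<open>x \<bullet> (J *v y)\<close>: as long as fewer
  vectors than the dimension have been chosen, the vectors \<open>J *v b i\<close> do not span, and
  a nonzero vector orthogonal to all of them can be rescaled to length one in the form.\<close>

lemma pos_def_orthonormal_family:
  fixes J :: "real^'n::finite^'n" and I :: "'n set"
  assumes sym: "transpose J = J" and pd: "\<And>x. x \<noteq> 0 \<Longrightarrow> x \<bullet> (J *v x) > 0"
  shows "\<exists>b. \<forall>i\<in>I. \<forall>j\<in>I. b i \<bullet> (J *v b j) = (if i = j then 1 else 0)"
proof (induction I rule: finite_induct[OF finite])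
  case 1 then show ?case by simp
next
  case (2 a I)
  then obtain b where b: "\<And>i j. i \<in> I \<Longrightarrow> j \<in> I \<Longrightarrow> b i \<bullet> (J *v b j) = (if i = j then 1 else 0)"
    by blast
  have comm: "x \<bullet> (J *v y) = y \<bullet> (J *v x)" for x y
    by (metis dot_lmul_matrix inner_commute sym vector_transpose_matrix)
  let ?S = "(\<lambda>i. J *v b i) ` I"
  have "dim ?S \<le> card I"
    using "2.hyps"(1) by (meson card_image_le dim_le_card' finite_imageI order_trans)
  also have "card I < CARD('n)"
    using "2.hyps"(2) by (metis UNIV_I finite psubset_card_mono subset_UNIV psubsetI)
  finally have "dim ?S < DIM(real^'n)" by simp
  then obtain v where v: "v \<noteq> 0" "\<And>y. y \<in> span ?S \<Longrightarrow> orthogonal v y"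
    using orthogonal_to_subspace_exists by blast
  have v0: "v \<bullet> (J *v b i) = 0" if "i \<in> I" for i
    using v(2)[of "J *v b i"] that by (auto simp: orthogonal_def intro: span_base)
  define c where "c = sqrt (v \<bullet> (J *v v))"
  have c: "c > 0" "c\<^sup>2 = v \<bullet> (J *v v)"
    using pd[OF v(1)] by (auto simp: c_def)
  define b' where "b' = b(a := (1/c) *\<^sub>R v)"
  have "b' i \<bullet> (J *v b' j) = (if i = j then 1 else 0)" if ij: "i \<in> insert a I" "j \<in> insert a I" for i j
  proof -
    have vv: "v \<bullet> (J *v v) = c * c" using c by (simp add: power2_eq_square)
    have bv: "b i \<bullet> (J *v v) = 0" if "i \<in> I" for i using comm[of "b i" v] v0 that by simp
    consider "i = a" "j = a" | "i = a" "j \<in> I" "j \<noteq> a" | "i \<in> I" "j = a" "i \<noteq> a" | "i \<in> I" "j \<in> I" "i \<noteq> a" "j \<noteq> a"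
      using ij 2(2) by auto
    then show ?thesis
    proof cases
      case 1 then show ?thesis using c(1) by (simp add: b'_def matrix_vector_mult_scaleR vv)
    next
      case 2 then show ?thesis by (simp add: b'_def v0)
    next
      case 3 then show ?thesis by (simp add: b'_def matrix_vector_mult_scaleR bv)
    next
      case 4 then show ?thesis by (simp add: b'_def b)
    qed
  qed
  then show ?case by blast
qed

text \<open>Stacking a J-orthonormal basis as the rows of \<open>B\<close> gives B J B^T = 1, hence
  J = B^-1 B^-T. Any such factor does the work of a symmetric square root in the Gaussian integrals
  below.\<close>

lemma pos_def_factorization:
  fixes J :: "real^'n::finite^'n"
  assumes sym: "transpose J = J" and pd: "\<And>x. x \<noteq> 0 \<Longrightarrow> x \<bullet> (J *v x) > 0"
  obtains A :: "real^'n^'n" where "invertible A" "J = A ** transpose A"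
proof -
  obtain b :: "'n \<Rightarrow> real^'n" where b: "\<And>i j. b i \<bullet> (J *v b j) = (if i = j then 1 else 0)"
    using pos_def_orthonormal_family[OF sym pd, of UNIV] by auto
  define B where "B = (\<chi> i. b i)"
  have BJB: "B ** (J ** transpose B) = mat 1"
  proof -
    have "(B ** (J ** transpose B)) $ i $ j = b i \<bullet> (J *v b j)" for i j
      by (simp add: B_def matrix_matrix_mult_def transpose_def
        matrix_vector_mult_def inner_vec_def)
    then show ?thesis by (simp add: vec_eq_iff mat_def b)
  qed
  then have iB: "invertible B"
    using invertible_right_inverse by blast
  let ?A = "matrix_inv B"
  have BA: "B ** ?A = mat 1" and AB: "?A ** B = mat 1"
    using iB by (auto simp: matrix_inv_mult)
  have TA: "transpose B ** transpose ?A = mat 1"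
    by (metis AB matrix_transpose_mul transpose_mat)
  have iA: "invertible ?A" using BA AB unfolding invertible_def by blast
  have "J = (?A ** B) ** J ** (transpose B ** transpose ?A)"
    by (simp add: AB TA)
  also have "\<dots> = ?A ** (B ** (J ** transpose B)) ** transpose ?A"
    by (simp add: matrix_mul_assoc)
  also have "\<dots> = ?A ** transpose ?A" by (simp add: BJB)
  finally show ?thesis by (rule that[OF iA])
qed


section \<open>Lebesgue measure under invertible matrices\<close>

text \<open>With all coordinates other than m held fixed, the shear is a translation of coordinate m
  by a constant, because n differs from m. Fubini with coordinate m integrated first therefore
  reduces the claim to translation invariance on the line.\<close>

lemma lborel_distr_shear:
  fixes m n :: "'n::finite" and c :: real
  assumes mn: "m \<noteq> n"
  shows "distr lborel borel (\<lambda>x::real^'n. x + (c * x $ n) *\<^sub>R axis m 1) = lborel"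
proof (rule measure_eqI)
  let ?T = "\<lambda>x::real^'n. x + (c * x $ n) *\<^sub>R axis m 1"
  let ?e = "axis m 1 :: real^'n" and ?d = "axis n 1 :: real^'n"
  let ?s = "\<lambda>f. \<Sum>b\<in>Basis. f b *\<^sub>R b :: real^'n"
  fix A assume "A \<in> sets (distr lborel borel ?T)"
  then have A[measurable]: "A \<in> sets borel" by simp
  have e: "?e \<in> Basis" "?d \<in> Basis" "?d \<noteq> ?e"
    using mn by (auto simp: axis_in_Basis_iff axis_eq_axis)
  define I where "I = Basis - {?e}"
  have I: "finite I" "?e \<notin> I" "Basis = insert ?e I" "?d \<in> I"
    using e by (auto simp: I_def)
  interpret product_sigma_finite "\<lambda>_::real^'n. lborel :: real measure" ..
  have [measurable]: "?s \<in> borel_measurable (Pi\<^sub>M (insert ?e I) (\<lambda>_. lborel))"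
    unfolding I(3) by measurable
  have [measurable]: "?T \<in> borel_measurable borel" by measurable
  have key: "?T (?s (f(?e := y))) = ?s (f(?e := c * f ?d + y))" for f y
  proof -
    have "?s (f(?e := y)) \<bullet> ?d = (f(?e := y)) ?d"
      by (subst inner_sum_left_Basis) (use e in auto)
    then have 1: "?s (f(?e := y)) $ n = f ?d"
      using e by (simp add: inner_axis)
    have 2: "?s (f(?e := z)) = z *\<^sub>R ?e + (\<Sum>b\<in>I. f b *\<^sub>R b)" for z
    proof -
      have "?s (f(?e := z)) = z *\<^sub>R ?e + (\<Sum>b\<in>I. (f(?e := z)) b *\<^sub>R b)"
        unfolding I(3) by (subst sum.insert) (use I in auto)
      also have "(\<Sum>b\<in>I. (f(?e := z)) b *\<^sub>R b) = (\<Sum>b\<in>I. f b *\<^sub>R b)"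
        by (intro sum.cong) (use I in auto)
      finally show ?thesis .
    qed
    show ?thesis
      unfolding 1 unfolding 2 by (simp add: scaleR_add_left add_ac)
  qed
  have *: "(\<integral>\<^sup>+x. indicator A x \<partial>(lborel :: (real^'n) measure)) =
     (\<integral>\<^sup>+f. indicator A (?s f) \<partial>Pi\<^sub>M (insert ?e I) (\<lambda>_. lborel))"
    by (subst lborel_eq) (simp add: nn_integral_distr I(3)[symmetric] del: nn_integral_indicator)
  have "emeasure (distr lborel borel ?T) A = (\<integral>\<^sup>+x. indicator A (?T x) \<partial>lborel)"
    by (subst nn_integral_indicator[symmetric]) (simp_all add: nn_integral_distr del: nn_integral_indicator)
  also have "\<dots> = (\<integral>\<^sup>+f. indicator A (?T (?s f)) \<partial>Pi\<^sub>M (insert ?e I) (\<lambda>_. lborel))"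
    by (subst lborel_eq) (simp add: nn_integral_distr I(3)[symmetric])
  also have "\<dots> = (\<integral>\<^sup>+f. (\<integral>\<^sup>+y. indicator A (?T (?s (f(?e := y)))) \<partial>lborel) \<partial>Pi\<^sub>M I (\<lambda>_. lborel))"
    by (rule product_nn_integral_insert[OF I(1,2)]) measurable
  also have "\<dots> = (\<integral>\<^sup>+f. (\<integral>\<^sup>+y. indicator A (?s (f(?e := y))) \<partial>lborel) \<partial>Pi\<^sub>M I (\<lambda>_. lborel))"
  proof (rule nn_integral_cong)
    fix f :: "real^'n \<Rightarrow> real" assume f: "f \<in> space (Pi\<^sub>M I (\<lambda>_. lborel :: real measure))"
    have [measurable]: "(\<lambda>y. f(?e := y)) \<in> lborel \<rightarrow>\<^sub>M Pi\<^sub>M (insert ?e I) (\<lambda>_. lborel)"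
      using f by measurable
    have [measurable]: "(\<lambda>y. ?s (f(?e := y))) \<in> borel_measurable borel"
      using measurable_compose[of "\<lambda>y. f(?e := y)" lborel "Pi\<^sub>M (insert ?e I) (\<lambda>_. lborel)" ?s borel]
      by simp
    show "(\<integral>\<^sup>+y. indicator A (?T (?s (f(?e := y)))) \<partial>lborel) = (\<integral>\<^sup>+y. indicator A (?s (f(?e := y))) \<partial>lborel)"
      unfolding key
      by (subst (2) nn_integral_real_affine[where c=1 and t="c * f ?d"]) auto
  qed
  also have "\<dots> = (\<integral>\<^sup>+f. indicator A (?s f) \<partial>Pi\<^sub>M (insert ?e I) (\<lambda>_. lborel))"
    by (rule product_nn_integral_insert[OF I(1,2), symmetric]) measurable
  also have "\<dots> = emeasure lborel A"
    using * by (simp add: nn_integral_indicator)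
  finally show "emeasure (distr lborel borel ?T) A = emeasure lborel A" .
qed simp

text \<open>Swapping coordinates sends boxes to boxes with permuted side lengths, and the product of
  the side lengths is unchanged.\<close>

lemma lborel_distr_transpose:
  fixes m n :: "'n::finite"
  shows "distr lborel borel (\<lambda>x::real^'n. \<chi> i. x $ Transposition.transpose m n i) = lborel"
proof (rule lborel_eqI[symmetric])
  let ?t = "Transposition.transpose m n"
  let ?T = "\<lambda>x::real^'n. \<chi> i. x $ ?t i"
  fix l u :: "real^'n" assume le: "\<And>b. b \<in> Basis \<Longrightarrow> l \<bullet> b \<le> u \<bullet> b"
  have le': "l $ i \<le> u $ i" for i
    using le[of "axis i 1"] by (auto simp: inner_axis axis_in_Basis_iff)
  have [measurable]: "?T \<in> borel_measurable borel"
    by (intro borel_measurable_continuous_onI continuous_intros)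
  have vimage: "?T -` box l u = box (?T l) (?T u)"
    apply (auto simp: mem_box_cart)
    apply (metis transpose_involutory)+
    done
  have P: "(\<Prod>b\<in>Basis. (u - l) \<bullet> b) = (\<Prod>i\<in>UNIV. u $ i - l $ i)" for u l :: "real^'n"
  proof -
    have B: "Basis = (\<lambda>i::'n. axis i (1::real)) ` UNIV"
      by (auto simp: Basis_vec_def)
    show ?thesis unfolding B
      by (subst prod.reindex) (auto simp: inj_on_def axis_eq_axis inner_axis)
  qed
  have Q: "(\<Prod>i\<in>UNIV. u $ i - l $ i) = (\<Prod>i\<in>UNIV. u $ ?t i - l $ ?t i)"
    by (rule prod.reindex_bij_betw[symmetric]) (auto intro: bij_transpose)
  have "emeasure (distr lborel borel ?T) (box l u) = emeasure lborel (box (?T l) (?T u))"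
    by (simp add: emeasure_distr vimage)
  also have "\<dots> = (\<Prod>b\<in>Basis. (?T u - ?T l) \<bullet> b)"
    by (rule emeasure_lborel_box) (use le' in \<open>auto simp: Basis_vec_def inner_axis\<close>)
  also have "\<dots> = (\<Prod>b\<in>Basis. (u - l) \<bullet> b)"
    unfolding P Q by simp
  finally show "emeasure (distr lborel borel ?T) (box l u) = ennreal (\<Prod>b\<in>Basis. (u - l) \<bullet> b)" .
qed simp

lemma lborel_distr_diagonal:
  fixes c :: "'n::finite \<Rightarrow> real"
  assumes "\<And>i. c i \<noteq> 0"
  shows "lborel = density (distr lborel borel (\<lambda>x::real^'n. \<chi> i. c i * x $ i)) (\<lambda>_. ennreal \<bar>\<Prod>i\<in>UNIV. c i\<bar>)"
proof -
  have B: "Basis = (\<lambda>i::'n. axis i (1::real)) ` UNIV"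
    by (auto simp: Basis_vec_def)
  have inj: "inj (\<lambda>i::'n. axis i (1::real))" by (auto simp: inj_on_def axis_eq_axis)
  \<comment> \<open>\<open>lborel_affine_euclidean\<close> indexes its scaling factors by basis
    vectors, so \<open>c\<close> is transported along the bijection
    \<open>i \<mapsto> axis i 1\<close>.\<close>
  define c' :: "real^'n \<Rightarrow> real" where "c' b = c (inv (\<lambda>i::'n. axis i (1::real)) b)" for b
  have c': "c' (axis i 1) = c i" for i
    unfolding c'_def by (subst inv_f_f[OF inj]) simp
  have "(\<Sum>j\<in>Basis. (c' j * (x \<bullet> j)) *\<^sub>R j) = (\<chi> i. c i * x $ i)" for x :: "real^'n"
  proof -
    have "(\<Sum>j\<in>Basis. (c' j * (x \<bullet> j)) *\<^sub>R j) = (\<Sum>i\<in>UNIV. (c i * x $ i) *\<^sub>R axis i 1)"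
      unfolding B by (subst sum.reindex[OF inj]) (simp add: c' inner_axis)
    also have "\<dots> = (\<chi> i. c i * x $ i)"
      by (simp add: vec_eq_iff axis_def if_distrib cong: if_cong)
    finally show ?thesis .
  qed
  moreover have "(\<Prod>j\<in>(Basis :: (real^'n) set). \<bar>c' j\<bar>) = \<bar>\<Prod>i\<in>UNIV. c i\<bar>"
    unfolding B by (subst prod.reindex[OF inj]) (simp add: c' abs_prod)
  moreover have "c' j \<noteq> 0" if "j \<in> Basis" for j
    using that assms by (auto simp: B c')
  ultimately show ?thesis
    using lborel_affine_euclidean[of c' 0] by simp
qed

lemma borel_measurable_matrix_vector [measurable]:
  fixes A :: "real^'n::finite^'m::finite"
  shows "(*v) A \<in> borel_measurable borel"
  by (auto intro!: borel_measurable_continuous_onI linear_continuous_on matrix_vector_mul_bounded_linear)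

lemma borel_measurable_matrix_vector' [measurable (raw)]:
  fixes A :: "real^'n::finite^'m::finite"
  shows "f \<in> borel_measurable M \<Longrightarrow> (\<lambda>x. A *v f x) \<in> borel_measurable M"
  using borel_measurable_matrix_vector measurable_compose by blast


text \<open>Both sides behave multiplicatively in the matrix, so induction over products of
  elementary matrices leaves only diagonal matrices, transpositions and shears, for which the image
  measure is known and the determinant is computed directly.\<close>

lemma lborel_distr_matrix:
  fixes A :: "real^'n::finite^'n"
  assumes "invertible A"
  shows "lborel = density (distr lborel borel ((*v) A)) (\<lambda>_. ennreal \<bar>det A\<bar>)"
  using assms
proof (induction A rule: induct_matrix_elementary)
  case (1 A B)
  have i: "invertible A" "invertible B"
    using 1(3) by (auto simp: invertible_det_nz det_mul)
  note A = 1(1)[OF i(1)] and B = 1(2)[OF i(2)]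
  show ?case
  proof (rule measure_eqI)
    fix X :: "(real^'n) set" assume "X \<in> sets lborel"
    then have [measurable]: "X \<in> sets borel" by simp
    have "emeasure lborel X = (\<integral>\<^sup>+x. indicator X x \<partial>lborel)" by simp
    also have "\<dots> = ennreal \<bar>det A\<bar> * (\<integral>\<^sup>+x. indicator X (A *v x) \<partial>lborel)"
      by (subst A) (simp add: nn_integral_density nn_integral_distr nn_integral_cmult del: nn_integral_indicator)
    also have "(\<integral>\<^sup>+x. indicator X (A *v x) \<partial>lborel)
        = ennreal \<bar>det B\<bar> * (\<integral>\<^sup>+x. indicator X (A *v (B *v x)) \<partial>lborel)"
      by (subst B) (simp add: nn_integral_density nn_integral_distr nn_integral_cmult del: nn_integral_indicator)
    also have "ennreal \<bar>det A\<bar> * \<dots> = emeasure (density (distr lborel borel ((*v) (A ** B))) (\<lambda>_. ennreal \<bar>det (A ** B)\<bar>)) X"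
      by (simp add: emeasure_density nn_integral_distr nn_integral_cmult det_mul abs_mult ennreal_mult
            matrix_vector_mul_assoc mult.assoc del: nn_integral_indicator)
    finally show "emeasure lborel X =
      emeasure (density (distr lborel borel ((*v) (A ** B))) (\<lambda>_. ennreal \<bar>det (A ** B)\<bar>)) X" .
  qed simp
next
  case (2 A i)
  \<comment> \<open>A matrix with a zero row is singular, so this case contradicts
    invertibility.\<close>
  then have "det A = 0" by (metis det_zero_row(2) row_def)
  with 2 show ?case by (simp add: invertible_det_nz)
next
  case (3 A)
  have d: "det A = (\<Prod>i\<in>UNIV. A $ i $ i)" using 3(1) by (rule det_diagonal)
  have "(*v) A = (\<lambda>x. \<chi> i. A $ i $ i * x $ i)"
  proof
    fix x
    have "A $ i $ i * x $ i = (\<Sum>j\<in>UNIV. A $ i $ j * x $ j)" for i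
      by (simp add: 3(1) sum.remove[where x=i])
    then show "A *v x = (\<chi> i. A $ i $ i * x $ i)" by (simp add: matrix_vector_mult_def)
  qed
  moreover have "A $ i $ i \<noteq> 0" for i
    using 3(2) d by (auto simp: invertible_det_nz)
  ultimately show ?case
    using lborel_distr_diagonal[of "\<lambda>i. A $ i $ i"] by (simp add: d)
next
  case (4 m n)
  let ?A = "\<chi> i j. mat 1 $ i $ Transposition.transpose m n j :: real^'n^'n"
  have "(?A *v x) $ i = x $ Transposition.transpose m n i" for x i
  proof -
    have "(?A *v x) $ i = (\<Sum>j\<in>UNIV. if j = Transposition.transpose m n i then x $ j else 0)"
    proof -
      have "i = Transposition.transpose m n j \<longleftrightarrow> j = Transposition.transpose m n i" for j
        by (metis transpose_involutory)
      then show ?thesis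
        unfolding matrix_vector_mult_def mat_def vec_lambda_beta
        by (simp add: if_distrib[of "\<lambda>z. z * _"] cong: if_cong)
    qed
    then show ?thesis by simp
  qed
  then have f: "(*v) ?A = (\<lambda>x. \<chi> i. x $ Transposition.transpose m n i)"
    by (auto simp: vec_eq_iff)
  have "det ?A = of_int (sign (Transposition.transpose m n)) * det (mat 1 :: real^'n^'n)"
    by (rule det_permute_columns) (simp add: permutes_swap_id)
  then have "\<bar>det ?A\<bar> = 1" using 4 by (simp add: sign_swap_id)
  then show ?case
    unfolding f by (simp add: lborel_distr_transpose density_1)
next
  case (5 m n c)
  let ?A = "\<chi> i j. if i = m \<and> j = n then c else of_bool (i = j) :: real^'n^'n"
  have f: "(*v) ?A = (\<lambda>x. x + (c * x $ n) *\<^sub>R axis m 1)"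
  proof
    fix x :: "real^'n"
    have "(?A *v x) $ i = (x + (c * x $ n) *\<^sub>R axis m 1) $ i" for i
    proof -
      have "(?A *v x) $ i = (\<Sum>j\<in>UNIV. (if j = i then x $ i else 0) + (if j = n then (if i = m then c * x $ n else 0) else 0))"
        unfolding matrix_vector_mult_def using 5(1)
        by (auto intro!: sum.cong)
      also have "\<dots> = x $ i + (if i = m then c * x $ n else 0)"
        by (simp add: sum.distrib)
      finally show ?thesis by (simp add: axis_def)
    qed
    then show "?A *v x = x + (c * x $ n) *\<^sub>R axis m 1" by (simp add: vec_eq_iff)
  qed
  have "?A = (\<chi> k. if k = m then row m (mat 1) + c *s row n (mat 1) else row k (mat 1))"
    using 5(1) by (auto simp: vec_eq_iff row_def mat_def)
  then have "det ?A = det (mat 1 :: real^'n^'n)"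
    using det_row_operation[OF 5(1), of "mat 1" c] by simp
  then show ?case
    unfolding f by (simp add: lborel_distr_shear[OF 5(1)] density_1)
qed

lemma nn_integral_lborel_matrix:
  fixes A :: "real^'n::finite^'n"
  assumes "invertible A" and [measurable]: "f \<in> borel_measurable borel"
  shows "(\<integral>\<^sup>+y. f y \<partial>lborel) = ennreal \<bar>det A\<bar> * (\<integral>\<^sup>+x. f (A *v x) \<partial>lborel)"
  by (subst lborel_distr_matrix[OF assms(1)])
     (simp add: nn_integral_density nn_integral_distr nn_integral_cmult)

lemma integral_lborel_matrix:
  fixes A :: "real^'n::finite^'n" and f :: "real^'n \<Rightarrow> 'b::{banach, second_countable_topology}"
  assumes "invertible A" and [measurable]: "f \<in> borel_measurable borel"
  shows "(\<integral>y. f y \<partial>lborel) = \<bar>det A\<bar> *\<^sub>R (\<integral>x. f (A *v x) \<partial>lborel)"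
  by (subst lborel_distr_matrix[OF assms(1)])
     (simp add: integral_density integral_distr)

lemma integrable_lborel_matrix:
  fixes A :: "real^'n::finite^'n" and f :: "real^'n \<Rightarrow> 'b::{banach, second_countable_topology}"
  assumes "invertible A" and [measurable]: "f \<in> borel_measurable borel"
  shows "integrable lborel f \<longleftrightarrow> integrable lborel (\<lambda>x. f (A *v x))"
proof -
  have "det A \<noteq> 0" using assms(1) invertible_det_nz by blast
  then show ?thesis
    using integrable_scaleR_right[of "1 / \<bar>det A\<bar>" lborel "\<lambda>x. \<bar>det A\<bar> *\<^sub>R f (A *v x)"]
    by (subst lborel_distr_matrix[OF assms(1)]) (auto simp: integrable_density integrable_distr_eq)
qed

section \<open>Gaussian densities: mass, exponential moments, Fourier transform\<close>

definition std_gauss :: "'a::euclidean_space \<Rightarrow> real" where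
  "std_gauss x = (2 * pi) powr (- real DIM('a) / 2) * exp (- (norm x)\<^sup>2 / 2)"

lemma std_gauss_eq_prod:
  fixes x :: "'a::euclidean_space"
  shows "std_gauss x = (\<Prod>b\<in>Basis. std_normal_density (x \<bullet> b))"
proof -
  have n: "(norm x)\<^sup>2 = (\<Sum>b\<in>Basis. (x \<bullet> b)\<^sup>2)"
    by (metis (no_types, lifting) euclidean_inner power2_eq_square power2_norm_eq_inner sum.cong)
  have p: "(2 * pi) powr (- real DIM('a) / 2) = (1 / sqrt (2 * pi)) ^ DIM('a)"
  proof -
    have "(1 / sqrt (2 * pi)) = (2 * pi) powr (- 1 / 2)"
      by (simp add: powr_half_sqrt[symmetric] powr_minus_divide)
    then show ?thesis by (simp add: powr_realpow[symmetric] powr_powr)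
  qed
  have "(\<Prod>b\<in>Basis. std_normal_density (x \<bullet> b))
      = (1 / sqrt (2 * pi)) ^ DIM('a) * exp (\<Sum>b\<in>(Basis::'a set). - (x \<bullet> b)\<^sup>2 / 2)"
    unfolding std_normal_density_def prod.distrib by (simp add: exp_sum power_divide)
  also have "(\<Sum>b\<in>(Basis::'a set). - (x \<bullet> b)\<^sup>2 / 2) = - (norm x)\<^sup>2 / 2"
    by (simp add: n sum_negf sum_divide_distrib)
  finally show ?thesis unfolding std_gauss_def p by simp
qed

lemma std_gauss_measurable [measurable]: "std_gauss \<in> borel_measurable borel"
  unfolding std_gauss_def by measurable

text \<open>The integrand is a product over the coordinates of one-dimensional integrands, so Fubini
  reduces everything to the characteristic function of the standard normal law. The case t = 0 later
  yields integrability and total mass.\<close>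

lemma fourier_std_gauss:
  fixes t :: "'a::euclidean_space"
  shows "integrable lborel (\<lambda>x::'a. complex_of_real (std_gauss x) * iexp (t \<bullet> x))"
    and "(\<integral>x. complex_of_real (std_gauss x) * iexp (t \<bullet> x) \<partial>(lborel :: 'a measure))
           = complex_of_real (exp (- (norm t)\<^sup>2 / 2))"
proof -
  let ?f = "\<lambda>b y. complex_of_real (std_normal_density y) * iexp ((t \<bullet> b) * y)"
  have eq: "complex_of_real (std_gauss x) * iexp (t \<bullet> x) = (\<Prod>b\<in>Basis. ?f b (x \<bullet> b))" for x :: 'a
  proof -
    have "t \<bullet> x = (\<Sum>b\<in>Basis. (t \<bullet> b) * (x \<bullet> b))" by (rule euclidean_inner)
    then show ?thesis
      by (simp add: std_gauss_eq_prod prod.distrib exp_sum sum_distrib_left)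
  qed
  interpret product_sigma_finite "\<lambda>_::'a. lborel :: real measure" ..
  have f_int: "integrable lborel (?f b)" for b
  proof -
    have "integrable lborel (\<lambda>y. complex_of_real (std_normal_density y))"
      by (intro integrable_of_real integrable_normal_density) simp
    then show ?thesis
      by (rule Bochner_Integration.integrable_bound) (auto simp: norm_mult)
  qed
  have f_val: "(\<integral>y. ?f b y \<partial>lborel) = complex_of_real (exp (- (t \<bullet> b)\<^sup>2 / 2))" for b
  proof -
    have "char std_normal_distribution (t \<bullet> b) = (\<integral>y. ?f b y \<partial>lborel)"
      unfolding char_def by (subst integral_density) (auto simp: scaleR_conv_of_real)
    then show ?thesis by (simp add: char_std_normal_distribution)
  qed
  have *: "(\<Prod>b\<in>Basis. ?f b ((\<Sum>b\<in>Basis. y b *\<^sub>R b) \<bullet> b)) = (\<Prod>b\<in>Basis. ?f b (y b))"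
    for y :: "'a \<Rightarrow> real"
    by (intro prod.cong refl) simp
  have i1: "integrable (\<Pi>\<^sub>M b\<in>Basis. lborel) (\<lambda>y. \<Prod>b\<in>Basis. ?f b (y b))"
    by (rule product_integrable_prod) (use f_int in auto)
  show "integrable lborel (\<lambda>x::'a. complex_of_real (std_gauss x) * iexp (t \<bullet> x))"
    unfolding eq using i1 by (subst lborel_eq, subst integrable_distr_eq) (auto simp: *)
  have n: "(norm t)\<^sup>2 = (\<Sum>b\<in>Basis. (t \<bullet> b)\<^sup>2)"
    by (metis (no_types, lifting) euclidean_inner power2_eq_square power2_norm_eq_inner sum.cong)
  have "(\<integral>x. complex_of_real (std_gauss x) * iexp (t \<bullet> x) \<partial>(lborel :: 'a measure))
     = (\<integral>y. (\<Prod>b\<in>Basis. ?f b (y b)) \<partial>(\<Pi>\<^sub>M b\<in>Basis. lborel))"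
    unfolding eq by (subst lborel_eq, subst integral_distr) (auto simp: *)
  also have "\<dots> = (\<Prod>b\<in>Basis. \<integral>y. ?f b y \<partial>lborel)"
    by (rule product_integral_prod) (use f_int in auto)
  also have "\<dots> = complex_of_real (exp (- (norm t)\<^sup>2 / 2))"
    unfolding f_val by (simp add: n exp_sum sum_negf[symmetric] sum_divide_distrib
       flip: of_real_prod of_real_exp)
  finally show "(\<integral>x. complex_of_real (std_gauss x) * iexp (t \<bullet> x) \<partial>(lborel :: 'a measure))
           = complex_of_real (exp (- (norm t)\<^sup>2 / 2))" .
qed

lemma std_gauss_pos: "std_gauss x > 0"
  by (simp add: std_gauss_def)

lemma std_gauss_le: "std_gauss (x::'a::euclidean_space) \<le> (2 * pi) powr (- real DIM('a) / 2)"
  unfolding std_gauss_def by (rule mult_left_le) auto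

lemma integrable_std_gauss: "integrable lborel (std_gauss :: 'a::euclidean_space \<Rightarrow> real)"
  using fourier_std_gauss(1)[of "0::'a"] by (simp add: complex_of_real_integrable_eq)

lemma integral_std_gauss: "(\<integral>x. std_gauss (x::'a::euclidean_space) \<partial>lborel) = 1"
proof -
  have "complex_of_real (\<integral>x. std_gauss (x::'a) \<partial>lborel) = 1"
    using fourier_std_gauss(2)[of "0::'a"] by simp
  then show ?thesis by (metis of_real_eq_1_iff)
qed

lemma nn_integral_std_gauss: "(\<integral>\<^sup>+x. ennreal (std_gauss (x::'a::euclidean_space)) \<partial>lborel) = 1"
  by (subst nn_integral_eq_integral[OF integrable_std_gauss])
     (auto simp: integral_std_gauss less_imp_le std_gauss_pos)

lemma nn_integral_lborel_translate:
  fixes f :: "'a::euclidean_space \<Rightarrow> ennreal"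
  assumes [measurable]: "f \<in> borel_measurable borel"
  shows "(\<integral>\<^sup>+x. f (c + x) \<partial>lborel) = (\<integral>\<^sup>+x. f x \<partial>lborel)"
  by (subst (2) lborel_distr_plus[of c, symmetric]) (simp add: nn_integral_distr)

text \<open>Completing the square turns the tilted density into a translate of the original, times
  the constant that becomes the value of the integral.\<close>

lemma nn_integral_std_gauss_exp:
  fixes a :: "'a::euclidean_space"
  shows "(\<integral>\<^sup>+x. ennreal (std_gauss x * exp (a \<bullet> x)) \<partial>lborel) = ennreal (exp ((norm a)\<^sup>2 / 2))"
proof -
  have eq: "std_gauss x * exp (a \<bullet> x) = exp ((norm a)\<^sup>2 / 2) * std_gauss (- a + x)" for x
  proof -
    have "- (norm x)\<^sup>2 / 2 + a \<bullet> x = (norm a)\<^sup>2 / 2 - (norm (- a + x))\<^sup>2 / 2"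
      by (simp add: power2_norm_eq_inner inner_simps inner_commute field_simps)
    then show ?thesis by (simp add: std_gauss_def flip: exp_add)
  qed
  show ?thesis
    using nn_integral_lborel_translate[of "\<lambda>x. ennreal (std_gauss x)" "- a"]
    unfolding eq by (simp add: ennreal_mult' nn_integral_cmult nn_integral_std_gauss)
qed

text \<open>For d > 0 this is the density of \<open>d\<close> times a standard normal
  vector.\<close>

definition scaled_gauss :: "real \<Rightarrow> 'a::euclidean_space \<Rightarrow> real" where
  "scaled_gauss d y = std_gauss ((1 / d) *\<^sub>R y) / d ^ DIM('a)"

lemma scaled_gauss_measurable [measurable]: "scaled_gauss d \<in> borel_measurable borel"
  unfolding scaled_gauss_def by measurable

lemma scaled_gauss_pos: "d > 0 \<Longrightarrow> scaled_gauss d y > 0"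
  by (simp add: scaled_gauss_def std_gauss_pos)

text \<open>An exponential tilt evaluated at the noisy point z + d Z has, on average over the noise,
  the value of the tilt at z times a factor independent of z. This is why noise and tilting commute
  up to a constant.\<close>

lemma nn_integral_scaled_gauss_exp:
  fixes a z :: "'a::euclidean_space"
  assumes d: "d > 0"
  shows "(\<integral>\<^sup>+y. ennreal (scaled_gauss d (y - z) * exp (a \<bullet> y)) \<partial>lborel)
    = ennreal (exp (a \<bullet> z) * exp (d\<^sup>2 * (norm a)\<^sup>2 / 2))"
proof -
  have "(\<integral>\<^sup>+y. ennreal (scaled_gauss d (y - z) * exp (a \<bullet> y)) \<partial>lborel)
     = (\<integral>\<^sup>+x. ennreal (\<bar>d\<bar> ^ DIM('a)) * ennreal (scaled_gauss d (d *\<^sub>R x) * exp (a \<bullet> (z + d *\<^sub>R x))) \<partial>lborel)"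
    using d by (subst lborel_affine[of d z]) (simp_all add: nn_integral_density nn_integral_distr)
  also have "\<dots> = (\<integral>\<^sup>+x. ennreal (exp (a \<bullet> z)) * ennreal (std_gauss x * exp ((d *\<^sub>R a) \<bullet> x)) \<partial>lborel)"
    using d by (intro nn_integral_cong)
      (simp add: scaled_gauss_def inner_simps exp_add mult_ac flip: ennreal_mult')
  also have "\<dots> = ennreal (exp (a \<bullet> z) * exp (d\<^sup>2 * (norm a)\<^sup>2 / 2))"
    by (subst nn_integral_cmult, measurable, subst nn_integral_std_gauss_exp)
       (simp add: ennreal_mult' power_mult_distrib)
  finally show ?thesis .
qed

text \<open>Substituting v = B u reduces the integral to the standard Gaussian, which is its own
  Fourier transform up to a constant. It is applied with B a multiple of the identity, for the
  noise, and with B the transposed factor of J, for the limit.\<close>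

lemma fourier_inversion_gauss:
  fixes B :: "real^'n::finite^'n"
  assumes B: "invertible B"
  shows "integrable lborel (\<lambda>u. complex_of_real (exp (- (norm (B *v u))\<^sup>2 / 2)) * iexp (u \<bullet> y))"
    and "(\<integral>u. complex_of_real (exp (- (norm (B *v u))\<^sup>2 / 2)) * iexp (- (u \<bullet> (transpose B *v z))) \<partial>lborel)
       = complex_of_real ((2 * pi) ^ CARD('n) / \<bar>det B\<bar> * std_gauss z)"
proof -
  let ?c = "(2 * pi) powr (real CARD('n) / 2)"
  have c: "exp (- (norm v)\<^sup>2 / 2) = ?c * std_gauss v" for v :: "real^'n"
    unfolding std_gauss_def by (simp add: powr_minus field_simps)
  have cc: "?c * ?c = (2 * pi) ^ CARD('n)"
    by (subst powr_add[symmetric], subst powr_realpow[symmetric]) auto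
  have d: "det B \<noteq> 0" using B invertible_det_nz by blast
  have "integrable lborel (\<lambda>v::real^'n. complex_of_real (exp (- (norm v)\<^sup>2 / 2)))"
    unfolding c of_real_mult by (intro integrable_mult_right integrable_of_real integrable_std_gauss)
  then have "integrable lborel (\<lambda>u. complex_of_real (exp (- (norm (B *v u))\<^sup>2 / 2)))"
    by (subst (asm) integrable_lborel_matrix[OF B]) simp_all
  then show "integrable lborel (\<lambda>u. complex_of_real (exp (- (norm (B *v u))\<^sup>2 / 2)) * iexp (u \<bullet> y))"
    by (rule Bochner_Integration.integrable_bound) (auto simp: norm_mult)
  let ?f = "\<lambda>v. complex_of_real ?c * (complex_of_real (std_gauss v) * iexp ((- z) \<bullet> v))"
  have "?f (B *v u) = complex_of_real (exp (- (norm (B *v u))\<^sup>2 / 2)) * iexp (- (u \<bullet> (transpose B *v z)))" for u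
  proof -
    have "(- z) \<bullet> (B *v u) = - (u \<bullet> (transpose B *v z))"
      by (metis dot_lmul_matrix inner_commute inner_minus_left vector_transpose_matrix transpose_transpose)
    then show ?thesis unfolding c of_real_mult by (simp only: mult_ac)
  qed
  then have "(\<integral>u. complex_of_real (exp (- (norm (B *v u))\<^sup>2 / 2)) * iexp (- (u \<bullet> (transpose B *v z))) \<partial>lborel)
     = (\<integral>u. ?f (B *v u) \<partial>lborel)" by presburger
  also have "\<dots> = (1 / \<bar>det B\<bar>) *\<^sub>R (\<bar>det B\<bar> *\<^sub>R (\<integral>u. ?f (B *v u) \<partial>lborel))"
    using d by simp
  also have "\<bar>det B\<bar> *\<^sub>R (\<integral>u. ?f (B *v u) \<partial>lborel) = (\<integral>v. ?f v \<partial>lborel)"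
    by (rule integral_lborel_matrix[OF B, symmetric]) measurable
  also have "(\<integral>v. ?f v \<partial>lborel) = complex_of_real ?c * complex_of_real (exp (- (norm (- z))\<^sup>2 / 2))"
    by (subst integral_mult_right_zero) (simp only: fourier_std_gauss(2))
  also have "\<dots> = complex_of_real ((2 * pi) ^ CARD('n) * std_gauss z)"
    unfolding c cc[symmetric] by (simp add: std_gauss_def)
  finally show "(\<integral>u. complex_of_real (exp (- (norm (B *v u))\<^sup>2 / 2)) * iexp (- (u \<bullet> (transpose B *v z))) \<partial>lborel)
       = complex_of_real ((2 * pi) ^ CARD('n) / \<bar>det B\<bar> * std_gauss z)"
    by (simp add: scaleR_conv_of_real)
qed

text \<open>The case B = d 1. Writing the noise density as an integral of exponentials is what lets
  the characteristic function of the score sum enter through Fubini.\<close>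

lemma scaled_gauss_fourier:
  fixes y :: "real^'n::finite"
  assumes d: "d > 0"
  shows "integrable lborel (\<lambda>u::real^'n. exp (- (d\<^sup>2 * (norm u)\<^sup>2) / 2))"
    and "complex_of_real (scaled_gauss d y)
     = (1 / (2 * pi) ^ CARD('n)) * (\<integral>u. complex_of_real (exp (- (d\<^sup>2 * (norm u)\<^sup>2) / 2)) * iexp (- (u \<bullet> y)) \<partial>lborel)"
proof -
  let ?B = "d *\<^sub>R mat 1 :: real^'n^'n"
  have Bv: "?B *v u = d *\<^sub>R u" for u by (simp add: scaleR_matrix_vector_assoc[symmetric])
  have tB: "transpose ?B = ?B" by (simp add: transpose_scalar transpose_mat)
  have det: "det ?B = d ^ CARD('n)"
    by (subst det_diagonal) (auto simp: mat_def)
  have B: "invertible ?B" using d by (simp add: invertible_det_nz det)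
  have n: "(norm (d *\<^sub>R u))\<^sup>2 = d\<^sup>2 * (norm u)\<^sup>2" for u :: "real^'n" by (simp add: power_mult_distrib)
  show "integrable lborel (\<lambda>u::real^'n. exp (- (d\<^sup>2 * (norm u)\<^sup>2) / 2))"
    using fourier_inversion_gauss(1)[OF B, of 0] unfolding Bv n by (simp add: complex_of_real_integrable_eq flip: of_real_exp)
  have "transpose ?B *v ((1/d) *\<^sub>R y) = y" using d by (simp add: tB Bv)
  then show "complex_of_real (scaled_gauss d y)
     = (1 / (2 * pi) ^ CARD('n)) * (\<integral>u. complex_of_real (exp (- (d\<^sup>2 * (norm u)\<^sup>2) / 2)) * iexp (- (u \<bullet> y)) \<partial>lborel)"
    using fourier_inversion_gauss(2)[OF B, of "(1/d) *\<^sub>R y"] d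
    unfolding Bv n det by (simp add: scaled_gauss_def)
qed

section \<open>The Gaussian density in terms of its precision matrix\<close>

text \<open>The density of N(0, J^-1) when J is positive definite. Using the precision matrix as
  parameter avoids inverses and makes continuity in J evident.\<close>

definition normal_precision_density :: "real^'n::finite^'n \<Rightarrow> real^'n \<Rightarrow> real" where
  "normal_precision_density J x = (2 * pi) powr (- real CARD('n) / 2) * sqrt (det J) * exp (- (x \<bullet> (J *v x)) / 2)"

lemma normal_precision_density_measurable [measurable]:
  "normal_precision_density J \<in> borel_measurable borel"
  unfolding normal_precision_density_def by measurable

lemma normal_precision_density_nonneg: "normal_precision_density J x \<ge> 0" if "det J \<ge> 0"
  using that by (simp add: normal_precision_density_def)

lemma normal_precision_density_eq:
  fixes A :: "real^'n::finite^'n"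
  shows "normal_precision_density (A ** transpose A) x = \<bar>det A\<bar> * std_gauss (transpose A *v x)"
proof -
  have "(norm (transpose A *v x))\<^sup>2 = x \<bullet> ((A ** transpose A) *v x)"
    by (metis dot_lmul_matrix matrix_vector_mul_assoc power2_norm_eq_inner vector_transpose_matrix transpose_transpose)
  moreover have "sqrt (det (A ** transpose A)) = \<bar>det A\<bar>"
    by (simp add: det_mul det_transpose real_sqrt_mult)
  ultimately show ?thesis by (simp add: normal_precision_density_def std_gauss_def)
qed

lemma nn_integral_normal_precision_density:
  fixes J :: "real^'n::finite^'n"
  assumes sym: "transpose J = J" and pd: "\<And>x. x \<noteq> 0 \<Longrightarrow> x \<bullet> (J *v x) > 0"
  shows "(\<integral>\<^sup>+x. ennreal (normal_precision_density J (x - h)) \<partial>lborel) = 1"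
proof -
  obtain A :: "real^'n^'n" where A: "invertible A" "J = A ** transpose A"
    by (rule pos_def_factorization[OF sym pd])
  have tA: "invertible (transpose A)" using A(1) by (simp add: invertible_det_nz det_transpose)
  have "(\<integral>\<^sup>+x. ennreal (normal_precision_density J (x - h)) \<partial>lborel) = (\<integral>\<^sup>+x. ennreal (normal_precision_density J x) \<partial>lborel)"
    using nn_integral_lborel_translate[of "\<lambda>x. ennreal (normal_precision_density J x)" "-h"] by simp
  also have "\<dots> = ennreal \<bar>det A\<bar> * (\<integral>\<^sup>+x. ennreal (std_gauss (transpose A *v x)) \<partial>lborel)"
    unfolding A(2) normal_precision_density_eq
    by (subst nn_integral_cmult[symmetric], measurable) (simp add: ennreal_mult')
  also have "\<dots> = (\<integral>\<^sup>+x. ennreal (std_gauss (x::real^'n)) \<partial>lborel)"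
    using nn_integral_lborel_matrix[OF tA, of "\<lambda>x. ennreal (std_gauss x)", symmetric] by (simp add: det_transpose)
  finally show ?thesis by (simp add: nn_integral_std_gauss)
qed

lemma det_pos_def:
  fixes J :: "real^'n::finite^'n"
  assumes sym: "transpose J = J" and pd: "\<And>x. x \<noteq> 0 \<Longrightarrow> x \<bullet> (J *v x) > 0"
  shows "det J > 0"
proof -
  obtain A :: "real^'n^'n" where A: "invertible A" "J = A ** transpose A"
    by (rule pos_def_factorization[OF sym pd])
  then show ?thesis by (auto simp: det_mul det_transpose invertible_det_nz zero_less_mult_iff)
qed

text \<open>Since det (J^-1) = 1 / det J and inverting twice returns J, the covariance form and the
  precision form of the density coincide.\<close>

lemma gaussian_matrix_inv:
  fixes J :: "real^'n::finite^'n"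
  assumes "invertible J" "det J > 0"
  shows "gaussian h (matrix_inv J) = density lborel (\<lambda>x. ennreal (normal_precision_density J (x - h)))"
proof -
  have "det J * det (matrix_inv J) = 1" by (metis assms(1) det_I det_mul matrix_inv_mult(1))
  then have "det (matrix_inv J) = 1 / det J" using assms(2) by (simp add: field_simps)
  moreover have "matrix_inv (matrix_inv J) = J"
    by (metis assms(1) invertible_def matrix_inv_mult matrix_mul_assoc matrix_mul_lid matrix_mul_rid)
  ultimately show ?thesis
    using assms(2) by (simp add: gaussian_def normal_precision_density_def real_sqrt_divide)
qed

section \<open>Total variation and Hellinger distance\<close>

lemma tv_norm_leI:
  assumes "\<And>\<A>. finite \<A> \<Longrightarrow> \<A> \<subseteq> sets M \<Longrightarrow> disjoint \<A> \<Longrightarrow> (\<Sum>A\<in>\<A>. \<bar>measure M A - measure N A\<bar>) \<le> c"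
  shows "tv_norm M N \<le> ennreal c"
  unfolding tv_norm_def by (rule SUP_least) (auto intro!: ennreal_leI assms)

lemma tv_norm_geI:
  assumes "finite \<A>" "\<A> \<subseteq> sets M" "disjoint \<A>"
  shows "ennreal (\<Sum>A\<in>\<A>. \<bar>measure M A - measure N A\<bar>) \<le> tv_norm M N"
  unfolding tv_norm_def by (rule SUP_upper) (use assms in auto)

lemma tv_norm_triangle:
  assumes "sets M = sets N"
  shows "tv_norm M L \<le> tv_norm M N + tv_norm N L"
  unfolding tv_norm_def[of M L]
proof (rule SUP_least)
  fix \<A> assume "\<A> \<in> {\<A>. finite \<A> \<and> \<A> \<subseteq> sets M \<and> disjoint \<A>}"
  then have A: "finite \<A>" "\<A> \<subseteq> sets M" "disjoint \<A>" by auto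
  have "ennreal (\<Sum>A\<in>\<A>. \<bar>measure M A - measure L A\<bar>)
      \<le> ennreal ((\<Sum>A\<in>\<A>. \<bar>measure M A - measure N A\<bar>) + (\<Sum>A\<in>\<A>. \<bar>measure N A - measure L A\<bar>))"
    unfolding sum.distrib[symmetric] by (intro ennreal_leI sum_mono) linarith
  also have "\<dots> = ennreal (\<Sum>A\<in>\<A>. \<bar>measure M A - measure N A\<bar>) + ennreal (\<Sum>A\<in>\<A>. \<bar>measure N A - measure L A\<bar>)"
    by (simp add: sum_nonneg)
  also have "\<dots> \<le> tv_norm M N + tv_norm N L"
    using A assms by (intro add_mono tv_norm_geI) auto
  finally show "ennreal (\<Sum>A\<in>\<A>. \<bar>measure M A - measure L A\<bar>) \<le> tv_norm M N + tv_norm N L" .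
qed

text \<open>Preimages of disjoint sets are disjoint, so each family tested for the image measures
  gives a family tested for the original ones. Sets with empty preimage contribute nothing and are
  dropped, since taking preimages is injective only on the remaining ones.\<close>

lemma tv_norm_distr_le:
  assumes f[measurable]: "f \<in> M \<rightarrow>\<^sub>M S" and MN: "sets M = sets N"
  shows "tv_norm (distr M S f) (distr N S f) \<le> tv_norm M N"
  unfolding tv_norm_def[of "distr M S f"]
proof (rule SUP_least)
  fix \<A> assume "\<A> \<in> {\<A>. finite \<A> \<and> \<A> \<subseteq> sets (distr M S f) \<and> disjoint \<A>}"
  then have A: "finite \<A>" "\<A> \<subseteq> sets S" "disjoint \<A>" by auto
  have sp: "space N = space M" using MN by (metis sets_eq_imp_space_eq)
  have fN: "f \<in> N \<rightarrow>\<^sub>M S" using f MN by (simp cong: measurable_cong_sets)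
  define B where "B A = f -` A \<inter> space M" for A
  define \<A>' where "\<A>' = {A\<in>\<A>. B A \<noteq> {}}"
  have inj: "inj_on B \<A>'"
  proof (rule inj_onI)
    fix X Y assume *: "X \<in> \<A>'" "Y \<in> \<A>'" "B X = B Y"
    then obtain x where "x \<in> B X" by (auto simp: \<A>'_def)
    then have "f x \<in> X \<inter> Y" using * by (auto simp: B_def)
    then show "X = Y" using A(3) * by (auto simp: disjoint_def \<A>'_def)
  qed
  have "(\<Sum>A\<in>\<A>. \<bar>measure (distr M S f) A - measure (distr N S f) A\<bar>)
      = (\<Sum>A\<in>\<A>. \<bar>measure M (B A) - measure N (B A)\<bar>)"
    using A fN by (intro sum.cong) (auto simp: measure_distr B_def sp)
  also have "\<dots> = (\<Sum>A\<in>\<A>'. \<bar>measure M (B A) - measure N (B A)\<bar>)"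
    using A(1) by (intro sum.mono_neutral_right) (auto simp: \<A>'_def)
  also have "\<dots> = (\<Sum>A\<in>B ` \<A>'. \<bar>measure M A - measure N A\<bar>)"
    using inj by (simp add: sum.reindex)
  also have "ennreal \<dots> \<le> tv_norm M N"
  proof (rule tv_norm_geI)
    show "finite (B ` \<A>')" using A(1) by (simp add: \<A>'_def)
    show "B ` \<A>' \<subseteq> sets M" using A(2) by (auto simp: B_def \<A>'_def)
    show "disjoint (B ` \<A>')" using A(3) by (auto simp: disjoint_def B_def \<A>'_def)
  qed
  finally show "ennreal (\<Sum>A\<in>\<A>. \<bar>measure (distr M S f) A - measure (distr N S f) A\<bar>) \<le> tv_norm M N" .
qed

lemma sum_indicator_disjoint_le_1:
  assumes "finite \<A>" "disjoint \<A>"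
  shows "(\<Sum>A\<in>\<A>. indicator A x :: real) \<le> 1"
proof (cases "\<exists>A\<in>\<A>. x \<in> A")
  case True
  then obtain A where A: "A \<in> \<A>" "x \<in> A" by auto
  have "(\<Sum>B\<in>\<A>. indicator B x :: real) = (\<Sum>B\<in>{A}. indicator B x)"
    using assms A by (intro sum.mono_neutral_right) (auto simp: disjoint_def indicator_def)
  then show ?thesis using A by simp
next
  case False then show ?thesis by (simp add: indicator_def)
qed

lemma measure_density_real:
  assumes "integrable M f" "\<And>x. f x \<ge> (0::real)" "A \<in> sets M"
  shows "measure (density M f) A = (\<integral>x. indicator A x * f x \<partial>M)"
proof -
  have [measurable]: "f \<in> borel_measurable M" "A \<in> sets M" using assms by auto
  have "emeasure (density M f) A = (\<integral>\<^sup>+x. ennreal (indicator A x * f x) \<partial>M)"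
    by (subst emeasure_density) (auto intro!: nn_integral_cong simp: indicator_def)
  also have "\<dots> = ennreal (\<integral>x. indicator A x * f x \<partial>M)"
    using assms by (intro nn_integral_eq_integral) (auto intro: integrable_real_mult_indicator simp: mult.commute)
  finally show ?thesis
    using assms(2) by (simp add: measure_def Bochner_Integration.integral_nonneg)
qed

lemma tv_norm_density_le:
  fixes f g :: "'a \<Rightarrow> real"
  assumes f: "integrable M f" "\<And>x. f x \<ge> 0" and g: "integrable M g" "\<And>x. g x \<ge> 0"
  shows "tv_norm (density M f) (density M g) \<le> ennreal (\<integral>x. \<bar>f x - g x\<bar> \<partial>M)"
proof (rule tv_norm_leI)
  fix \<A> assume A: "finite \<A>" "\<A> \<subseteq> sets (density M f)" "disjoint \<A>"
  have int: "integrable M (\<lambda>x. indicator A x * h x)" if "A \<in> \<A>" "integrable M h" for A and h :: "_ \<Rightarrow> real"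
    using that A(2) integrable_real_mult_indicator[of A M h] by (auto simp: mult.commute)
  have "(\<Sum>A\<in>\<A>. \<bar>measure (density M f) A - measure (density M g) A\<bar>)
     = (\<Sum>A\<in>\<A>. \<bar>\<integral>x. indicator A x * (f x - g x) \<partial>M\<bar>)"
    using A f g by (intro sum.cong)
      (auto simp: measure_density_real right_diff_distrib int subset_eq)
  also have "\<dots> \<le> (\<Sum>A\<in>\<A>. \<integral>x. indicator A x * \<bar>f x - g x\<bar> \<partial>M)"
    by (intro sum_mono order_trans[OF integral_abs_bound]) (auto simp: abs_mult)
  also have "\<dots> = (\<integral>x. (\<Sum>A\<in>\<A>. indicator A x * \<bar>f x - g x\<bar>) \<partial>M)"
    using f g by (intro Bochner_Integration.integral_sum[symmetric] int) auto
  also have "\<dots> \<le> (\<integral>x. \<bar>f x - g x\<bar> \<partial>M)"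
  proof (rule integral_mono)
    show "integrable M (\<lambda>x. \<Sum>A\<in>\<A>. indicator A x * \<bar>f x - g x\<bar>)"
      using f g by (intro Bochner_Integration.integrable_sum int) auto
    show "(\<Sum>A\<in>\<A>. indicator A x * \<bar>f x - g x\<bar>) \<le> \<bar>f x - g x\<bar>" for x
      unfolding sum_distrib_right[symmetric]
      using sum_indicator_disjoint_le_1[OF A(1,3), of x] mult_right_mono[of _ 1 "\<bar>f x - g x\<bar>"] by auto
  qed (use f g in auto)
  finally show "(\<Sum>A\<in>\<A>. \<bar>measure (density M f) A - measure (density M g) A\<bar>) \<le> (\<integral>x. \<bar>f x - g x\<bar> \<partial>M)" .
qed

lemma integrable_mult_of_squares:
  fixes f g :: "'a \<Rightarrow> real"
  assumes [measurable]: "f \<in> borel_measurable M" "g \<in> borel_measurable M"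
    and "integrable M (\<lambda>x. (f x)\<^sup>2)" "integrable M (\<lambda>x. (g x)\<^sup>2)"
  shows "integrable M (\<lambda>x. f x * g x)"
proof (rule Bochner_Integration.integrable_bound)
  show "integrable M (\<lambda>x. (f x)\<^sup>2 + (g x)\<^sup>2)" using assms by auto
  show "AE x in M. norm (f x * g x) \<le> norm ((f x)\<^sup>2 + (g x)\<^sup>2)"
  proof (rule AE_I2)
    fix x
    have "2 * (\<bar>f x\<bar> * \<bar>g x\<bar>) \<le> (f x)\<^sup>2 + (g x)\<^sup>2"
      using sum_squares_bound[of "\<bar>f x\<bar>" "\<bar>g x\<bar>"] by (simp add: mult.assoc)
    moreover have "0 \<le> \<bar>f x\<bar> * \<bar>g x\<bar>" by simp
    ultimately show "norm (f x * g x) \<le> norm ((f x)\<^sup>2 + (g x)\<^sup>2)"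
      unfolding real_norm_def abs_mult by linarith
  qed
qed measurable

text \<open>With a and b the two L^2 norms, the weighted inequality |f g| <= (b / 2a) f^2 + (a / 2b)
  g^2 integrates to exactly a b. The weights need a, b > 0; if a norm vanishes, that function is
  zero almost everywhere.\<close>

lemma Cauchy_Schwarz_integral:
  fixes f g :: "'a \<Rightarrow> real"
  assumes [measurable]: "f \<in> borel_measurable M" "g \<in> borel_measurable M"
    and f: "integrable M (\<lambda>x. (f x)\<^sup>2)" and g: "integrable M (\<lambda>x. (g x)\<^sup>2)"
  shows "(\<integral>x. \<bar>f x * g x\<bar> \<partial>M) \<le> sqrt (\<integral>x. (f x)\<^sup>2 \<partial>M) * sqrt (\<integral>x. (g x)\<^sup>2 \<partial>M)"
proof -
  let ?a = "sqrt (\<integral>x. (f x)\<^sup>2 \<partial>M)" and ?b = "sqrt (\<integral>x. (g x)\<^sup>2 \<partial>M)"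
  have ab: "?a \<ge> 0" "?b \<ge> 0" "?a\<^sup>2 = (\<integral>x. (f x)\<^sup>2 \<partial>M)" "?b\<^sup>2 = (\<integral>x. (g x)\<^sup>2 \<partial>M)" by auto
  have fg: "integrable M (\<lambda>x. \<bar>f x * g x\<bar>)"
    using integrable_mult_of_squares[OF _ _ f g] by auto
  consider "?a = 0" | "?b = 0" | "?a > 0" "?b > 0" using ab(1,2) by (metis order_le_less)
  then show ?thesis
  proof cases
    case 1
    then have "AE x in M. (f x)\<^sup>2 = 0"
      using f by (subst (asm) real_sqrt_eq_0_iff, subst (asm) integral_nonneg_eq_0_iff_AE) auto
    then have "(\<integral>x. \<bar>f x * g x\<bar> \<partial>M) = (\<integral>x. 0 \<partial>M)" by (intro integral_cong_AE) auto
    then show ?thesis by simp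
  next
    case 2
    then have "AE x in M. (g x)\<^sup>2 = 0"
      using g by (subst (asm) real_sqrt_eq_0_iff, subst (asm) integral_nonneg_eq_0_iff_AE) auto
    then have "(\<integral>x. \<bar>f x * g x\<bar> \<partial>M) = (\<integral>x. 0 \<partial>M)" by (intro integral_cong_AE) auto
    then show ?thesis by simp
  next
    case 3
    define a b where "a = ?a" and "b = ?b"
    have p: "a > 0" "b > 0" using 3 by (auto simp: a_def b_def)
    have "(\<integral>x. \<bar>f x * g x\<bar> \<partial>M) \<le> (\<integral>x. (b / (2 * a)) * (f x)\<^sup>2 + (a / (2 * b)) * (g x)\<^sup>2 \<partial>M)"
    proof (rule integral_mono[OF fg])
      show "integrable M (\<lambda>x. (b / (2 * a)) * (f x)\<^sup>2 + (a / (2 * b)) * (g x)\<^sup>2)" using f g by auto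
      fix x
      have "0 \<le> (b * \<bar>f x\<bar> - a * \<bar>g x\<bar>)\<^sup>2" by simp
      also have "\<dots> = b\<^sup>2 * (f x)\<^sup>2 + a\<^sup>2 * (g x)\<^sup>2 - 2 * a * b * \<bar>f x * g x\<bar>"
        by (simp add: power2_diff power_mult_distrib abs_mult algebra_simps)
      finally show "\<bar>f x * g x\<bar> \<le> (b / (2 * a)) * (f x)\<^sup>2 + (a / (2 * b)) * (g x)\<^sup>2"
        using p by (simp add: field_simps power2_eq_square)
    qed
    also have "\<dots> = (b / (2 * a)) * a\<^sup>2 + (a / (2 * b)) * b\<^sup>2"
      using f g by (simp add: a_def b_def)
    also have "\<dots> = a * b" using p by (simp add: power2_eq_square field_simps)
    finally show ?thesis by (simp add: a_def b_def)
  qed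
qed

section \<open>Product densities and the Hellinger bound\<close>

text \<open>Measures on a finite product are determined by rectangles, and on a rectangle the
  integral of the product density factors.\<close>

lemma PiM_density:
  assumes M: "prob_space M" and D: "prob_space (density M f)" and [measurable]: "f \<in> borel_measurable M"
    and I: "finite I"
  shows "PiM I (\<lambda>_. density M f) = density (PiM I (\<lambda>_. M)) (\<lambda>x. \<Prod>i\<in>I. f (x i))"
proof -
  interpret M: product_prob_space "\<lambda>_. M" by (auto intro!: product_prob_spaceI M)
  interpret D: product_prob_space "\<lambda>_. density M f" by (auto intro!: product_prob_spaceI D)
  show ?thesis
  proof (rule D.PiM_eqI[OF I, symmetric])
    show "sets (density (PiM I (\<lambda>_. M)) (\<lambda>x. \<Prod>i\<in>I. f (x i))) = sets (PiM I (\<lambda>_. density M f))"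
      by (simp cong: sets_PiM_cong)
    fix A assume A: "\<And>i. i \<in> I \<Longrightarrow> A i \<in> sets (density M f)"
    then have [measurable]: "\<And>i. i \<in> I \<Longrightarrow> A i \<in> sets M" by simp
    have PA: "Pi\<^sub>E I A \<in> sets (PiM I (\<lambda>_. M))" using A I by (auto intro!: sets_PiM_I_finite)
    have "emeasure (density (PiM I (\<lambda>_. M)) (\<lambda>x. \<Prod>i\<in>I. f (x i))) (Pi\<^sub>E I A)
      = (\<integral>\<^sup>+x. (\<Prod>i\<in>I. f (x i)) * indicator (Pi\<^sub>E I A) x \<partial>PiM I (\<lambda>_. M))"
      using PA I by (subst emeasure_density) auto
    also have "\<dots> = (\<integral>\<^sup>+x. (\<Prod>i\<in>I. f (x i) * indicator (A i) (x i)) \<partial>PiM I (\<lambda>_. M))"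
    proof (rule nn_integral_cong)
      fix x assume "x \<in> space (PiM I (\<lambda>_. M))"
      then have "x \<in> extensional I" by (auto simp: space_PiM PiE_def)
      then have "(indicator (Pi\<^sub>E I A) x :: ennreal) = (\<Prod>i\<in>I. indicator (A i) (x i))"
        using I by (auto simp: indicator_def PiE_def Pi_def intro!: prod_zero[symmetric] prod.neutral[symmetric])
      then show "(\<Prod>i\<in>I. f (x i)) * indicator (Pi\<^sub>E I A) x = (\<Prod>i\<in>I. f (x i) * indicator (A i) (x i))"
        by (simp add: prod.distrib)
    qed
    also have "\<dots> = (\<Prod>i\<in>I. \<integral>\<^sup>+y. f y * indicator (A i) y \<partial>M)"
      using I by (intro M.product_nn_integral_prod) auto
    also have "\<dots> = (\<Prod>i\<in>I. emeasure (density M f) (A i))"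
      by (intro prod.cong) (auto simp: emeasure_density)
    finally show "emeasure (density (PiM I (\<lambda>_. M)) (\<lambda>x. \<Prod>i\<in>I. f (x i))) (Pi\<^sub>E I A)
        = (\<Prod>i\<in>I. emeasure (density M f) (A i))" .
  qed
qed

lemma sqrt_prod: "sqrt (\<Prod>i\<in>I. f i) = (\<Prod>i\<in>I. sqrt (f i))"
  by (induction I rule: infinite_finite_induct) (auto simp: real_sqrt_mult)

text \<open>The Hellinger affinity r of the factors becomes \<open>r ^ card I\<close> for the
  products, and Bernoulli's inequality gives \<open>1 - r ^ card I \<le> card I * (1 - r)\<close>.
  The passage from Hellinger to L^1 distance is Cauchy-Schwarz for |F - G| = |sqrt F - sqrt G| (sqrt
  F + sqrt G), where the second factor has squared norm at most 4.\<close>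

lemma tv_norm_PiM_density_le:
  fixes f g :: "'a \<Rightarrow> real"
  assumes M: "prob_space M" and I: "finite I"
    and f: "integrable M f" "\<And>x. f x \<ge> 0" "(\<integral>x. f x \<partial>M) = 1"
    and g: "integrable M g" "\<And>x. g x \<ge> 0" "(\<integral>x. g x \<partial>M) = 1"
  shows "tv_norm (PiM I (\<lambda>_. density M f)) (PiM I (\<lambda>_. density M g))
     \<le> ennreal (2 * sqrt (real (card I) * (\<integral>x. (sqrt (f x) - sqrt (g x))\<^sup>2 \<partial>M)))"
proof -
  interpret M: product_prob_space "\<lambda>_. M" by (auto intro!: product_prob_spaceI M)
  have [measurable]: "f \<in> borel_measurable M" "g \<in> borel_measurable M" using f g by auto
  have P: "prob_space (density M h)" if "integrable M h" "\<And>x. h x \<ge> 0" "(\<integral>x. h x \<partial>M) = 1" for h :: "'a \<Rightarrow> real"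
    using that by (intro prob_spaceI) (auto simp: emeasure_density nn_integral_eq_integral cong: nn_integral_cong)
  have dens: "PiM I (\<lambda>_. density M h) = density (PiM I (\<lambda>_. M)) (\<lambda>x. ennreal (\<Prod>i\<in>I. h (x i)))"
    if "integrable M h" "\<And>x. h x \<ge> 0" "(\<integral>x. h x \<partial>M) = 1" for h :: "'a \<Rightarrow> real"
    using PiM_density[OF M P[OF that] _ I] that by (simp add: prod_ennreal)
  let ?N = "PiM I (\<lambda>_. M)"
  define F where "F x = (\<Prod>i\<in>I. f (x i))" for x
  define G where "G x = (\<Prod>i\<in>I. g (x i))" for x
  define r where "r = (\<integral>x. sqrt (f x) * sqrt (g x) \<partial>M)"
  have F: "integrable ?N F" "\<And>x. F x \<ge> 0" "(\<integral>x. F x \<partial>?N) = 1"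
    unfolding F_def using f M.product_integrable_prod[OF I, of "\<lambda>_. f"] M.product_integral_prod[OF I, of "\<lambda>_. f"]
    by (auto intro!: prod_nonneg)
  have G: "integrable ?N G" "\<And>x. G x \<ge> 0" "(\<integral>x. G x \<partial>?N) = 1"
    unfolding G_def using g M.product_integrable_prod[OF I, of "\<lambda>_. g"] M.product_integral_prod[OF I, of "\<lambda>_. g"]
    by (auto intro!: prod_nonneg)
  have fg: "integrable M (\<lambda>x. sqrt (f x) * sqrt (g x))"
    using f g by (intro integrable_mult_of_squares) auto
  have sFG: "sqrt (F x) * sqrt (G x) = (\<Prod>i\<in>I. sqrt (f (x i)) * sqrt (g (x i)))" for x
    unfolding F_def G_def prod.distrib sqrt_prod ..
  have FG: "integrable ?N (\<lambda>x. sqrt (F x) * sqrt (G x))" "(\<integral>x. sqrt (F x) * sqrt (G x) \<partial>?N) = r ^ card I"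
    unfolding sFG r_def using M.product_integrable_prod[OF I, of "\<lambda>_ x. sqrt (f x) * sqrt (g x)"]
      M.product_integral_prod[OF I, of "\<lambda>_ x. sqrt (f x) * sqrt (g x)"] fg by auto
  have sq: "(sqrt a - sqrt b)\<^sup>2 = a + b - 2 * (sqrt a * sqrt b)" "(sqrt a + sqrt b)\<^sup>2 = a + b + 2 * (sqrt a * sqrt b)"
    if "a \<ge> 0" "b \<ge> 0" for a b :: real
    using that by (auto simp: power2_diff power2_sum)
  have h2: "(\<integral>x. (sqrt (f x) - sqrt (g x))\<^sup>2 \<partial>M) = 2 - 2 * r"
    using f g fg by (simp add: sq r_def)
  then have r1: "r \<le> 1"
    using Bochner_Integration.integral_nonneg[of M "\<lambda>x. (sqrt (f x) - sqrt (g x))\<^sup>2"] by auto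
  have r0: "r \<ge> 0" unfolding r_def using f g by (intro Bochner_Integration.integral_nonneg) auto
  have D: "integrable ?N (\<lambda>x. (sqrt (F x) - sqrt (G x))\<^sup>2)" "(\<integral>x. (sqrt (F x) - sqrt (G x))\<^sup>2 \<partial>?N) = 2 - 2 * r ^ card I"
    using F G FG by (simp_all add: sq)
  have S: "integrable ?N (\<lambda>x. (sqrt (F x) + sqrt (G x))\<^sup>2)" "(\<integral>x. (sqrt (F x) + sqrt (G x))\<^sup>2 \<partial>?N) = 2 + 2 * r ^ card I"
    using F G FG by (simp_all add: sq)
  have [measurable]: "F \<in> borel_measurable ?N" "G \<in> borel_measurable ?N" using F G by auto
  have rn: "r ^ card I \<le> 1" "1 - r ^ card I \<le> real (card I) * (1 - r)"
    using r0 r1 Bernoulli_inequality[of "r - 1" "card I"] by (auto simp: power_le_one algebra_simps)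
  have "tv_norm (PiM I (\<lambda>_. density M f)) (PiM I (\<lambda>_. density M g))
     \<le> ennreal (\<integral>x. \<bar>F x - G x\<bar> \<partial>?N)"
    unfolding dens[OF f] dens[OF g] F_def[symmetric] G_def[symmetric]
    by (rule tv_norm_density_le[OF F(1,2) G(1,2)])
  also have "(\<integral>x. \<bar>F x - G x\<bar> \<partial>?N) = (\<integral>x. \<bar>(sqrt (F x) - sqrt (G x)) * (sqrt (F x) + sqrt (G x))\<bar> \<partial>?N)"
    using F G by (intro Bochner_Integration.integral_cong refl arg_cong[where f=abs]) (simp add: algebra_simps)
  also have "\<dots> \<le> sqrt (2 - 2 * r ^ card I) * sqrt (2 + 2 * r ^ card I)"
    using Cauchy_Schwarz_integral[OF _ _ D(1) S(1)] by (simp add: D(2) S(2))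
  also have "\<dots> \<le> sqrt (real (card I) * (2 - 2 * r)) * sqrt 4"
    using rn r0 by (intro mult_mono real_sqrt_le_mono) (auto simp: algebra_simps)
  finally show ?thesis unfolding h2 by (simp add: ennreal_leI mult.commute)
qed

text \<open>The measure \<open>\<mu>\<close> need not be a probability, so a product of copies of it
  is avoided: both densities are rewritten relative to the probability measure with density
  \<open>w = (p + q) / 2\<close>, which dominates both, and the Hellinger integral does not
  change.\<close>

lemma tv_norm_PiM_le_hellinger:
  fixes p q :: "'a \<Rightarrow> real"
  assumes I: "finite I"
    and p: "integrable \<mu> p" "\<And>x. p x \<ge> 0" "(\<integral>x. p x \<partial>\<mu>) = 1"
    and q: "integrable \<mu> q" "\<And>x. q x \<ge> 0" "(\<integral>x. q x \<partial>\<mu>) = 1"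
  shows "tv_norm (PiM I (\<lambda>_. density \<mu> p)) (PiM I (\<lambda>_. density \<mu> q))
     \<le> ennreal (2 * sqrt (real (card I) * (\<integral>x. (sqrt (p x) - sqrt (q x))\<^sup>2 \<partial>\<mu>)))"
proof -
  have [measurable]: "p \<in> borel_measurable \<mu>" "q \<in> borel_measurable \<mu>" using p q by auto
  define w where "w x = (p x + q x) / 2" for x
  have w: "integrable \<mu> w" "\<And>x. w x \<ge> 0" "(\<integral>x. w x \<partial>\<mu>) = 1"
    unfolding w_def using p q by auto
  have [measurable]: "w \<in> borel_measurable \<mu>" using w by auto
  let ?M = "density \<mu> w"
  have M: "prob_space ?M"
    using w by (intro prob_spaceI) (auto simp: emeasure_density nn_integral_eq_integral cong: nn_integral_cong)
  \<comment> \<open>Where \<open>w x = 0\<close>, both \<open>p x\<close> and \<open>q x\<close>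
    vanish by nonnegativity, so the identities survive division by zero.\<close>
  have pw: "w x * (p x / w x) = p x" "w x * (q x / w x) = q x" for x
    using p(2)[of x] q(2)[of x] by (auto simp: w_def)
  have *: "density \<mu> h = density ?M (\<lambda>x. ennreal (h x / w x))" "integrable ?M (\<lambda>x. h x / w x)" "(\<integral>x. h x / w x \<partial>?M) = (\<integral>x. h x \<partial>\<mu>)"
    if h: "integrable \<mu> h" "\<And>x. h x \<ge> 0" "\<And>x. w x * (h x / w x) = h x" for h
  proof -
    have [measurable]: "h \<in> borel_measurable \<mu>" using h by auto
    have "density ?M (\<lambda>x. ennreal (h x / w x)) = density \<mu> (\<lambda>x. ennreal (w x) * ennreal (h x / w x))"
      by (rule density_density_eq) measurable
    also have "\<dots> = density \<mu> h"
      using h w(2) by (simp add: ennreal_mult'[symmetric] h(3))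
    finally show "density \<mu> h = density ?M (\<lambda>x. ennreal (h x / w x))" ..
    show "integrable ?M (\<lambda>x. h x / w x)" using h w(2) by (subst integrable_real_density) (auto simp del: times_divide_eq_right simp: h(3))
    show "(\<integral>x. h x / w x \<partial>?M) = (\<integral>x. h x \<partial>\<mu>)" using w(2) by (subst integral_real_density) (auto simp del: times_divide_eq_right simp: h(3))
  qed
  note P = *[OF p(1,2) pw(1)] and Q = *[OF q(1,2) pw(2)]
  have "(\<integral>x. (sqrt (p x / w x) - sqrt (q x / w x))\<^sup>2 \<partial>?M) = (\<integral>x. w x * (sqrt (p x / w x) - sqrt (q x / w x))\<^sup>2 \<partial>\<mu>)"
    using w(2) by (subst integral_real_density) auto
  also have "\<dots> = (\<integral>x. (sqrt (p x) - sqrt (q x))\<^sup>2 \<partial>\<mu>)"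
  proof (intro Bochner_Integration.integral_cong refl)
    fix x
    have "w x * (sqrt (p x / w x) - sqrt (q x / w x))\<^sup>2 = (sqrt (w x) * (sqrt (p x / w x) - sqrt (q x / w x)))\<^sup>2"
      using w(2)[of x] by (simp add: power_mult_distrib)
    also have "sqrt (w x) * (sqrt (p x / w x) - sqrt (q x / w x)) = sqrt (w x * (p x / w x)) - sqrt (w x * (q x / w x))"
      by (simp only: right_diff_distrib real_sqrt_mult)
    finally show "w x * (sqrt (p x / w x) - sqrt (q x / w x))\<^sup>2 = (sqrt (p x) - sqrt (q x))\<^sup>2"
      by (simp only: pw)
  qed
  finally have h: "(\<integral>x. (sqrt (p x / w x) - sqrt (q x / w x))\<^sup>2 \<partial>?M) = (\<integral>x. (sqrt (p x) - sqrt (q x))\<^sup>2 \<partial>\<mu>)" .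
  show ?thesis
    unfolding P(1) Q(1)
    using tv_norm_PiM_density_le[OF M I P(2) _ _ Q(2)] P(3) Q(3) p q w(2) unfolding h by auto
qed

section \<open>Square root densities\<close>

definition square_integrable :: "'a measure \<Rightarrow> ('a \<Rightarrow> real) \<Rightarrow> bool" where
  "square_integrable M f \<longleftrightarrow> f \<in> borel_measurable M \<and> integrable M (\<lambda>x. (f x)\<^sup>2)"

lemma square_integrable_mult: "square_integrable M f \<Longrightarrow> square_integrable M g \<Longrightarrow> integrable M (\<lambda>x. f x * g x)"
  unfolding square_integrable_def by (intro integrable_mult_of_squares) auto

lemma square_integrable_cmult: "square_integrable M f \<Longrightarrow> square_integrable M (\<lambda>x. c * f x)"
  unfolding square_integrable_def by (auto simp: power_mult_distrib)

lemma square_integrable_add: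
  assumes f: "square_integrable M f" and g: "square_integrable M g"
  shows "square_integrable M (\<lambda>x. f x + g x)"
  using square_integrable_mult[OF f g] f g
  unfolding square_integrable_def by (auto simp: power2_sum mult.assoc)

lemma square_integrable_diff:
  assumes f: "square_integrable M f" and g: "square_integrable M g"
  shows "square_integrable M (\<lambda>x. f x - g x)"
  using square_integrable_add[OF f square_integrable_cmult[OF g, of "-1"]] by simp

lemma square_integrable_Cauchy_Schwarz:
  assumes f: "square_integrable M f" and g: "square_integrable M g"
  shows "\<bar>\<integral>x. f x * g x \<partial>M\<bar> \<le> sqrt (\<integral>x. (f x)\<^sup>2 \<partial>M) * sqrt (\<integral>x. (g x)\<^sup>2 \<partial>M)"
  using assms unfolding square_integrable_def
  by (intro order_trans[OF integral_abs_bound Cauchy_Schwarz_integral]) auto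

section \<open>Elementary bounds for score moments and truncation\<close>

lemma exists_Basis_norm_le:
  fixes v :: "'a::euclidean_space"
  shows "\<exists>b\<in>Basis. norm v \<le> DIM('a) * \<bar>v \<bullet> b\<bar>"
proof (rule ccontr)
  assume "\<not> ?thesis"
  then have "\<And>b. b \<in> Basis \<Longrightarrow> DIM('a) * \<bar>v \<bullet> b\<bar> < norm v" by force
  then have "(\<Sum>b\<in>(Basis :: 'a set). DIM('a) * \<bar>v \<bullet> b\<bar>) < (\<Sum>b\<in>(Basis :: 'a set). norm v)"
    by (intro sum_strict_mono) auto
  then have "DIM('a) * (\<Sum>b\<in>Basis. \<bar>v \<bullet> b\<bar>) < DIM('a) * norm v"
    by (simp add: sum_distrib_left)
  moreover have "norm v \<le> (\<Sum>b\<in>Basis. \<bar>v \<bullet> b\<bar>)" by (rule norm_le_l1)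
  ultimately show False by simp
qed

text \<open>Some coordinate carries at least the fraction 1/DIM of the norm, and one of its two
  signs makes the exponent nonnegative. Exponential moments of linear forms, which are all that the
  model assumes, thereby bound those of the norm.\<close>

lemma exp_norm_le_sum_exp_inner:
  fixes v :: "'a::euclidean_space"
  assumes "c \<ge> 0"
  shows "exp (c * norm v) \<le> (\<Sum>b\<in>Basis. exp (((c * DIM('a)) *\<^sub>R b) \<bullet> v) + exp ((- (c * DIM('a)) *\<^sub>R b) \<bullet> v))"
proof -
  obtain b where b: "b \<in> Basis" "norm v \<le> DIM('a) * \<bar>v \<bullet> b\<bar>" using exists_Basis_norm_le[of v] by auto
  have "c * norm v \<le> c * (DIM('a) * \<bar>v \<bullet> b\<bar>)" using b assms by (intro mult_left_mono) auto
  then have "exp (c * norm v) \<le> exp (\<bar>(c * DIM('a)) * (b \<bullet> v)\<bar>)"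
    using assms by (simp add: abs_mult inner_commute mult.assoc)
  also have "\<dots> \<le> exp (((c * DIM('a)) *\<^sub>R b) \<bullet> v) + exp ((- (c * DIM('a)) *\<^sub>R b) \<bullet> v)"
    by (cases "(c * DIM('a)) * (b \<bullet> v) \<ge> 0") (auto simp: abs_if less_imp_le)
  also have "\<dots> \<le> (\<Sum>b\<in>Basis. exp (((c * DIM('a)) *\<^sub>R b) \<bullet> v) + exp ((- (c * DIM('a)) *\<^sub>R b) \<bullet> v))"
    using b(1) by (intro member_le_sum) (auto intro: add_nonneg_nonneg)
  finally show ?thesis .
qed

text \<open>The quotient \<open>x ^ k / fact k\<close> is a single term of the nonnegative series
  for exp x, so a power is absorbed by raising the rate of the exponential by one.\<close>

lemma power_mult_exp_le:
  fixes x c :: real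
  assumes "x \<ge> 0"
  shows "x ^ k * exp (c * x) \<le> fact k * exp ((c + 1) * x)"
proof -
  have "(\<Sum>j\<in>{k}. x ^ j /\<^sub>R fact j) \<le> (\<Sum>j. x ^ j /\<^sub>R fact j)"
    using assms by (intro sum_le_suminf sums_summable[OF exp_converges]) auto
  then have "x ^ k / fact k \<le> exp x" by (simp add: exp_def divide_inverse mult.commute)
  then have "x ^ k \<le> fact k * exp x" by (simp add: field_simps)
  then show ?thesis by (simp add: exp_add distrib_right mult.assoc[symmetric] mult_right_mono)
qed

text \<open>For L > 0 this is the radial projection onto the ball of radius L, a truncation that is
  continuous, unlike multiplication by an indicator.\<close>

definition clip :: "real \<Rightarrow> 'a::real_normed_vector \<Rightarrow> 'a" where
  "clip L v = (1 / max 1 (norm v / L)) *\<^sub>R v"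

lemma norm_clip_le: "L > 0 \<Longrightarrow> norm (clip L v) \<le> L"
  by (auto simp: clip_def max_def field_simps)

text \<open>The difference is nonzero only where norm v > L, and there norm v is at most its square
  over L. Squared and integrated, truncation costs a fourth moment divided by L^2.\<close>

lemma norm_diff_clip_le:
  assumes "L > 0" shows "norm (v - clip L v) \<le> (norm v)\<^sup>2 / L"
proof (cases "norm v \<le> L")
  case True then show ?thesis using assms by (simp add: clip_def max_def field_simps)
next
  case False
  then have v: "norm v > L" "v \<noteq> 0" using assms by auto
  have "v - clip L v = (1 - L / norm v) *\<^sub>R v"
    using v assms by (simp add: clip_def max_def scaleR_diff_left)
  then have "norm (v - clip L v) = (1 - L / norm v) * norm v"
    using v assms by simp
  also have "\<dots> \<le> norm v" using v assms by (simp add: field_simps)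
  also have "\<dots> \<le> (norm v)\<^sup>2 / L" using v assms by (simp add: field_simps power2_eq_square)
  finally show ?thesis .
qed

lemma continuous_clip: "L > 0 \<Longrightarrow> continuous_on UNIV (clip L)"
  unfolding clip_def by (intro continuous_intros) (auto simp: max_def)

lemma clip_measurable [measurable]: "L > 0 \<Longrightarrow> clip L \<in> borel_measurable borel"
  by (intro borel_measurable_continuous_onI continuous_clip)

lemma norm_sum4_sq_le:
  fixes a b c d :: "'a::real_normed_vector"
  shows "(norm (a + b + c + d))\<^sup>2 \<le> 4 * ((norm a)\<^sup>2 + (norm b)\<^sup>2 + (norm c)\<^sup>2 + (norm d)\<^sup>2)"
proof -
  have "norm (a + b + c + d) \<le> norm a + norm b + norm c + norm d"
    by (meson add_mono norm_triangle_ineq order_trans order_refl)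
  then have "(norm (a + b + c + d))\<^sup>2 \<le> (norm a + norm b + norm c + norm d)\<^sup>2"
    by (intro power_mono) auto
  also have "\<dots> \<le> 4 * ((norm a)\<^sup>2 + (norm b)\<^sup>2 + (norm c)\<^sup>2 + (norm d)\<^sup>2)"
  proof -
    have "0 \<le> (x - y)\<^sup>2 + (x - z)\<^sup>2 + (x - w)\<^sup>2 + (y - z)\<^sup>2 + (y - w)\<^sup>2 + (z - w)\<^sup>2" for x y z w :: real by simp
    from this[of "norm a" "norm b" "norm c" "norm d"] show ?thesis
      by (simp add: power2_eq_square algebra_simps)
  qed
  finally show ?thesis .
qed

lemma norm_add_sq_le:
  fixes a b :: "'a::real_normed_vector"
  shows "(norm (a + b))\<^sup>2 \<le> 2 * (norm a)\<^sup>2 + 2 * (norm b)\<^sup>2"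
proof -
  have "(norm (a + b))\<^sup>2 \<le> (norm a + norm b)\<^sup>2" by (intro power_mono norm_triangle_ineq) auto
  also have "\<dots> \<le> 2 * (norm a)\<^sup>2 + 2 * (norm b)\<^sup>2"
    using sum_squares_bound[of "norm a" "norm b"] by (simp add: power2_sum)
  finally show ?thesis .
qed

section \<open>Densities, their square roots and score moments\<close>

locale regular_model =
  fixes \<mu> :: "'a measure" and \<Theta> :: "(real^'m::finite) set"
    and p :: "real^'m \<Rightarrow> 'a \<Rightarrow> real" and l :: "real^'m \<Rightarrow> 'a \<Rightarrow> real^'m"
  assumes open_Theta: "open \<Theta>"
    and p_measurable [measurable]: "\<And>\<theta>. \<theta> \<in> \<Theta> \<Longrightarrow> p \<theta> \<in> borel_measurable \<mu>"
    and p_nonneg: "\<And>\<theta> x. \<theta> \<in> \<Theta> \<Longrightarrow> p \<theta> x \<ge> 0"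
    and nn_integral_p: "\<And>\<theta>. \<theta> \<in> \<Theta> \<Longrightarrow> (\<integral>\<^sup>+ x. ennreal (p \<theta> x) \<partial>\<mu>) = 1"
    and l_measurable [measurable]: "\<And>\<theta>. \<theta> \<in> \<Theta> \<Longrightarrow> l \<theta> \<in> borel_measurable \<mu>"
    and cont_dqm: "continuous_dqm \<mu> \<Theta> p l"
    and exp_moments: "\<And>K h. compact K \<Longrightarrow> K \<subseteq> \<Theta> \<Longrightarrow>
           (SUP \<theta>\<in>K. \<integral>\<^sup>+ x. ennreal (exp (h \<bullet> l \<theta> x)) \<partial>(model \<mu> p \<theta>)) < \<infinity>"
    and fisher_invertible: "\<And>\<theta>. \<theta> \<in> \<Theta> \<Longrightarrow> invertible (fisher_info \<mu> p l \<theta>)"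
begin

definition sroot :: "real^'m \<Rightarrow> 'a \<Rightarrow> real" where "sroot \<theta> x = sqrt (p \<theta> x)"
text \<open>Twice the derivative of \<open>sroot\<close> with respect to the parameter, in the sense
  of L^2(\<open>\<mu>\<close>). Working with it moves the analysis to the fixed space
  L^2(\<open>\<mu>\<close>) although the laws \<open>P \<theta>\<close> vary.\<close>

definition grad :: "real^'m \<Rightarrow> 'a \<Rightarrow> real^'m" where "grad \<theta> x = sroot \<theta> x *\<^sub>R l \<theta> x"

abbreviation P where "P \<equiv> model \<mu> p"

lemma sroot_measurable [measurable]: "\<theta> \<in> \<Theta> \<Longrightarrow> sroot \<theta> \<in> borel_measurable \<mu>"
  unfolding sroot_def by measurable

lemma grad_measurable [measurable]: "\<theta> \<in> \<Theta> \<Longrightarrow> grad \<theta> \<in> borel_measurable \<mu>"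
  unfolding grad_def by measurable

lemma sets_P [simp, measurable_cong]: "sets (P \<theta>) = sets \<mu>" by (simp add: model_def)
lemma space_P [simp]: "space (P \<theta>) = space \<mu>" by (simp add: model_def)

lemma prob_space_P: "\<theta> \<in> \<Theta> \<Longrightarrow> prob_space (P \<theta>)"
  by (intro prob_spaceI) (simp add: model_def emeasure_density nn_integral_p cong: nn_integral_cong)

lemma integrable_p: "\<theta> \<in> \<Theta> \<Longrightarrow> integrable \<mu> (p \<theta>)"
  by (rule integrableI_bounded) (auto simp: p_nonneg nn_integral_p)

lemma integral_p: "\<theta> \<in> \<Theta> \<Longrightarrow> (\<integral>x. p \<theta> x \<partial>\<mu>) = 1"
  by (subst integral_eq_nn_integral) (auto simp: p_nonneg nn_integral_p)

lemma integrable_P: "\<theta> \<in> \<Theta> \<Longrightarrow> f \<in> borel_measurable \<mu> \<Longrightarrow> integrable (P \<theta>) f \<longleftrightarrow> integrable \<mu> (\<lambda>x. p \<theta> x * f x)"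
  for f :: "'a \<Rightarrow> real"
  unfolding model_def by (subst integrable_real_density) (auto simp: p_nonneg)

lemma integral_P: "\<theta> \<in> \<Theta> \<Longrightarrow> f \<in> borel_measurable \<mu> \<Longrightarrow> (\<integral>x. f x \<partial>P \<theta>) = (\<integral>x. p \<theta> x * f x \<partial>\<mu>)"
  for f :: "'a \<Rightarrow> real"
  unfolding model_def by (subst integral_real_density) (auto simp: p_nonneg)

lemma sroot_sq: "\<theta> \<in> \<Theta> \<Longrightarrow> (sroot \<theta> x)\<^sup>2 = p \<theta> x"
  by (simp add: sroot_def p_nonneg)

lemma uniform_moments:
  assumes K: "compact K" "K \<subseteq> \<Theta>" and c: "c \<ge> 0"
  obtains C where "C \<ge> 0" "\<And>\<theta>. \<theta> \<in> K \<Longrightarrow> integrable (P \<theta>) (\<lambda>x. norm (l \<theta> x) ^ k * exp (c * norm (l \<theta> x)))"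
     "\<And>\<theta>. \<theta> \<in> K \<Longrightarrow> (\<integral>x. norm (l \<theta> x) ^ k * exp (c * norm (l \<theta> x)) \<partial>P \<theta>) \<le> C"
proof -
  let ?S = "\<lambda>h. (SUP \<theta>\<in>K. \<integral>\<^sup>+ x. ennreal (exp (h \<bullet> l \<theta> x)) \<partial>(P \<theta>))"
  \<comment> \<open>The rate is raised from c to c + 1 to absorb the k-th power; the dimension is
    the price for replacing the norm by a single coordinate.\<close>
  let ?a = "(c + 1) * real DIM(real^'m)"
  define B where "B = ennreal (fact k) * (\<Sum>b\<in>Basis. ?S (?a *\<^sub>R b) + ?S (- ?a *\<^sub>R b))"
  have "(\<Sum>b\<in>Basis. ?S (?a *\<^sub>R b) + ?S (- ?a *\<^sub>R b)) < top"
  proof -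
    have "?S h < top" for h using exp_moments[OF K, of h] by simp
    then show ?thesis by (simp only: ennreal_sum_less_top[OF finite_Basis] ennreal_add_less_top) blast
  qed
  then have B: "B < top" unfolding B_def by (simp add: ennreal_mult_less_top)
  have le: "(\<integral>\<^sup>+x. ennreal (norm (l \<theta> x) ^ k * exp (c * norm (l \<theta> x))) \<partial>P \<theta>) \<le> B" if \<theta>: "\<theta> \<in> K" for \<theta>
  proof -
    have [measurable]: "\<theta> \<in> \<Theta>" using \<theta> K by auto
    have S: "(\<integral>\<^sup>+x. ennreal (exp (h \<bullet> l \<theta> x)) \<partial>P \<theta>) \<le> ?S h" for h
      by (rule SUP_upper[OF \<theta>])
    have "(\<integral>\<^sup>+x. ennreal (norm (l \<theta> x) ^ k * exp (c * norm (l \<theta> x))) \<partial>P \<theta>)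
       \<le> (\<integral>\<^sup>+x. ennreal (fact k) * (\<Sum>b\<in>Basis. ennreal (exp ((?a *\<^sub>R b) \<bullet> l \<theta> x)) + ennreal (exp ((- ?a *\<^sub>R b) \<bullet> l \<theta> x))) \<partial>P \<theta>)"
    proof (rule nn_integral_mono)
      fix x
      have "norm (l \<theta> x) ^ k * exp (c * norm (l \<theta> x)) \<le> fact k * exp ((c + 1) * norm (l \<theta> x))"
        by (rule power_mult_exp_le) simp
      also have "\<dots> \<le> fact k * (\<Sum>b\<in>Basis. exp ((?a *\<^sub>R b) \<bullet> l \<theta> x) + exp ((- ?a *\<^sub>R b) \<bullet> l \<theta> x))"
        using exp_norm_le_sum_exp_inner[of "c + 1" "l \<theta> x"] c by (intro mult_left_mono) auto
      finally have *: "norm (l \<theta> x) ^ k * exp (c * norm (l \<theta> x)) \<le> \<dots>" .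
      show "ennreal (norm (l \<theta> x) ^ k * exp (c * norm (l \<theta> x)))
        \<le> ennreal (fact k) * (\<Sum>b\<in>Basis. ennreal (exp ((?a *\<^sub>R b) \<bullet> l \<theta> x)) + ennreal (exp ((- ?a *\<^sub>R b) \<bullet> l \<theta> x)))"
      proof -
        have "(\<Sum>b\<in>Basis. ennreal (exp ((?a *\<^sub>R b) \<bullet> l \<theta> x)) + ennreal (exp ((- ?a *\<^sub>R b) \<bullet> l \<theta> x)))
           = ennreal (\<Sum>b\<in>Basis. exp ((?a *\<^sub>R b) \<bullet> l \<theta> x) + exp ((- ?a *\<^sub>R b) \<bullet> l \<theta> x))"
          by (subst sum_ennreal[symmetric]) (auto simp: add_nonneg_nonneg)
        then show ?thesis using * by (simp only: ennreal_mult'[symmetric] fact_ge_zero ennreal_leI)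
      qed
    qed
    also have "\<dots> = ennreal (fact k) * (\<Sum>b\<in>Basis. (\<integral>\<^sup>+x. ennreal (exp ((?a *\<^sub>R b) \<bullet> l \<theta> x)) \<partial>P \<theta>)
         + (\<integral>\<^sup>+x. ennreal (exp ((- ?a *\<^sub>R b) \<bullet> l \<theta> x)) \<partial>P \<theta>))"
      by (simp add: nn_integral_cmult nn_integral_sum nn_integral_add)
    also have "\<dots> \<le> B"
      unfolding B_def by (intro mult_left_mono sum_mono add_mono S) auto
    finally show ?thesis .
  qed
  show ?thesis
  proof (rule that[of "enn2real B"])
    fix \<theta> assume \<theta>: "\<theta> \<in> K"
    then have [measurable]: "\<theta> \<in> \<Theta>" using K by auto
    show *: "integrable (P \<theta>) (\<lambda>x. norm (l \<theta> x) ^ k * exp (c * norm (l \<theta> x)))"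
      using le[OF \<theta>] B by (intro integrableI_bounded) (auto simp: abs_mult)
    have "ennreal (\<integral>x. norm (l \<theta> x) ^ k * exp (c * norm (l \<theta> x)) \<partial>P \<theta>) \<le> B"
      using le[OF \<theta>] by (subst nn_integral_eq_integral[OF *, symmetric]) auto
    then show "(\<integral>x. norm (l \<theta> x) ^ k * exp (c * norm (l \<theta> x)) \<partial>P \<theta>) \<le> enn2real B"
      using B ennreal_le_iff[of "enn2real B"] by (simp add: less_top)
  qed simp
qed

lemma integrable_moment:
  assumes "\<theta> \<in> \<Theta>" shows "integrable (P \<theta>) (\<lambda>x. norm (l \<theta> x) ^ k)"
proof -
  obtain C where "\<And>\<theta>'. \<theta>' \<in> {\<theta>} \<Longrightarrow> integrable (P \<theta>') (\<lambda>x. norm (l \<theta>' x) ^ k * exp (0 * norm (l \<theta>' x)))"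
    by (rule uniform_moments[of "{\<theta>}" 0 k]) (use assms in auto)
  then show ?thesis by simp
qed

lemma square_integrable_sroot: "\<theta> \<in> \<Theta> \<Longrightarrow> square_integrable \<mu> (sroot \<theta>)"
  by (simp add: square_integrable_def sroot_sq integrable_p)

lemma norm_grad_sq: "\<theta> \<in> \<Theta> \<Longrightarrow> (norm (grad \<theta> x))\<^sup>2 = p \<theta> x * (norm (l \<theta> x))\<^sup>2"
  by (simp add: grad_def power_mult_distrib sroot_sq)

lemma integrable_norm_grad_sq: "\<theta> \<in> \<Theta> \<Longrightarrow> integrable \<mu> (\<lambda>x. (norm (grad \<theta> x))\<^sup>2)"
  using integrable_moment[of \<theta> 2] by (simp add: norm_grad_sq integrable_P)

lemma square_integrable_inner:
  fixes f :: "'a \<Rightarrow> real^'m"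
  assumes [measurable]: "f \<in> borel_measurable \<mu>" and "integrable \<mu> (\<lambda>x. (norm (f x))\<^sup>2)"
  shows "square_integrable \<mu> (\<lambda>x. d \<bullet> f x)"
  unfolding square_integrable_def
proof
  show "integrable \<mu> (\<lambda>x. (d \<bullet> f x)\<^sup>2)"
  proof (rule Bochner_Integration.integrable_bound)
    show "integrable \<mu> (\<lambda>x. (norm d)\<^sup>2 * (norm (f x))\<^sup>2)" using assms by auto
    show "AE x in \<mu>. norm ((d \<bullet> f x)\<^sup>2) \<le> norm ((norm d)\<^sup>2 * (norm (f x))\<^sup>2)"
      using power_mono[OF Cauchy_Schwarz_ineq2, of d _ 2] by (auto simp: power_mult_distrib)
  qed measurable
qed measurable

lemma square_integrable_inner_grad: "\<theta> \<in> \<Theta> \<Longrightarrow> square_integrable \<mu> (\<lambda>x. d \<bullet> grad \<theta> x)"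
  by (intro square_integrable_inner integrable_norm_grad_sq) auto

lemma square_integrable_remainder:
  "\<theta> \<in> \<Theta> \<Longrightarrow> \<theta>' \<in> \<Theta> \<Longrightarrow> square_integrable \<mu> (\<lambda>x. sroot \<theta>' x - sroot \<theta> x - (1/2) * (d \<bullet> grad \<theta> x))"
  by (intro square_integrable_diff square_integrable_cmult square_integrable_sroot square_integrable_inner_grad)

text \<open>The limit of extended real quotients in \<open>dqm\<close> becomes a bound on Lebesgue
  integrals that also covers h = 0. The radius is shrunk so that \<open>\<theta> + h\<close> stays
  in \<open>\<Theta>\<close>, because \<open>dqm\<close> itself evaluates \<open>p\<close> there
  without asking for membership.\<close>

lemma dqm_remainder:
  assumes \<theta>: "\<theta> \<in> \<Theta>" and \<epsilon>: "\<epsilon> > 0"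
  obtains \<rho> where "\<rho> > 0" "\<And>h. norm h < \<rho> \<Longrightarrow> \<theta> + h \<in> \<Theta>"
    "\<And>h. norm h < \<rho> \<Longrightarrow> (\<integral>x. (sroot (\<theta> + h) x - sroot \<theta> x - (1/2) * (h \<bullet> grad \<theta> x))\<^sup>2 \<partial>\<mu>) \<le> \<epsilon> * (norm h)\<^sup>2"
proof -
  obtain \<rho>1 where \<rho>1: "\<rho>1 > 0" "ball \<theta> \<rho>1 \<subseteq> \<Theta>"
    using open_Theta \<theta> by (meson openE)
  let ?N = "\<lambda>h. \<integral>\<^sup>+ x. ennreal ((sqrt (p (\<theta> + h) x) - sqrt (p \<theta> x)
                   - (1/2) * (h \<bullet> l \<theta> x) * sqrt (p \<theta> x))\<^sup>2) \<partial>\<mu>"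
  have "((\<lambda>h. ?N h / ennreal ((norm h)\<^sup>2)) \<longlongrightarrow> 0) (at 0)"
    using cont_dqm \<theta> by (auto simp: continuous_dqm_def dqm_def)
  then have "eventually (\<lambda>h. ?N h / ennreal ((norm h)\<^sup>2) < ennreal \<epsilon>) (at 0)"
    using \<epsilon> by (intro order_tendstoD(2)) auto
  then obtain \<rho>2 where \<rho>2: "\<rho>2 > 0"
    "\<And>h. h \<noteq> 0 \<Longrightarrow> norm h < \<rho>2 \<Longrightarrow> ?N h / ennreal ((norm h)\<^sup>2) < ennreal \<epsilon>"
    by (auto simp: eventually_at dist_norm)
  show ?thesis
  proof (rule that[of "min \<rho>1 \<rho>2"])
    fix h :: "real^'m" assume h: "norm h < min \<rho>1 \<rho>2"
    show \<theta>h: "\<theta> + h \<in> \<Theta>" using h \<rho>1 by (auto simp: ball_def dist_norm subset_eq)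
    show "(\<integral>x. (sroot (\<theta> + h) x - sroot \<theta> x - (1/2) * (h \<bullet> grad \<theta> x))\<^sup>2 \<partial>\<mu>) \<le> \<epsilon> * (norm h)\<^sup>2"
    proof (cases "h = 0")
      case True then show ?thesis by simp
    next
      case False
      have eq: "?N h = (\<integral>\<^sup>+x. ennreal ((sroot (\<theta> + h) x - sroot \<theta> x - (1/2) * (h \<bullet> grad \<theta> x))\<^sup>2) \<partial>\<mu>)"
        by (simp add: sroot_def grad_def mult_ac)
      have "?N h / ennreal ((norm h)\<^sup>2) < ennreal \<epsilon>" using \<rho>2 False h by auto
      then have "?N h \<le> ennreal \<epsilon> * ennreal ((norm h)\<^sup>2)"
      proof (rule contrapos_pp)
        assume "\<not> ?N h \<le> ennreal \<epsilon> * ennreal ((norm h)\<^sup>2)"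
        then have "ennreal \<epsilon> * ennreal ((norm h)\<^sup>2) / ennreal ((norm h)\<^sup>2) \<le> ?N h / ennreal ((norm h)\<^sup>2)"
          by (intro divide_right_mono_ennreal) auto
        moreover have "ennreal \<epsilon> * ennreal ((norm h)\<^sup>2) / ennreal ((norm h)\<^sup>2) = ennreal \<epsilon>"
          using False by (intro mult_divide_eq_ennreal) auto
        ultimately show "\<not> ?N h / ennreal ((norm h)\<^sup>2) < ennreal \<epsilon>" by (simp add: not_less)
      qed
      also have "\<dots> = ennreal (\<epsilon> * (norm h)\<^sup>2)" using \<epsilon> by (simp add: ennreal_mult')
      finally have "ennreal (\<integral>x. (sroot (\<theta> + h) x - sroot \<theta> x - (1/2) * (h \<bullet> grad \<theta> x))\<^sup>2 \<partial>\<mu>) \<le> ennreal (\<epsilon> * (norm h)\<^sup>2)"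
        unfolding eq using square_integrable_remainder[OF \<theta> \<theta>h, of h]
        by (subst nn_integral_eq_integral[symmetric]) (auto simp: square_integrable_def)
      then show ?thesis using \<epsilon> by (subst (asm) ennreal_le_iff) auto
    qed
  qed (use \<rho>1 \<rho>2 in auto)
qed

section \<open>Continuity and differentiability of the square root densities in L^2\<close>

lemma sroot_continuous_L2:
  assumes \<theta>: "\<theta> \<in> \<Theta>" and \<eta>: "\<And>k. \<eta> k \<in> \<Theta>" "\<eta> \<longlonglongrightarrow> \<theta>"
  shows "(\<lambda>k. \<integral>x. (sroot (\<eta> k) x - sroot \<theta> x)\<^sup>2 \<partial>\<mu>) \<longlonglongrightarrow> 0"
proof -
  obtain \<rho> where \<rho>: "\<rho> > 0" "\<And>h. norm h < \<rho> \<Longrightarrow> \<theta> + h \<in> \<Theta>"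
    "\<And>h. norm h < \<rho> \<Longrightarrow> (\<integral>x. (sroot (\<theta> + h) x - sroot \<theta> x - (1/2) * (h \<bullet> grad \<theta> x))\<^sup>2 \<partial>\<mu>) \<le> 1 * (norm h)\<^sup>2"
    by (rule dqm_remainder[OF \<theta>, of 1]) auto
  define G where "G = (\<integral>x. (norm (grad \<theta> x))\<^sup>2 \<partial>\<mu>)"
  have "(\<integral>x. (sroot (\<eta> k) x - sroot \<theta> x)\<^sup>2 \<partial>\<mu>) \<le> (2 + G) * (norm (\<eta> k - \<theta>))\<^sup>2" if "norm (\<eta> k - \<theta>) < \<rho>" for k
  proof -
    let ?h = "\<eta> k - \<theta>"
    let ?r = "\<lambda>x. sroot (\<theta> + ?h) x - sroot \<theta> x - (1/2) * (?h \<bullet> grad \<theta> x)"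
    have sr: "square_integrable \<mu> ?r" using \<theta> \<eta> by (intro square_integrable_remainder) auto
    have "(\<integral>x. (sroot (\<eta> k) x - sroot \<theta> x)\<^sup>2 \<partial>\<mu>) \<le> (\<integral>x. 2 * (?r x)\<^sup>2 + (norm ?h)\<^sup>2 * (norm (grad \<theta> x))\<^sup>2 \<partial>\<mu>)"
    proof (rule integral_mono)
      show "integrable \<mu> (\<lambda>x. (sroot (\<eta> k) x - sroot \<theta> x)\<^sup>2)"
        using square_integrable_diff[OF square_integrable_sroot[OF \<eta>(1)] square_integrable_sroot[OF \<theta>]]
        by (simp add: square_integrable_def)
      show "integrable \<mu> (\<lambda>x. 2 * (?r x)\<^sup>2 + (norm ?h)\<^sup>2 * (norm (grad \<theta> x))\<^sup>2)"
        using sr integrable_norm_grad_sq[OF \<theta>] by (auto simp: square_integrable_def)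
      fix x
      have "(?h \<bullet> grad \<theta> x)\<^sup>2 \<le> (norm ?h)\<^sup>2 * (norm (grad \<theta> x))\<^sup>2"
        using power_mono[OF Cauchy_Schwarz_ineq2, of ?h "grad \<theta> x" 2] by (auto simp: power_mult_distrib)
      moreover have "(sroot (\<eta> k) x - sroot \<theta> x)\<^sup>2 \<le> 2 * (?r x)\<^sup>2 + 2 * ((1/2) * (?h \<bullet> grad \<theta> x))\<^sup>2"
        using norm_add_sq_le[of "?r x" "(1/2) * (?h \<bullet> grad \<theta> x)"]
        unfolding real_norm_def power2_abs by simp
      moreover have "2 * ((1/2) * (?h \<bullet> grad \<theta> x))\<^sup>2 \<le> (?h \<bullet> grad \<theta> x)\<^sup>2"
        by (simp add: power_mult_distrib power_divide)
      ultimately show "(sroot (\<eta> k) x - sroot \<theta> x)\<^sup>2 \<le> 2 * (?r x)\<^sup>2 + (norm ?h)\<^sup>2 * (norm (grad \<theta> x))\<^sup>2"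
        by linarith
    qed
    also have "\<dots> = 2 * (\<integral>x. (?r x)\<^sup>2 \<partial>\<mu>) + (norm ?h)\<^sup>2 * G"
      using sr integrable_norm_grad_sq[OF \<theta>] by (simp add: square_integrable_def G_def)
    also have "\<dots> \<le> 2 * (1 * (norm ?h)\<^sup>2) + (norm ?h)\<^sup>2 * G"
      using \<rho>(3)[OF that] by (intro add_mono mult_left_mono) auto
    finally show ?thesis by (simp add: algebra_simps)
  qed
  moreover have "eventually (\<lambda>k. norm (\<eta> k - \<theta>) < \<rho>) sequentially"
    using tendstoD[OF \<eta>(2) \<rho>(1)] by (simp add: dist_norm)
  ultimately have le: "eventually (\<lambda>k. (\<integral>x. (sroot (\<eta> k) x - sroot \<theta> x)\<^sup>2 \<partial>\<mu>) \<le> (2 + G) * (norm (\<eta> k - \<theta>))\<^sup>2) sequentially"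
    by (auto elim: eventually_mono)
  have "(\<lambda>k. (2 + G) * (norm (\<eta> k - \<theta>))\<^sup>2) \<longlonglongrightarrow> (2 + G) * (norm (\<theta> - \<theta>))\<^sup>2"
    by (intro tendsto_intros \<eta>(2))
  then have lim: "(\<lambda>k. (2 + G) * (norm (\<eta> k - \<theta>))\<^sup>2) \<longlonglongrightarrow> 0" by simp
  show ?thesis
    by (rule tendsto_sandwich[OF _ le tendsto_const lim]) auto
qed


text \<open>By Cauchy-Schwarz the error of the difference quotient is at most the L^2 norm of the
  remainder times that of \<open>v\<close>, divided by the increment. Real-valued pairings suffice
  here, since they admit the mean value theorem and the criterion for extrema.\<close>

lemma sroot_weak_derivative:
  assumes \<theta>: "\<theta> \<in> \<Theta>" and v: "square_integrable \<mu> v"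
  shows "((\<lambda>t. \<integral>x. sroot (\<theta> + t *\<^sub>R d) x * v x \<partial>\<mu>) has_real_derivative (\<integral>x. (1/2) * (d \<bullet> grad \<theta> x) * v x \<partial>\<mu>)) (at 0)"
  unfolding DERIV_def
proof (rule tendstoI)
  fix e :: real assume e: "e > 0"
  define V where "V = sqrt (\<integral>x. (v x)\<^sup>2 \<partial>\<mu>)"
  have V: "V \<ge> 0" by (simp add: V_def)
  \<comment> \<open>The summand 1 keeps the denominator positive and makes
    \<open>norm d * V / ?w\<close> strictly less than 1.\<close>
  let ?w = "norm d * V + 1"
  have w: "?w > 0" using V by (intro add_nonneg_pos) auto
  obtain \<rho> where \<rho>: "\<rho> > 0" "\<And>h. norm h < \<rho> \<Longrightarrow> \<theta> + h \<in> \<Theta>"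
    "\<And>h. norm h < \<rho> \<Longrightarrow> (\<integral>x. (sroot (\<theta> + h) x - sroot \<theta> x - (1/2) * (h \<bullet> grad \<theta> x))\<^sup>2 \<partial>\<mu>) \<le> (e / ?w)\<^sup>2 * (norm h)\<^sup>2"
    by (rule dqm_remainder[OF \<theta>, of "(e / ?w)\<^sup>2"]) (use e w in auto)
  let ?f = "\<lambda>t. \<integral>x. sroot (\<theta> + t *\<^sub>R d) x * v x \<partial>\<mu>" and ?D = "\<integral>x. (1/2) * (d \<bullet> grad \<theta> x) * v x \<partial>\<mu>"
  have *: "dist ((?f (0 + h) - ?f 0) / h) ?D < e" if h: "h \<noteq> 0" "\<bar>h\<bar> * (norm d + 1) < \<rho>" for h
  proof -
    have "\<bar>h\<bar> * norm d \<le> \<bar>h\<bar> * (norm d + 1)" by (simp add: algebra_simps)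
    then have hd: "norm (h *\<^sub>R d) < \<rho>" unfolding norm_scaleR using h(2) by linarith
    note \<theta>' = \<rho>(2)[OF hd]
    let ?r = "\<lambda>x. sroot (\<theta> + h *\<^sub>R d) x - sroot \<theta> x - (1/2) * ((h *\<^sub>R d) \<bullet> grad \<theta> x)"
    have r: "square_integrable \<mu> ?r" by (rule square_integrable_remainder[OF \<theta> \<theta>'])
    have i: "integrable \<mu> (\<lambda>x. sroot (\<theta> + h *\<^sub>R d) x * v x)" "integrable \<mu> (\<lambda>x. sroot \<theta> x * v x)"
       "integrable \<mu> (\<lambda>x. (d \<bullet> grad \<theta> x) * v x)"
      using \<theta> \<theta>' v by (auto intro!: square_integrable_mult square_integrable_sroot square_integrable_inner_grad)
    have "?f (0 + h) - ?f 0 - h * ?D = (\<integral>x. sroot (\<theta> + h *\<^sub>R d) x * v x - sroot \<theta> x * v x - (h / 2) * ((d \<bullet> grad \<theta> x) * v x) \<partial>\<mu>)"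
      using i by (simp add: mult.assoc)
    also have "\<dots> = (\<integral>x. ?r x * v x \<partial>\<mu>)"
      by (intro Bochner_Integration.integral_cong) (auto simp: algebra_simps)
    finally have "\<bar>?f (0 + h) - ?f 0 - h * ?D\<bar> \<le> sqrt (\<integral>x. (?r x)\<^sup>2 \<partial>\<mu>) * V"
      using square_integrable_Cauchy_Schwarz[OF r v] by (simp add: V_def)
    also have "\<dots> \<le> sqrt ((e / ?w)\<^sup>2 * (norm (h *\<^sub>R d))\<^sup>2) * V"
      using \<rho>(3)[OF hd] V by (intro mult_right_mono real_sqrt_le_mono) auto
    also have "\<dots> = e / ?w * (\<bar>h\<bar> * norm d) * V"
      using e w by (simp add: real_sqrt_mult)
    also have "\<dots> = \<bar>h\<bar> * (e * ((norm d * V) / ?w))" by simp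
    also have "\<dots> < \<bar>h\<bar> * (e * 1)"
      using w h e by (intro mult_strict_left_mono) auto
    finally have lt: "\<bar>?f (0 + h) - ?f 0 - h * ?D\<bar> < \<bar>h\<bar> * e" by simp
    have "\<bar>A - h * D\<bar> < \<bar>h\<bar> * e \<Longrightarrow> dist (A / h) D < e" for A D
    proof -
      assume "\<bar>A - h * D\<bar> < \<bar>h\<bar> * e"
      moreover have "A / h - D = (A - h * D) / h" using h(1) by (simp add: field_simps)
      ultimately show "dist (A / h) D < e" using h(1) by (simp add: dist_real_def divide_less_eq mult.commute)
    qed
    from this[OF lt] show ?thesis .
  qed
  have "\<rho> / (norm d + 1) > 0" using \<rho>(1) by (intro divide_pos_pos add_nonneg_pos) auto
  moreover have "\<bar>h\<bar> * (norm d + 1) < \<rho>" if "\<bar>h\<bar> < \<rho> / (norm d + 1)" for h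
    using that by (simp add: pos_less_divide_eq add_nonneg_pos)
  ultimately show "eventually (\<lambda>h. dist ((?f (0 + h) - ?f 0) / h) ?D < e) (at 0)"
    unfolding eventually_at
    by (intro exI[of _ "\<rho> / (norm d + 1)"] conjI ballI impI *) (auto simp: dist_real_def)
qed

lemma l_continuous: "x \<in> space \<mu> \<Longrightarrow> continuous_on \<Theta> (\<lambda>\<theta>. l \<theta> x)"
  using cont_dqm by (auto simp: continuous_dqm_def)

text \<open>The score is continuous only pointwise, and the weights \<open>p (\<eta> k)\<close> vary
  with k. Clipping the score at level L makes it bounded, so that L^2 continuity of
  \<open>sroot\<close> and dominated convergence apply; the clipping errors are O(1 / L^2) uniformly
  in k because fourth moments are bounded on the compact set of all \<open>\<eta> k\<close> and
  \<open>\<theta>\<close>.\<close>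

lemma grad_continuous_L2:
  assumes \<theta>: "\<theta> \<in> \<Theta>" and \<eta>: "\<And>k. \<eta> k \<in> \<Theta>" "\<eta> \<longlonglongrightarrow> \<theta>"
  shows "(\<lambda>k. \<integral>x. (norm (grad (\<eta> k) x - grad \<theta> x))\<^sup>2 \<partial>\<mu>) \<longlonglongrightarrow> 0"
proof -
  have K1: "compact (insert \<theta> (range \<eta>))"
    by (rule compact_sequence_with_limit[OF \<eta>(2)])
  have K2: "insert \<theta> (range \<eta>) \<subseteq> \<Theta>"
    using \<theta> \<eta>(1) by blast
  note K = K1 K2
  obtain C where C: "C \<ge> 0"
     "\<And>\<theta>'. \<theta>' \<in> insert \<theta> (range \<eta>) \<Longrightarrow> integrable (P \<theta>') (\<lambda>x. norm (l \<theta>' x) ^ 4 * exp (0 * norm (l \<theta>' x)))"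
     "\<And>\<theta>'. \<theta>' \<in> insert \<theta> (range \<eta>) \<Longrightarrow> (\<integral>x. norm (l \<theta>' x) ^ 4 * exp (0 * norm (l \<theta>' x)) \<partial>P \<theta>') \<le> C"
    by (rule uniform_moments[OF K, of 0 4]) auto
  have C': "integrable \<mu> (\<lambda>x. p \<theta>' x * norm (l \<theta>' x) ^ 4)" "(\<integral>x. p \<theta>' x * norm (l \<theta>' x) ^ 4 \<partial>\<mu>) \<le> C"
    if "\<theta>' \<in> insert \<theta> (range \<eta>)" for \<theta>'
  proof -
    have t[measurable]: "\<theta>' \<in> \<Theta>" using that K(2) by auto
    show "integrable \<mu> (\<lambda>x. p \<theta>' x * norm (l \<theta>' x) ^ 4)" "(\<integral>x. p \<theta>' x * norm (l \<theta>' x) ^ 4 \<partial>\<mu>) \<le> C"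
      using C(2,3)[OF that] by (simp_all add: integrable_P integral_P t)
  qed
  define a where "a k = (\<integral>x. (sroot (\<eta> k) x - sroot \<theta> x)\<^sup>2 \<partial>\<mu>)" for k
  have a: "a \<longlonglongrightarrow> 0" unfolding a_def by (rule sroot_continuous_L2[OF \<theta> \<eta>])
  have ai: "integrable \<mu> (\<lambda>x. (sroot (\<eta> k) x - sroot \<theta> x)\<^sup>2)" for k
    using square_integrable_diff[OF square_integrable_sroot[OF \<eta>(1)] square_integrable_sroot[OF \<theta>]]
    by (simp add: square_integrable_def)
  \<comment> \<open>The weight is \<open>p \<theta>\<close> for all k, so dominated convergence with
    the pointwise continuity of the clipped score applies.\<close>
  define b where "b L k = (\<integral>x. p \<theta> x * (norm (clip L (l (\<eta> k) x) - clip L (l \<theta> x)))\<^sup>2 \<partial>\<mu>)" for L k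
  have clip_le: "(norm (clip L u - clip L v))\<^sup>2 \<le> 4 * L\<^sup>2" if "L > 0" for L and u v :: "real^'m"
  proof -
    have "norm (clip L u - clip L v) \<le> 2 * L"
      using norm_triangle_ineq4[of "clip L u" "clip L v"] norm_clip_le[OF that, of u] norm_clip_le[OF that, of v] by linarith
    then have "(norm (clip L u - clip L v))\<^sup>2 \<le> (2 * L)\<^sup>2" by (intro power_mono) auto
    then show ?thesis by (simp add: power_mult_distrib)
  qed
  have bdom: "integrable \<mu> (\<lambda>x. (4 * L\<^sup>2) * p \<theta> x)" for L using integrable_p[OF \<theta>] by auto
  have bb: "norm (p \<theta> x * (norm (clip L (l (\<eta> k) x) - clip L (l \<theta> x)))\<^sup>2) \<le> (4 * L\<^sup>2) * p \<theta> x" if "L > 0" for L k x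
    using mult_left_mono[OF clip_le[OF that, of "l (\<eta> k) x" "l \<theta> x"] p_nonneg[OF \<theta>, of x]] p_nonneg[OF \<theta>, of x]
    by (simp add: abs_mult mult_ac)
  have bi: "integrable \<mu> (\<lambda>x. p \<theta> x * (norm (clip L (l (\<eta> k) x) - clip L (l \<theta> x)))\<^sup>2)" if [arith]: "L > 0" for L k
    using \<theta> \<eta>(1)[of k] bb[OF that] 
    by (intro Bochner_Integration.integrable_bound[OF bdom[of L]]) (auto intro: order_trans[OF _ abs_ge_self])
  have b: "b L \<longlonglongrightarrow> 0" if L: "L > 0" for L
  proof -
    have "b L \<longlonglongrightarrow> (\<integral>x. 0 \<partial>\<mu>)" unfolding b_def
    proof (rule integral_dominated_convergence)
      show "integrable \<mu> (\<lambda>x. (4 * L\<^sup>2) * p \<theta> x)" by (rule bdom)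
      show "AE x in \<mu>. norm (p \<theta> x * (norm (clip L (l (\<eta> k) x) - clip L (l \<theta> x)))\<^sup>2) \<le> (4 * L\<^sup>2) * p \<theta> x" for k
        using bb[OF L] by auto
      show "AE x in \<mu>. (\<lambda>k. p \<theta> x * (norm (clip L (l (\<eta> k) x) - clip L (l \<theta> x)))\<^sup>2) \<longlonglongrightarrow> 0"
      proof (rule AE_I2)
        fix x assume x: "x \<in> space \<mu>"
        have "(\<lambda>k. l (\<eta> k) x) \<longlonglongrightarrow> l \<theta> x"
          by (rule continuous_on_tendsto_compose[OF l_continuous[OF x] \<eta>(2) \<theta>]) (use \<eta>(1) in auto)
        then have "(\<lambda>k. clip L (l (\<eta> k) x)) \<longlonglongrightarrow> clip L (l \<theta> x)"
          by (rule continuous_on_tendsto_compose[OF continuous_clip[OF L]]) auto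
        then have "(\<lambda>k. p \<theta> x * (norm (clip L (l (\<eta> k) x) - clip L (l \<theta> x)))\<^sup>2) \<longlonglongrightarrow> p \<theta> x * (norm (clip L (l \<theta> x) - clip L (l \<theta> x)))\<^sup>2"
          by (intro tendsto_intros)
        then show "(\<lambda>k. p \<theta> x * (norm (clip L (l (\<eta> k) x) - clip L (l \<theta> x)))\<^sup>2) \<longlonglongrightarrow> 0" by simp
      qed
    qed (use \<theta> \<eta>(1) L in measurable)
    then show ?thesis by simp
  qed
  have main: "(\<integral>x. (norm (grad (\<eta> k) x - grad \<theta> x))\<^sup>2 \<partial>\<mu>) \<le> 8 * C / L\<^sup>2 + (4 * L\<^sup>2 * a k + 4 * b L k)" if L: "L > 0" for L k
  proof -
    note \<eta>k = \<eta>(1)[of k]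
    let ?R = "\<lambda>x. 4 * (p (\<eta> k) x * norm (l (\<eta> k) x) ^ 4 / L\<^sup>2 + L\<^sup>2 * (sroot (\<eta> k) x - sroot \<theta> x)\<^sup>2
        + p \<theta> x * (norm (clip L (l (\<eta> k) x) - clip L (l \<theta> x)))\<^sup>2 + p \<theta> x * norm (l \<theta> x) ^ 4 / L\<^sup>2)"
    have Ri: "integrable \<mu> ?R"
      using C'(1)[of "\<eta> k"] C'(1)[of \<theta>] ai bi[OF L] by auto
    have le: "(norm (grad (\<eta> k) x - grad \<theta> x))\<^sup>2 \<le> ?R x" for x
    proof -
      \<comment> \<open>Four pieces: clipping error at \<open>\<eta> k\<close>, change of the root
        density against a bounded score, change of the clipped score under the fixed root density,
        clipping error at \<open>\<theta>\<close>.\<close>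
      let ?a = "sroot (\<eta> k) x *\<^sub>R (l (\<eta> k) x - clip L (l (\<eta> k) x))"
      let ?b = "(sroot (\<eta> k) x - sroot \<theta> x) *\<^sub>R clip L (l (\<eta> k) x)"
      let ?c = "sroot \<theta> x *\<^sub>R (clip L (l (\<eta> k) x) - clip L (l \<theta> x))"
      let ?d = "sroot \<theta> x *\<^sub>R (clip L (l \<theta> x) - l \<theta> x)"
      have eq: "grad (\<eta> k) x - grad \<theta> x = ?a + ?b + ?c + ?d"
        by (simp add: grad_def algebra_simps)
      have n4: "(norm v)\<^sup>2 \<le> norm w ^ 4 / L\<^sup>2" if "norm v \<le> (norm w)\<^sup>2 / L" for v w :: "real^'m"
        using power_mono[OF that, of 2] by (simp add: power_divide flip: power_mult)
      have "(norm ?a)\<^sup>2 \<le> p (\<eta> k) x * norm (l (\<eta> k) x) ^ 4 / L\<^sup>2"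
        using mult_left_mono[OF n4[OF norm_diff_clip_le[OF L, of "l (\<eta> k) x"]] p_nonneg[OF \<eta>k, of x]]
        by (simp add: power_mult_distrib sroot_sq[OF \<eta>k])
      moreover have "(norm ?b)\<^sup>2 \<le> L\<^sup>2 * (sroot (\<eta> k) x - sroot \<theta> x)\<^sup>2"
        using power_mono[OF norm_clip_le[OF L, of "l (\<eta> k) x"], of 2]
        by (simp add: power_mult_distrib mult.commute[of "L\<^sup>2"] mult_left_mono)
      moreover have "(norm ?c)\<^sup>2 = p \<theta> x * (norm (clip L (l (\<eta> k) x) - clip L (l \<theta> x)))\<^sup>2"
        by (simp add: power_mult_distrib sroot_sq[OF \<theta>])
      moreover have "(norm ?d)\<^sup>2 \<le> p \<theta> x * norm (l \<theta> x) ^ 4 / L\<^sup>2"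
        using mult_left_mono[OF n4[OF norm_diff_clip_le[OF L, of "l \<theta> x"]] p_nonneg[OF \<theta>, of x]]
        by (simp add: power_mult_distrib sroot_sq[OF \<theta>] norm_minus_commute)
      ultimately show ?thesis
        unfolding eq by (intro order_trans[OF norm_sum4_sq_le] mult_left_mono add_mono) simp_all
    qed
    have "(\<integral>x. (norm (grad (\<eta> k) x - grad \<theta> x))\<^sup>2 \<partial>\<mu>) \<le> (\<integral>x. ?R x \<partial>\<mu>)"
    proof (rule integral_mono[OF _ Ri le])
      show "integrable \<mu> (\<lambda>x. (norm (grad (\<eta> k) x - grad \<theta> x))\<^sup>2)"
        using \<theta> \<eta>k le by (intro Bochner_Integration.integrable_bound[OF Ri]) (auto intro: order_trans[OF _ abs_ge_self])
    qed
    also have "\<dots> = 4 * ((\<integral>x. p (\<eta> k) x * norm (l (\<eta> k) x) ^ 4 \<partial>\<mu>) / L\<^sup>2 + L\<^sup>2 * a k + b L k + (\<integral>x. p \<theta> x * norm (l \<theta> x) ^ 4 \<partial>\<mu>) / L\<^sup>2)"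
      using C'(1)[of "\<eta> k"] C'(1)[of \<theta>] ai bi[OF L] by (simp add: a_def b_def)
    also have "\<dots> \<le> 4 * (C / L\<^sup>2 + L\<^sup>2 * a k + b L k + C / L\<^sup>2)"
      using C'(2)[of "\<eta> k"] C'(2)[of \<theta>] by (intro mult_left_mono add_mono divide_right_mono) auto
    finally show ?thesis by (simp add: algebra_simps)
  qed
  show ?thesis
  proof (rule LIMSEQ_I)
    fix e :: real assume e: "e > 0"
    \<comment> \<open>With this level \<open>8 * C / L\<^sup>2\<close> equals e C / (2 (C + 1)),
      which is below e; C + 1 instead of C keeps L positive. The level is fixed before k tends to
      infinity.\<close>
    define L where "L = sqrt (16 * (C + 1) / e)"
    have L: "L > 0" "L\<^sup>2 = 16 * (C + 1) / e" using C(1) e by (auto simp: L_def)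
    have "8 * C / L\<^sup>2 < e" using C(1) e by (simp add: L field_simps add_pos_nonneg)
    moreover have "(\<lambda>k. 4 * L\<^sup>2 * a k + 4 * b L k) \<longlonglongrightarrow> 4 * L\<^sup>2 * 0 + 4 * 0"
      by (intro tendsto_intros a b L)
    ultimately have "eventually (\<lambda>k. 4 * L\<^sup>2 * a k + 4 * b L k < e - 8 * C / L\<^sup>2) sequentially"
      by (intro order_tendstoD(2)[of _ 0]) auto
    then show "\<exists>no. \<forall>n\<ge>no. norm ((\<integral>x. (norm (grad (\<eta> n) x - grad \<theta> x))\<^sup>2 \<partial>\<mu>) - 0) < e"
      unfolding eventually_sequentially
    proof (elim exE, intro exI allI impI)
      fix N n assume *: "\<forall>n\<ge>N. 4 * L\<^sup>2 * a n + 4 * b L n < e - 8 * C / L\<^sup>2" "n \<ge> N"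
      then have "(\<integral>x. (norm (grad (\<eta> n) x - grad \<theta> x))\<^sup>2 \<partial>\<mu>) < e"
        using main[OF L(1), of n] by fastforce
      moreover have "(\<integral>x. (norm (grad (\<eta> n) x - grad \<theta> x))\<^sup>2 \<partial>\<mu>) \<ge> 0" by simp
      ultimately show "norm ((\<integral>x. (norm (grad (\<eta> n) x - grad \<theta> x))\<^sup>2 \<partial>\<mu>) - 0) < e" by simp
    qed
  qed
qed

end

lemma borel_measurable_vec_nth [measurable (raw)]:
  fixes f :: "'a \<Rightarrow> real^'n::finite"
  assumes "f \<in> borel_measurable M"
  shows "(\<lambda>x. f x $ i) \<in> borel_measurable M"
proof -
  have "(\<lambda>x. f x \<bullet> axis i 1) \<in> borel_measurable M" using assms by measurable
  then show ?thesis by (simp add: inner_axis)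
qed

context regular_model begin

lemma grad_continuous_eps:
  assumes \<theta>: "\<theta> \<in> \<Theta>" and \<epsilon>: "\<epsilon> > 0"
  obtains \<rho> where "\<rho> > 0" "ball \<theta> \<rho> \<subseteq> \<Theta>"
    "\<And>\<eta>. \<eta> \<in> ball \<theta> \<rho> \<Longrightarrow> (\<integral>x. (norm (grad \<eta> x - grad \<theta> x))\<^sup>2 \<partial>\<mu>) < \<epsilon>"
proof -
  obtain \<rho>1 where \<rho>1: "\<rho>1 > 0" "ball \<theta> \<rho>1 \<subseteq> \<Theta>"
    using open_Theta \<theta> by (meson openE)
  let ?F = "\<lambda>\<eta>. \<integral>x. (norm (grad \<eta> x - grad \<theta> x))\<^sup>2 \<partial>\<mu>"
  have "continuous (at \<theta> within \<Theta>) ?F"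
    unfolding continuous_within_sequentially
    using grad_continuous_L2[OF \<theta>] by (auto simp: comp_def)
  then have c: "\<forall>e>0. \<exists>d>0. \<forall>\<eta>\<in>\<Theta>. dist \<eta> \<theta> < d \<longrightarrow> dist (?F \<eta>) (?F \<theta>) < e"
    unfolding continuous_within_eps_delta .
  from c[THEN spec, THEN mp, OF \<epsilon>] obtain \<rho>2 where \<rho>2: "\<rho>2 > 0" "\<And>\<eta>. \<eta> \<in> \<Theta> \<Longrightarrow> dist \<eta> \<theta> < \<rho>2 \<Longrightarrow> dist (?F \<eta>) (?F \<theta>) < \<epsilon>"
    by (elim exE conjE) (rule that, assumption, blast)
  show ?thesis
  proof (rule that[of "min \<rho>1 \<rho>2"])
    show "ball \<theta> (min \<rho>1 \<rho>2) \<subseteq> \<Theta>" using \<rho>1(2) by auto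
    fix \<eta> assume \<eta>: "\<eta> \<in> ball \<theta> (min \<rho>1 \<rho>2)"
    then have "dist (?F \<eta>) (?F \<theta>) < \<epsilon>" using \<rho>1(2) by (intro \<rho>2) (auto simp: dist_commute)
    then show "?F \<eta> < \<epsilon>" by (simp add: dist_real_def)
  qed (use \<rho>1 \<rho>2 in auto)
qed

lemma integrable_norm_grad_diff_sq:
  assumes [measurable]: "\<theta> \<in> \<Theta>" "\<eta> \<in> \<Theta>"
  shows "integrable \<mu> (\<lambda>x. (norm (grad \<eta> x - grad \<theta> x))\<^sup>2)"
proof (rule Bochner_Integration.integrable_bound)
  show "integrable \<mu> (\<lambda>x. 2 * (norm (grad \<eta> x))\<^sup>2 + 2 * (norm (grad \<theta> x))\<^sup>2)"
    using integrable_norm_grad_sq assms by auto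
  show "AE x in \<mu>. norm ((norm (grad \<eta> x - grad \<theta> x))\<^sup>2) \<le> norm (2 * (norm (grad \<eta> x))\<^sup>2 + 2 * (norm (grad \<theta> x))\<^sup>2)"
    using norm_add_sq_le[of "grad \<eta> _" "- grad \<theta> _"] by auto
qed measurable

text \<open>Pairing the remainder of the expansion of the square root density with itself turns the mean
  value theorem for real functions into one for maps into \<open>L\<^sup>2\<close>.\<close>

lemma uniform_dqm_remainder:
  assumes \<theta>: "\<theta> \<in> \<Theta>" and \<epsilon>: "\<epsilon> > 0"
  obtains \<rho> where "\<rho> > 0"
    "\<And>\<theta>' d. dist \<theta> \<theta>' < \<rho> \<Longrightarrow> norm d < \<rho> \<Longrightarrow> \<theta>' \<in> \<Theta> \<and> \<theta>' + d \<in> \<Theta> \<and>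
       (\<integral>x. (sroot (\<theta>' + d) x - sroot \<theta>' x - (1/2) * (d \<bullet> grad \<theta>' x))\<^sup>2 \<partial>\<mu>) \<le> \<epsilon> * (norm d)\<^sup>2"
proof -
  obtain \<rho> where \<rho>: "\<rho> > 0" "ball \<theta> \<rho> \<subseteq> \<Theta>"
    "\<And>\<eta>. \<eta> \<in> ball \<theta> \<rho> \<Longrightarrow> (\<integral>x. (norm (grad \<eta> x - grad \<theta> x))\<^sup>2 \<partial>\<mu>) < \<epsilon>"
    by (rule grad_continuous_eps[OF \<theta> \<epsilon>]) blast
  show ?thesis
  proof (rule that[of "\<rho> / 2"])
    fix \<theta>' d :: "real^'m" assume *: "dist \<theta> \<theta>' < \<rho> / 2" "norm d < \<rho> / 2"
    have seg: "\<theta>' + t *\<^sub>R d \<in> ball \<theta> \<rho>" if "0 \<le> t" "t \<le> 1" for t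
    proof -
      have "dist \<theta> (\<theta>' + t *\<^sub>R d) \<le> dist \<theta> \<theta>' + dist \<theta>' (\<theta>' + t *\<^sub>R d)" by (rule dist_triangle)
      also have "dist \<theta>' (\<theta>' + t *\<^sub>R d) \<le> norm d" using that by (simp add: dist_norm mult_left_le_one_le)
      finally show ?thesis using * by simp
    qed
    have \<theta>': "\<theta>' \<in> \<Theta>" "\<theta>' + d \<in> \<Theta>" using seg[of 0] seg[of 1] \<rho>(2) by auto
    have \<theta>'b: "\<theta>' \<in> ball \<theta> \<rho>" using seg[of 0] by simp
    define v where "v x = sroot (\<theta>' + d) x - sroot \<theta>' x - (1/2) * (d \<bullet> grad \<theta>' x)" for x
    have v: "square_integrable \<mu> v"
      unfolding v_def by (rule square_integrable_remainder[OF \<theta>'])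
    define D where "D t = (\<integral>x. (1/2) * (d \<bullet> grad (\<theta>' + t *\<^sub>R d) x) * v x \<partial>\<mu>)" for t
    \<comment> \<open>The linear term is subtracted so that \<open>F 1 - F 0\<close> is the pairing
      of the remainder \<open>v\<close> with itself, while the derivative of F at t involves only
      the difference of \<open>grad\<close> at \<open>\<theta>' + t *\<^sub>R d\<close> and at
      \<open>\<theta>'\<close>.\<close>
    define F where "F t = (\<integral>x. sroot (\<theta>' + t *\<^sub>R d) x * v x \<partial>\<mu>) - t * D 0" for t
    have der: "(F has_real_derivative D t - D 0) (at t)" if t: "0 \<le> t" "t \<le> 1" for t
    proof -
      have "\<theta>' + t *\<^sub>R d \<in> \<Theta>" using seg[OF t] \<rho>(2) by auto
      from sroot_weak_derivative[OF this v, of d]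
      have "((\<lambda>s. \<integral>x. sroot (\<theta>' + t *\<^sub>R d + s *\<^sub>R d) x * v x \<partial>\<mu>) has_real_derivative D t) (at (t + - t))"
        by (simp add: D_def)
      then have "((\<lambda>s. \<integral>x. sroot (\<theta>' + t *\<^sub>R d + (s + - t) *\<^sub>R d) x * v x \<partial>\<mu>) has_real_derivative D t) (at t)"
        by (subst (asm) DERIV_shift)
      then have "((\<lambda>s. \<integral>x. sroot (\<theta>' + s *\<^sub>R d) x * v x \<partial>\<mu>) has_real_derivative D t) (at t)"
        by (simp add: scaleR_left_diff_distrib)
      then show ?thesis unfolding F_def
        by (auto intro!: derivative_eq_intros)
    qed
    obtain t where t: "0 < t" "t < 1" "F 1 - F 0 = (1 - 0) * (D t - D 0)"
      using MVT2[of 0 1 F "\<lambda>t. D t - D 0"] der by auto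
    have t\<Theta>: "\<theta>' + t *\<^sub>R d \<in> \<Theta>" "\<theta>' + t *\<^sub>R d \<in> ball \<theta> \<rho>" using seg[of t] t \<rho>(2) by auto
    have i: "integrable \<mu> (\<lambda>x. sroot (\<theta>' + d) x * v x)" "integrable \<mu> (\<lambda>x. sroot \<theta>' x * v x)"
       "integrable \<mu> (\<lambda>x. (d \<bullet> grad \<theta>' x) * v x)" "integrable \<mu> (\<lambda>x. (d \<bullet> grad (\<theta>' + t *\<^sub>R d) x) * v x)"
      using \<theta>' t\<Theta> v by (auto intro!: square_integrable_mult square_integrable_sroot square_integrable_inner_grad)
    let ?G = "\<lambda>x. grad (\<theta>' + t *\<^sub>R d) x - grad \<theta>' x"
    have Gi: "integrable \<mu> (\<lambda>x. (norm (?G x))\<^sup>2)" by (rule integrable_norm_grad_diff_sq) fact+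
    have dG: "square_integrable \<mu> (\<lambda>x. d \<bullet> ?G x)"
      using \<theta>' t\<Theta> by (intro square_integrable_inner Gi) auto
    have vi: "integrable \<mu> (\<lambda>x. (v x)\<^sup>2)" using v by (simp add: square_integrable_def)
    have "(\<integral>x. (v x)\<^sup>2 \<partial>\<mu>) = (\<integral>x. sroot (\<theta>' + d) x * v x - sroot \<theta>' x * v x - (1/2) * ((d \<bullet> grad \<theta>' x) * v x) \<partial>\<mu>)"
      by (intro Bochner_Integration.integral_cong refl) (simp add: v_def power2_eq_square algebra_simps)
    also have "\<dots> = F 1 - F 0"
      using i by (simp add: F_def D_def mult.assoc)
    also have "\<dots> = D t - D 0" using t by simp
    also have "\<dots> = (\<integral>x. (1/2) * ((d \<bullet> grad (\<theta>' + t *\<^sub>R d) x) * v x) - (1/2) * ((d \<bullet> grad \<theta>' x) * v x) \<partial>\<mu>)"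
      using i by (simp add: D_def mult.assoc)
    also have "\<dots> = (1/2) * (\<integral>x. (d \<bullet> ?G x) * v x \<partial>\<mu>)"
      unfolding integral_mult_right_zero[symmetric]
      by (intro Bochner_Integration.integral_cong refl) (simp add: inner_diff_right algebra_simps)
    also have "\<dots> \<le> (1/2) * (sqrt (\<integral>x. (d \<bullet> ?G x)\<^sup>2 \<partial>\<mu>) * sqrt (\<integral>x. (v x)\<^sup>2 \<partial>\<mu>))"
      using square_integrable_Cauchy_Schwarz[OF dG v] by (intro mult_left_mono) auto
    finally have le: "(\<integral>x. (v x)\<^sup>2 \<partial>\<mu>) \<le> (1/2) * (sqrt (\<integral>x. (d \<bullet> ?G x)\<^sup>2 \<partial>\<mu>) * sqrt (\<integral>x. (v x)\<^sup>2 \<partial>\<mu>))" .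
    \<comment> \<open>Expanding a square replaces the division by sqrt V, which may be zero. The
      factor 1/4 later cancels the 4 that arises from comparing both gradients with
      \<open>grad \<theta>\<close>.\<close>
    have cs: "V \<le> (1/4) * W" if "V \<le> (1/2) * (sqrt W * sqrt V)" "V \<ge> 0" "W \<ge> 0" for V W :: real
    proof -
      have "V = (sqrt V)\<^sup>2" "W = (sqrt W)\<^sup>2" using that by auto
      moreover have "0 \<le> (sqrt V - sqrt W / 2)\<^sup>2" by simp
      ultimately show ?thesis using that(1) by (simp add: power2_diff power_divide algebra_simps)
    qed
    have "(\<integral>x. (v x)\<^sup>2 \<partial>\<mu>) \<le> (1/4) * (\<integral>x. (d \<bullet> ?G x)\<^sup>2 \<partial>\<mu>)"
      by (rule cs[OF le]) auto
    also have "(\<integral>x. (d \<bullet> ?G x)\<^sup>2 \<partial>\<mu>) \<le> (\<integral>x. (norm d)\<^sup>2 * (2 * (norm (grad (\<theta>' + t *\<^sub>R d) x - grad \<theta> x))\<^sup>2 + 2 * (norm (grad \<theta>' x - grad \<theta> x))\<^sup>2) \<partial>\<mu>)"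
    proof (rule integral_mono)
      show "integrable \<mu> (\<lambda>x. (d \<bullet> ?G x)\<^sup>2)" using dG by (simp add: square_integrable_def)
      show "integrable \<mu> (\<lambda>x. (norm d)\<^sup>2 * (2 * (norm (grad (\<theta>' + t *\<^sub>R d) x - grad \<theta> x))\<^sup>2 + 2 * (norm (grad \<theta>' x - grad \<theta> x))\<^sup>2))"
        using \<theta> \<theta>' t\<Theta> by (auto intro!: integrable_norm_grad_diff_sq)
      fix x
      have "(d \<bullet> ?G x)\<^sup>2 \<le> (norm d)\<^sup>2 * (norm (?G x))\<^sup>2"
        using power_mono[OF Cauchy_Schwarz_ineq2, of d "?G x" 2] by (auto simp: power_mult_distrib)
      also have "(norm (?G x))\<^sup>2 \<le> 2 * (norm (grad (\<theta>' + t *\<^sub>R d) x - grad \<theta> x))\<^sup>2 + 2 * (norm (grad \<theta>' x - grad \<theta> x))\<^sup>2"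
        using norm_add_sq_le[of "grad (\<theta>' + t *\<^sub>R d) x - grad \<theta> x" "- (grad \<theta>' x - grad \<theta> x)"]
        by (simp add: norm_minus_commute)
      finally show "(d \<bullet> ?G x)\<^sup>2 \<le> (norm d)\<^sup>2 * (2 * (norm (grad (\<theta>' + t *\<^sub>R d) x - grad \<theta> x))\<^sup>2 + 2 * (norm (grad \<theta>' x - grad \<theta> x))\<^sup>2)"
        by (simp add: mult_left_mono)
    qed
    also have "\<dots> = (norm d)\<^sup>2 * (2 * (\<integral>x. (norm (grad (\<theta>' + t *\<^sub>R d) x - grad \<theta> x))\<^sup>2 \<partial>\<mu>) + 2 * (\<integral>x. (norm (grad \<theta>' x - grad \<theta> x))\<^sup>2 \<partial>\<mu>))"
      using \<theta> \<theta>' t\<Theta> by (simp add: integrable_norm_grad_diff_sq)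
    also have "\<dots> \<le> (norm d)\<^sup>2 * (2 * \<epsilon> + 2 * \<epsilon>)"
      using \<rho>(3)[OF t\<Theta>(2)] \<rho>(3)[OF \<theta>'b] by (intro mult_left_mono add_mono) auto
    finally show "\<theta>' \<in> \<Theta> \<and> \<theta>' + d \<in> \<Theta> \<and>
       (\<integral>x. (sroot (\<theta>' + d) x - sroot \<theta>' x - (1/2) * (d \<bullet> grad \<theta>' x))\<^sup>2 \<partial>\<mu>) \<le> \<epsilon> * (norm d)\<^sup>2"
      using \<theta>' by (simp add: v_def algebra_simps)
  qed (use \<rho> in auto)
qed

section \<open>Centred scores and the Fisher information\<close>

lemma integrable_inner_score:
  assumes [measurable]: "\<theta> \<in> \<Theta>"
  shows "integrable (P \<theta>) (\<lambda>x. d \<bullet> l \<theta> x)"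
proof (rule Bochner_Integration.integrable_bound)
  show "integrable (P \<theta>) (\<lambda>x. norm d * norm (l \<theta> x) ^ 1)"
    using integrable_moment[OF assms, of 1] by (rule integrable_mult_right)
  show "AE x in P \<theta>. norm (d \<bullet> l \<theta> x) \<le> norm (norm d * norm (l \<theta> x) ^ 1)"
    by (simp add: Cauchy_Schwarz_ineq2)
qed measurable

text \<open>The affinity of the root densities at \<open>\<theta> + t *\<^sub>R d\<close> and
  \<open>\<theta>\<close> is at most 1 by Cauchy-Schwarz and equals 1 at t = 0. Its derivative
  there, half the mean of \<open>d \<bullet> l \<theta>\<close>, therefore vanishes, without
  differentiating under the integral.\<close>

lemma score_mean_zero:
  assumes \<theta>: "\<theta> \<in> \<Theta>"
  shows "(\<integral>x. d \<bullet> l \<theta> x \<partial>P \<theta>) = 0"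
proof -
  let ?F = "\<lambda>t. \<integral>x. sroot (\<theta> + t *\<^sub>R d) x * sroot \<theta> x \<partial>\<mu>"
  let ?D = "\<integral>x. (1/2) * (d \<bullet> grad \<theta> x) * sroot \<theta> x \<partial>\<mu>"
  have der: "(?F has_real_derivative ?D) (at 0)"
    by (rule sroot_weak_derivative[OF \<theta> square_integrable_sroot[OF \<theta>]])
  obtain \<rho> where \<rho>: "\<rho> > 0" "ball \<theta> \<rho> \<subseteq> \<Theta>" using open_Theta \<theta> by (meson openE)
  have pos: "\<rho> / (norm d + 1) > 0" using \<rho>(1) by (intro divide_pos_pos add_nonneg_pos) auto
  have "?D = 0"
  proof (rule DERIV_local_max[OF der pos], intro allI impI)
    fix t :: real assume "\<bar>0 - t\<bar> < \<rho> / (norm d + 1)"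
    moreover have "norm d + 1 > 0" by (simp add: add_nonneg_pos)
    ultimately have "\<bar>t\<bar> * (norm d + 1) < \<rho>" by (simp only: pos_less_divide_eq) simp
    then have "\<bar>t\<bar> * norm d + \<bar>t\<bar> < \<rho>" by (simp only: distrib_left mult_1_right)
    then have "\<bar>t\<bar> * norm d < \<rho>" by linarith
    then have t: "\<theta> + t *\<^sub>R d \<in> \<Theta>" using \<rho>(2) by (auto simp: dist_norm)
    have "?F t \<le> sqrt (\<integral>x. (sroot (\<theta> + t *\<^sub>R d) x)\<^sup>2 \<partial>\<mu>) * sqrt (\<integral>x. (sroot \<theta> x)\<^sup>2 \<partial>\<mu>)"
      using square_integrable_Cauchy_Schwarz[OF square_integrable_sroot[OF t] square_integrable_sroot[OF \<theta>]] by linarith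
    also have "\<dots> = 1" using t \<theta> by (simp add: sroot_sq integral_p)
    also have "1 = ?F 0" using \<theta> by (simp add: sroot_sq integral_p flip: power2_eq_square)
    finally show "?F t \<le> ?F 0" .
  qed
  moreover have "?D = (1/2) * (\<integral>x. p \<theta> x * (d \<bullet> l \<theta> x) \<partial>\<mu>)"
    unfolding integral_mult_right_zero[symmetric]
    by (intro Bochner_Integration.integral_cong refl) (simp add: grad_def sroot_sq[OF \<theta>, symmetric] power2_eq_square)
  ultimately show ?thesis using \<theta> by (simp add: integral_P)
qed

abbreviation J where "J \<equiv> fisher_info \<mu> p l"

lemma integrable_score_product:
  assumes [measurable]: "\<theta> \<in> \<Theta>"
  shows "integrable (P \<theta>) (\<lambda>x. (u \<bullet> l \<theta> x) * (v \<bullet> l \<theta> x))"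
proof (rule Bochner_Integration.integrable_bound)
  show "integrable (P \<theta>) (\<lambda>x. norm u * norm v * norm (l \<theta> x) ^ 2)"
    using integrable_moment[OF assms, of 2] by auto
  show "AE x in P \<theta>. norm ((u \<bullet> l \<theta> x) * (v \<bullet> l \<theta> x)) \<le> norm (norm u * norm v * norm (l \<theta> x) ^ 2)"
    using mult_mono[OF Cauchy_Schwarz_ineq2 Cauchy_Schwarz_ineq2, of u "l \<theta> _" v "l \<theta> _"]
    by (auto simp: abs_mult power2_eq_square mult_ac)
qed measurable

lemma fisher_bilinear:
  assumes \<theta>: "\<theta> \<in> \<Theta>"
  shows "u \<bullet> (J \<theta> *v v) = (\<integral>x. (u \<bullet> l \<theta> x) * (v \<bullet> l \<theta> x) \<partial>P \<theta>)"
proof -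
  have i: "integrable (P \<theta>) (\<lambda>x. (l \<theta> x $ i) * (l \<theta> x $ j))" for i j
    using integrable_score_product[OF \<theta>, of "axis i 1" "axis j 1"] by (simp add: inner_axis')
  have "(\<integral>x. (u \<bullet> l \<theta> x) * (v \<bullet> l \<theta> x) \<partial>P \<theta>) = (\<integral>x. (\<Sum>i\<in>UNIV. \<Sum>j\<in>UNIV. (u $ i * v $ j) * ((l \<theta> x $ i) * (l \<theta> x $ j))) \<partial>P \<theta>)"
    by (intro Bochner_Integration.integral_cong refl) (simp add: inner_vec_def sum_product mult_ac)
  also have "\<dots> = (\<Sum>i\<in>UNIV. \<Sum>j\<in>UNIV. (u $ i * v $ j) * (\<integral>x. (l \<theta> x $ i) * (l \<theta> x $ j) \<partial>P \<theta>))"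
    using i by (simp add: Bochner_Integration.integral_sum)
  also have "\<dots> = u \<bullet> (J \<theta> *v v)"
    by (simp add: inner_vec_def matrix_vector_mult_def fisher_info_def sum_distrib_left mult_ac)
  finally show ?thesis ..
qed

lemma fisher_symmetric: "transpose (J \<theta>) = J \<theta>"
  by (simp add: transpose_def fisher_info_def vec_eq_iff mult.commute)

text \<open>J is a Gram matrix, so its form is nonnegative. If it vanished at u, then
  \<open>u \<bullet> l \<theta>\<close> would be zero almost surely, whence J u = 0 against
  invertibility.\<close>

lemma fisher_pos_def:
  assumes \<theta>: "\<theta> \<in> \<Theta>" and u: "u \<noteq> 0"
  shows "u \<bullet> (J \<theta> *v u) > 0"
proof -
  have [measurable]: "\<theta> \<in> \<Theta>" by fact
  have nn: "u \<bullet> (J \<theta> *v u) \<ge> 0" unfolding fisher_bilinear[OF \<theta>] by simp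
  have "u \<bullet> (J \<theta> *v u) \<noteq> 0"
  proof
    assume "u \<bullet> (J \<theta> *v u) = 0"
    then have "AE x in P \<theta>. (u \<bullet> l \<theta> x) * (u \<bullet> l \<theta> x) = 0"
      unfolding fisher_bilinear[OF \<theta>]
      by (subst (asm) integral_nonneg_eq_0_iff_AE) (auto intro: integrable_score_product[OF \<theta>])
    then have "AE x in P \<theta>. u \<bullet> l \<theta> x = 0" by auto
    then have "v \<bullet> (J \<theta> *v u) = 0" for v
      unfolding fisher_bilinear[OF \<theta>] by (intro integral_eq_zero_AE) auto
    from this[of "J \<theta> *v u"] have "J \<theta> *v u = 0" by simp
    then show False using u fisher_invertible[OF \<theta>]
      by (metis invertible_left_inverse matrix_left_invertible_ker)
  qed
  with nn show ?thesis by simp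
qed

text \<open>The entries of J are L^2(\<open>\<mu>\<close>) inner products of components of
  \<open>grad\<close>, so Cauchy-Schwarz passes the L^2 continuity of \<open>grad\<close> on to
  them.\<close>

lemma fisher_continuous:
  assumes \<theta>: "\<theta> \<in> \<Theta>" and \<eta>: "\<And>k. \<eta> k \<in> \<Theta>" "\<eta> \<longlonglongrightarrow> \<theta>"
  shows "(\<lambda>k. J (\<eta> k)) \<longlonglongrightarrow> J \<theta>"
proof -
  define G where "G = (\<integral>x. (norm (grad \<theta> x))\<^sup>2 \<partial>\<mu>)"
  define a where "a k = (\<integral>x. (norm (grad (\<eta> k) x - grad \<theta> x))\<^sup>2 \<partial>\<mu>)" for k
  have a0: "a k \<ge> 0" for k by (simp add: a_def)
  have a: "a \<longlonglongrightarrow> 0" unfolding a_def by (rule grad_continuous_L2[OF \<theta> \<eta>])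
  have Ji: "integrable \<mu> (\<lambda>x. grad \<theta>' x $ i * grad \<theta>' x $ j)" and Je: "J \<theta>' $ i $ j = (\<integral>x. grad \<theta>' x $ i * grad \<theta>' x $ j \<partial>\<mu>)"
    if \<theta>': "\<theta>' \<in> \<Theta>" for \<theta>' i j
  proof -
    have [measurable]: "\<theta>' \<in> \<Theta>" by fact
    have eq: "grad \<theta>' x $ i * grad \<theta>' x $ j = p \<theta>' x * (l \<theta>' x $ i * l \<theta>' x $ j)" for x
      by (simp add: grad_def sroot_sq[OF \<theta>', symmetric] power2_eq_square)
    show "integrable \<mu> (\<lambda>x. grad \<theta>' x $ i * grad \<theta>' x $ j)"
      unfolding eq using integrable_score_product[OF \<theta>', of "axis i 1" "axis j 1"] \<theta>'
      by (subst (asm) integrable_P) (auto simp: inner_axis')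
    show "J \<theta>' $ i $ j = (\<integral>x. grad \<theta>' x $ i * grad \<theta>' x $ j \<partial>\<mu>)"
      unfolding eq using \<theta>' by (simp add: fisher_info_def integral_P)
  qed
  have bound: "\<bar>J (\<eta> k) $ i $ j - J \<theta> $ i $ j\<bar> \<le> a k + 2 * (sqrt G * sqrt (a k))" for k i j
  proof -
    note \<eta>k = \<eta>(1)[of k]
    let ?D = "\<lambda>x. norm (grad (\<eta> k) x - grad \<theta> x)"
    have [measurable]: "\<eta> k \<in> \<Theta>" "\<theta> \<in> \<Theta>" by fact+
    have Di: "integrable \<mu> (\<lambda>x. (?D x)\<^sup>2)" by (rule integrable_norm_grad_diff_sq) fact+
    have GD: "integrable \<mu> (\<lambda>x. norm (grad \<theta> x) * ?D x)"
      by (intro integrable_mult_of_squares integrable_norm_grad_sq[OF \<theta>] Di) auto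
    have "\<bar>J (\<eta> k) $ i $ j - J \<theta> $ i $ j\<bar> = \<bar>\<integral>x. grad (\<eta> k) x $ i * grad (\<eta> k) x $ j - grad \<theta> x $ i * grad \<theta> x $ j \<partial>\<mu>\<bar>"
      using Ji \<eta>k \<theta> by (simp add: Je)
    also have "\<dots> \<le> (\<integral>x. \<bar>grad (\<eta> k) x $ i * grad (\<eta> k) x $ j - grad \<theta> x $ i * grad \<theta> x $ j\<bar> \<partial>\<mu>)"
      by (rule integral_abs_bound)
    also have "\<dots> \<le> (\<integral>x. (?D x)\<^sup>2 + 2 * (norm (grad \<theta> x) * ?D x) \<partial>\<mu>)"
    proof (rule integral_mono)
      show "integrable \<mu> (\<lambda>x. \<bar>grad (\<eta> k) x $ i * grad (\<eta> k) x $ j - grad \<theta> x $ i * grad \<theta> x $ j\<bar>)"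
        using Ji \<eta>k \<theta> by auto
      show "integrable \<mu> (\<lambda>x. (?D x)\<^sup>2 + 2 * (norm (grad \<theta> x) * ?D x))" using Di GD by auto
      fix x
      let ?d = "grad (\<eta> k) x - grad \<theta> x" and ?g = "grad \<theta> x"
      have tri: "\<bar>a + b + c\<bar> \<le> \<bar>a\<bar> + \<bar>b\<bar> + \<bar>c\<bar>" for a b c :: real by linarith
      have c: "\<bar>?d $ i\<bar> \<le> ?D x" "\<bar>?d $ j\<bar> \<le> ?D x" "\<bar>?g $ i\<bar> \<le> norm ?g" "\<bar>?g $ j\<bar> \<le> norm ?g"
        by (rule component_le_norm_cart)+
      have eq: "grad (\<eta> k) x $ i * grad (\<eta> k) x $ j - ?g $ i * ?g $ j = ?d $ i * ?d $ j + ?d $ i * ?g $ j + ?g $ i * ?d $ j"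
        by (simp add: algebra_simps)
      have "\<bar>grad (\<eta> k) x $ i * grad (\<eta> k) x $ j - ?g $ i * ?g $ j\<bar> \<le> \<bar>?d $ i\<bar> * \<bar>?d $ j\<bar> + \<bar>?d $ i\<bar> * \<bar>?g $ j\<bar> + \<bar>?g $ i\<bar> * \<bar>?d $ j\<bar>"
        unfolding eq abs_mult[symmetric] by (rule tri)
      also have "\<dots> \<le> ?D x * ?D x + ?D x * norm ?g + norm ?g * ?D x"
        by (intro add_mono mult_mono c abs_ge_zero norm_ge_zero)
      finally show "\<bar>grad (\<eta> k) x $ i * grad (\<eta> k) x $ j - ?g $ i * ?g $ j\<bar> \<le> (?D x)\<^sup>2 + 2 * (norm ?g * ?D x)"
        by (simp add: power2_eq_square mult_ac)
    qed
    also have "\<dots> = a k + 2 * (\<integral>x. norm (grad \<theta> x) * ?D x \<partial>\<mu>)" using Di GD by (simp add: a_def)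
    also have "(\<integral>x. norm (grad \<theta> x) * ?D x \<partial>\<mu>) \<le> sqrt G * sqrt (a k)"
      using Cauchy_Schwarz_integral[OF _ _ integrable_norm_grad_sq[OF \<theta>] Di] unfolding G_def a_def by simp
    finally show ?thesis by simp
  qed
  have lim: "(\<lambda>k. a k + 2 * (sqrt G * sqrt (a k))) \<longlonglongrightarrow> 0"
    using tendsto_add[OF a tendsto_mult[OF tendsto_const[of 2] tendsto_mult[OF tendsto_const[of "sqrt G"] tendsto_real_sqrt[OF a]]]]
    by simp
  show ?thesis
  proof (intro vec_tendstoI)
    fix i j
    have "(\<lambda>k. J (\<eta> k) $ i $ j - J \<theta> $ i $ j) \<longlonglongrightarrow> 0"
      by (rule Lim_null_comparison[OF _ lim]) (use bound in auto)
    then show "(\<lambda>k. J (\<eta> k) $ i $ j) \<longlonglongrightarrow> J \<theta> $ i $ j" by (simp add: LIM_zero_iff)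
  qed
qed

end

section \<open>Exponential tilting\<close>

lemma exp_taylor2_bound: "\<bar>exp v - 1 - v\<bar> \<le> v\<^sup>2 * exp \<bar>v\<bar>" for v :: real
proof -
  obtain t where t: "\<bar>t\<bar> \<le> \<bar>v\<bar>" "exp v = (\<Sum>m<2. v ^ m / fact m) + exp t / fact 2 * v ^ 2"
    using Maclaurin_exp_le by blast
  have "(\<Sum>m<2. v ^ m / fact m) = 1 + v" by (simp add: eval_nat_numeral)
  then have "\<bar>exp v - 1 - v\<bar> = (exp t / 2) * v\<^sup>2" using t(2) by (simp add: abs_mult fact_numeral)
  also have "\<dots> \<le> exp \<bar>v\<bar> * v\<^sup>2"
  proof (rule mult_right_mono)
    have "exp t \<le> exp \<bar>v\<bar>" using t(1) by simp
    then show "exp t / 2 \<le> exp \<bar>v\<bar>" using exp_ge_zero[of t] by linarith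
  qed simp
  finally show ?thesis by (simp add: mult.commute)
qed

lemma exp_taylor3_bound: "\<bar>exp v - 1 - v - v\<^sup>2 / 2\<bar> \<le> \<bar>v\<bar> ^ 3 * exp \<bar>v\<bar>" for v :: real
proof -
  obtain t where t: "\<bar>t\<bar> \<le> \<bar>v\<bar>" "exp v = (\<Sum>m<3. v ^ m / fact m) + exp t / fact 3 * v ^ 3"
    using Maclaurin_exp_le by blast
  have "(\<Sum>m<3. v ^ m / fact m) = 1 + v + v\<^sup>2 / 2" by (simp add: eval_nat_numeral)
  then have "\<bar>exp v - 1 - v - v\<^sup>2 / 2\<bar> = (exp t / 6) * \<bar>v\<bar> ^ 3" using t(2) by (simp add: abs_mult fact_numeral power_abs)
  also have "\<dots> \<le> exp \<bar>v\<bar> * \<bar>v\<bar> ^ 3"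
  proof (rule mult_right_mono)
    have "exp t \<le> exp \<bar>v\<bar>" using t(1) by simp
    then show "exp t / 6 \<le> exp \<bar>v\<bar>" using exp_ge_zero[of t] by linarith
  qed simp
  finally show ?thesis by (simp add: mult.commute)
qed

text \<open>The inequality 1 + x <= exp x, used at M - 1 and at 1/M - 1, traps M^n between exp (n (M
  - 1) / M) and exp (n (M - 1)); both exponents tend to L.\<close>

lemma power_tendsto_exp:
  fixes M :: "nat \<Rightarrow> real" and n :: "nat \<Rightarrow> nat"
  assumes M: "\<And>k. M k \<ge> 1" "M \<longlonglongrightarrow> 1" and L: "(\<lambda>k. real (n k) * (M k - 1)) \<longlonglongrightarrow> L"
  shows "(\<lambda>k. M k ^ n k) \<longlonglongrightarrow> exp L"
proof (rule tendsto_sandwich)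
  have "M k ^ n k \<le> exp (real (n k) * (M k - 1))" for k
    using power_mono[OF exp_ge_add_one_self[of "M k - 1"], of "n k"] M(1)[of k] by (simp add: exp_of_nat_mult)
  then show "\<forall>\<^sub>F k in sequentially. M k ^ n k \<le> exp (real (n k) * (M k - 1))" by auto
  have "exp ((real (n k) * (M k - 1)) / M k) \<le> M k ^ n k" for k
  proof -
    have "1 / M k \<le> exp (1 / M k - 1)" using exp_ge_add_one_self[of "1 / M k - 1"] by simp
    then have "exp (1 - 1 / M k) \<le> M k"
    proof -
      have "exp (1 - 1 / M k) = inverse (exp (1 / M k - 1))" by (simp flip: exp_minus)
      also have "\<dots> \<le> inverse (1 / M k)" using \<open>1 / M k \<le> exp (1 / M k - 1)\<close> M(1)[of k]
        by (intro le_imp_inverse_le) auto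
      finally show ?thesis by simp
    qed
    then have "exp (1 - 1 / M k) ^ n k \<le> M k ^ n k" by (intro power_mono) auto
    moreover have "(real (n k) * (M k - 1)) / M k = real (n k) * (1 - 1 / M k)" using M(1)[of k] by (simp add: field_simps)
    ultimately show ?thesis by (simp add: exp_of_nat_mult)
  qed
  then show "\<forall>\<^sub>F k in sequentially. exp ((real (n k) * (M k - 1)) / M k) \<le> M k ^ n k" by auto
  have "(\<lambda>k. exp ((real (n k) * (M k - 1)) / M k)) \<longlonglongrightarrow> exp (L / 1)" by (intro tendsto_intros L M) auto
  then show "(\<lambda>k. exp ((real (n k) * (M k - 1)) / M k)) \<longlonglongrightarrow> exp L" by simp
  show "(\<lambda>k. exp (real (n k) * (M k - 1))) \<longlonglongrightarrow> exp L" by (intro tendsto_intros L)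
qed

context regular_model begin

definition tilt_mass :: "real^'m \<Rightarrow> nat \<Rightarrow> real^'m \<Rightarrow> real" where
  "tilt_mass \<theta> n h = (\<integral>x. exp ((h \<bullet> l \<theta> x) / sqrt (real n)) \<partial>P \<theta>)"

text \<open>The density is relative to \<open>P \<theta>\<close>, not to \<open>\<mu>\<close>: a
  member of the exponential family generated by the score, at parameter h / sqrt n.\<close>

definition tilt_density :: "real^'m \<Rightarrow> nat \<Rightarrow> real^'m \<Rightarrow> 'a \<Rightarrow> real" where
  "tilt_density \<theta> n h x = exp ((h \<bullet> l \<theta> x) / sqrt (real n)) / tilt_mass \<theta> n h"

lemma tilt_exponent_le:
  assumes "norm h \<le> B" "n \<ge> 1"
  shows "\<bar>(h \<bullet> l \<theta> x) / sqrt (real n)\<bar> \<le> B * norm (l \<theta> x) / sqrt (real n)"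
    "\<bar>(h \<bullet> l \<theta> x) / sqrt (real n)\<bar> \<le> B * norm (l \<theta> x)"
proof -
  have B: "B \<ge> 0" using assms(1) norm_ge_zero order_trans by blast
  have "\<bar>h \<bullet> l \<theta> x\<bar> \<le> norm h * norm (l \<theta> x)" by (rule Cauchy_Schwarz_ineq2)
  also have "\<dots> \<le> B * norm (l \<theta> x)" using assms(1) by (intro mult_right_mono) auto
  finally show 1: "\<bar>(h \<bullet> l \<theta> x) / sqrt (real n)\<bar> \<le> B * norm (l \<theta> x) / sqrt (real n)"
    by (simp add: divide_right_mono)
  also have "\<dots> \<le> B * norm (l \<theta> x) / 1"
    using assms(2) B by (intro divide_left_mono) auto
  finally show "\<bar>(h \<bullet> l \<theta> x) / sqrt (real n)\<bar> \<le> B * norm (l \<theta> x)" by simp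
qed

lemma tilt_moment_bound:
  assumes "norm h \<le> B" "n \<ge> 1"
  shows "\<bar>(h \<bullet> l \<theta> x) / sqrt (real n)\<bar> ^ k * exp \<bar>(h \<bullet> l \<theta> x) / sqrt (real n)\<bar>
    \<le> (B / sqrt (real n)) ^ k * (norm (l \<theta> x) ^ k * exp (B * norm (l \<theta> x)))"
proof -
  have B: "B \<ge> 0" using assms(1) norm_ge_zero order_trans by blast
  have "\<bar>(h \<bullet> l \<theta> x) / sqrt (real n)\<bar> ^ k * exp \<bar>(h \<bullet> l \<theta> x) / sqrt (real n)\<bar>
     \<le> (B * norm (l \<theta> x) / sqrt (real n)) ^ k * exp (B * norm (l \<theta> x))"
    by (rule mult_mono[OF power_mono[OF tilt_exponent_le(1)[OF assms] abs_ge_zero]])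
       (use tilt_exponent_le(2)[OF assms] B in auto)
  also have "\<dots> = (B / sqrt (real n)) ^ k * (norm (l \<theta> x) ^ k * exp (B * norm (l \<theta> x)))"
    by (simp add: power_mult_distrib power_divide)
  finally show ?thesis .
qed

text \<open>Put v = h . l / sqrt n, which has mean 0 and second moment (h . J h) / n. Taylor's
  formula for exp v leaves a cubic error of order n^(-3/2) in the mass, hence n^(-1/2) after
  multiplication by n. The squared error of the linearized root density is a fourth moment of v plus
  the squared normalization error, both of order n^-2. The constants depend only on the compact set
  and on B.\<close>

lemma tilt_expansion:
  assumes K: "compact K" "K \<subseteq> \<Theta>"
  obtains C where "C \<ge> 0"
   "\<And>\<theta> n h. \<theta> \<in> K \<Longrightarrow> norm h \<le> B \<Longrightarrow> n \<ge> 1 \<Longrightarrow> integrable (P \<theta>) (\<lambda>x. exp ((h \<bullet> l \<theta> x) / sqrt (real n)))"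
   "\<And>\<theta> n h. \<theta> \<in> K \<Longrightarrow> norm h \<le> B \<Longrightarrow> n \<ge> 1 \<Longrightarrow> tilt_mass \<theta> n h \<ge> 1"
   "\<And>\<theta> n h. \<theta> \<in> K \<Longrightarrow> norm h \<le> B \<Longrightarrow> n \<ge> 1 \<Longrightarrow> \<bar>real n * (tilt_mass \<theta> n h - 1) - (h \<bullet> (J \<theta> *v h)) / 2\<bar> \<le> C / sqrt (real n)"
   "\<And>\<theta> n h. \<theta> \<in> K \<Longrightarrow> norm h \<le> B \<Longrightarrow> n \<ge> 1 \<Longrightarrow> real n * (tilt_mass \<theta> n h - 1) \<le> C"
   "\<And>\<theta> n h. \<theta> \<in> K \<Longrightarrow> norm h \<le> B \<Longrightarrow> n \<ge> 1 \<Longrightarrow>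
      real n * (\<integral>x. (sqrt (tilt_density \<theta> n h x) - 1 - (h \<bullet> l \<theta> x) / sqrt (real n) / 2)\<^sup>2 \<partial>P \<theta>) \<le> C / real n"
proof -
  \<comment> \<open>B is an arbitrary real number; if it is negative no h satisfies the bound, but
    the moment lemma needs a nonnegative rate.\<close>
  define B' where "B' = max B 0"
  have B': "B' \<ge> 0" "\<And>h::real^'m. norm h \<le> B \<Longrightarrow> norm h \<le> B'" by (auto simp: B'_def)
  define Q where "Q k C \<longleftrightarrow> C \<ge> 0 \<and> (\<forall>\<theta>\<in>K. integrable (P \<theta>) (\<lambda>x. norm (l \<theta> x) ^ k * exp (B' * norm (l \<theta> x)))
       \<and> (\<integral>x. norm (l \<theta> x) ^ k * exp (B' * norm (l \<theta> x)) \<partial>P \<theta>) \<le> C)" for k C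
  have "\<exists>C. Q k C" for k
    unfolding Q_def by (rule uniform_moments[OF K B'(1), of k]) blast
  then have "\<exists>C. \<forall>k. Q k (C k)" by (intro choice allI)
  then obtain C where "\<And>k. Q k (C k)" by blast
  then have C: "\<And>k. C k \<ge> 0"
    "\<And>k \<theta>. \<theta> \<in> K \<Longrightarrow> integrable (P \<theta>) (\<lambda>x. norm (l \<theta> x) ^ k * exp (B' * norm (l \<theta> x)))"
    "\<And>k \<theta>. \<theta> \<in> K \<Longrightarrow> (\<integral>x. norm (l \<theta> x) ^ k * exp (B' * norm (l \<theta> x)) \<partial>P \<theta>) \<le> C k"
    unfolding Q_def by blast+
  \<comment> \<open>These come from the third moment (cubic Taylor error), the second moment (size
    of the mass minus 1), and the fourth moment together with the squared normalization
    error.\<close>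
  define C1 where "C1 = B' ^ 3 * C 3"
  define C2 where "C2 = B'\<^sup>2 * C 2"
  define C3 where "C3 = B' ^ 4 * C 4 + 2 * C2\<^sup>2 * C 0"
  define CC where "CC = C1 + C2 + C3"
  have nn: "C1 \<ge> 0" "C2 \<ge> 0" "C3 \<ge> 0" using C(1) B' by (auto simp: C1_def C2_def C3_def)
  have core: "integrable (P \<theta>) (\<lambda>x. exp ((h \<bullet> l \<theta> x) / sqrt (real n))) \<and> tilt_mass \<theta> n h \<ge> 1 \<and>
    \<bar>real n * (tilt_mass \<theta> n h - 1) - (h \<bullet> (J \<theta> *v h)) / 2\<bar> \<le> C1 / sqrt (real n) \<and>
    real n * (tilt_mass \<theta> n h - 1) \<le> C2 \<and>
    real n * (\<integral>x. (sqrt (tilt_density \<theta> n h x) - 1 - (h \<bullet> l \<theta> x) / sqrt (real n) / 2)\<^sup>2 \<partial>P \<theta>) \<le> C3 / real n"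
    if \<theta>K: "\<theta> \<in> K" and h: "norm h \<le> B'" and n: "n \<ge> 1" for \<theta> n h
  proof -
    have \<theta>: "\<theta> \<in> \<Theta>" using \<theta>K K by auto
    then have [measurable]: "\<theta> \<in> \<Theta>" .
    interpret prob_space "P \<theta>" by (rule prob_space_P[OF \<theta>])
    have pr: "measure (P \<theta>) (space \<mu>) = 1" using prob_space by simp
    define v where "v x = (h \<bullet> l \<theta> x) / sqrt (real n)" for x
    have [measurable]: "v \<in> borel_measurable \<mu>" unfolding v_def by measurable
    have sn: "sqrt (real n) > 0" "(sqrt (real n))\<^sup>2 = real n" using n by auto
    have mom: "\<bar>v x\<bar> ^ k * exp \<bar>v x\<bar> \<le> (B' / sqrt (real n)) ^ k * (norm (l \<theta> x) ^ k * exp (B' * norm (l \<theta> x)))" for x k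
      unfolding v_def by (rule tilt_moment_bound[OF h n])
    have vint: "integrable (P \<theta>) (\<lambda>x. \<bar>v x\<bar> ^ k * exp \<bar>v x\<bar>)" for k
    proof (rule Bochner_Integration.integrable_bound)
      show "integrable (P \<theta>) (\<lambda>x. (B' / sqrt (real n)) ^ k * (norm (l \<theta> x) ^ k * exp (B' * norm (l \<theta> x))))"
        by (intro integrable_mult_right C(2)[OF \<theta>K])
      show "AE x in P \<theta>. norm (\<bar>v x\<bar> ^ k * exp \<bar>v x\<bar>) \<le> norm ((B' / sqrt (real n)) ^ k * (norm (l \<theta> x) ^ k * exp (B' * norm (l \<theta> x))))"
        using mom B'(1) by (intro AE_I2) (simp add: abs_mult)
    qed measurable
    have vbound: "(\<integral>x. \<bar>v x\<bar> ^ k * exp \<bar>v x\<bar> \<partial>P \<theta>) \<le> (B' / sqrt (real n)) ^ k * C k" for k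
    proof -
      have "(\<integral>x. \<bar>v x\<bar> ^ k * exp \<bar>v x\<bar> \<partial>P \<theta>) \<le> (\<integral>x. (B' / sqrt (real n)) ^ k * (norm (l \<theta> x) ^ k * exp (B' * norm (l \<theta> x))) \<partial>P \<theta>)"
        by (intro integral_mono vint integrable_mult_right C(2)[OF \<theta>K] mom)
      also have "\<dots> \<le> (B' / sqrt (real n)) ^ k * C k"
        using C(3)[OF \<theta>K] B'(1) by (simp add: mult_left_mono)
      finally show ?thesis .
    qed
    have eint: "integrable (P \<theta>) (\<lambda>x. exp (v x))"
    proof (rule Bochner_Integration.integrable_bound)
      show "integrable (P \<theta>) (\<lambda>x. \<bar>v x\<bar> ^ 0 * exp \<bar>v x\<bar>)" by (rule vint)
    qed (auto simp: AE_I2)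
    have v1: "integrable (P \<theta>) v" "(\<integral>x. v x \<partial>P \<theta>) = 0"
      unfolding v_def using integrable_inner_score[OF \<theta>, of h] score_mean_zero[OF \<theta>, of h] by auto
    have v2: "integrable (P \<theta>) (\<lambda>x. (v x)\<^sup>2)" "(\<integral>x. (v x)\<^sup>2 \<partial>P \<theta>) = (h \<bullet> (J \<theta> *v h)) / real n"
    proof -
      have eq: "(v x)\<^sup>2 = ((h \<bullet> l \<theta> x) * (h \<bullet> l \<theta> x)) / real n" for x
        by (simp add: v_def power_divide power2_eq_square)
      show "integrable (P \<theta>) (\<lambda>x. (v x)\<^sup>2)" "(\<integral>x. (v x)\<^sup>2 \<partial>P \<theta>) = (h \<bullet> (J \<theta> *v h)) / real n"
        unfolding eq using integrable_score_product[OF \<theta>, of h h] by (auto simp: fisher_bilinear[OF \<theta>])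
    qed
    define m where "m = tilt_mass \<theta> n h"
    have m: "m = (\<integral>x. exp (v x) \<partial>P \<theta>)" by (simp add: m_def tilt_mass_def v_def)
    have m1: "m - 1 = (\<integral>x. exp (v x) - 1 - v x \<partial>P \<theta>)"
      using eint v1 by (simp add: m pr)
    have m2: "m - 1 - (h \<bullet> (J \<theta> *v h)) / real n / 2 = (\<integral>x. exp (v x) - 1 - v x - (v x)\<^sup>2 / 2 \<partial>P \<theta>)"
      using eint v1 v2 by (simp add: m pr)
    have mge: "m \<ge> 1"
      using Bochner_Integration.integral_nonneg[of "P \<theta>" "\<lambda>x. exp (v x) - 1 - v x"] exp_ge_add_one_self[of "v _"] m1
      by (simp add: algebra_simps)
    have "\<bar>m - 1 - (h \<bullet> (J \<theta> *v h)) / real n / 2\<bar> \<le> (\<integral>x. \<bar>v x\<bar> ^ 3 * exp \<bar>v x\<bar> \<partial>P \<theta>)"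
      unfolding m2 using eint v1 v2 vint[of 3] exp_taylor3_bound
      by (intro order_trans[OF integral_abs_bound] integral_mono) auto
    also have "\<dots> \<le> (B' / sqrt (real n)) ^ 3 * C 3" by (rule vbound)
    also have "\<dots> = C1 / sqrt (real n) / real n"
      using sn by (simp add: C1_def power_divide power3_eq_cube power2_eq_square[symmetric])
    finally have "real n * \<bar>m - 1 - (h \<bullet> (J \<theta> *v h)) / real n / 2\<bar> \<le> real n * (C1 / sqrt (real n) / real n)"
      by (intro mult_left_mono) auto
    then have e1: "\<bar>real n * (m - 1) - (h \<bullet> (J \<theta> *v h)) / 2\<bar> \<le> C1 / sqrt (real n)"
    proof -
      have "real n * (m - 1) - (h \<bullet> (J \<theta> *v h)) / 2 = real n * (m - 1 - (h \<bullet> (J \<theta> *v h)) / real n / 2)"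
        using n by (simp add: field_simps)
      then have "\<bar>real n * (m - 1) - (h \<bullet> (J \<theta> *v h)) / 2\<bar> = real n * \<bar>m - 1 - (h \<bullet> (J \<theta> *v h)) / real n / 2\<bar>"
        by (simp add: abs_mult)
      also have "\<dots> \<le> real n * (C1 / sqrt (real n) / real n)" by fact
      also have "\<dots> = C1 / sqrt (real n)" using n by simp
      finally show ?thesis .
    qed
    have "m - 1 \<le> (\<integral>x. \<bar>v x\<bar> ^ 2 * exp \<bar>v x\<bar> \<partial>P \<theta>)"
      unfolding m1
    proof (rule integral_mono)
      show "exp (v x) - 1 - v x \<le> \<bar>v x\<bar> ^ 2 * exp \<bar>v x\<bar>" for x using exp_taylor2_bound[of "v x"] by simp
    qed (use eint v1 vint[of 2] in auto)
    also have "\<dots> \<le> (B' / sqrt (real n)) ^ 2 * C 2" by (rule vbound)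
    also have "\<dots> = C2 / real n" using sn by (simp add: C2_def power_divide)
    finally have mle: "m - 1 \<le> C2 / real n" .
    then have e2: "real n * (m - 1) \<le> C2" using n by (simp add: field_simps)
    have "(\<integral>x. (sqrt (tilt_density \<theta> n h x) - 1 - v x / 2)\<^sup>2 \<partial>P \<theta>)
        \<le> (\<integral>x. (1/8) * (\<bar>v x\<bar> ^ 4 * exp \<bar>v x\<bar>) + (2 * (m - 1)\<^sup>2) * (\<bar>v x\<bar> ^ 0 * exp \<bar>v x\<bar>) \<partial>P \<theta>)"
    proof -
      let ?R = "\<lambda>x. (1/8) * (\<bar>v x\<bar> ^ 4 * exp \<bar>v x\<bar>) + (2 * (m - 1)\<^sup>2) * (\<bar>v x\<bar> ^ 0 * exp \<bar>v x\<bar>)"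
      have Ri: "integrable (P \<theta>) ?R"
        by (intro Bochner_Integration.integrable_add integrable_mult_right vint)
      have le: "(sqrt (tilt_density \<theta> n h x) - 1 - v x / 2)\<^sup>2 \<le> ?R x" for x
      proof -
        have sq: "sqrt (tilt_density \<theta> n h x) = exp (v x / 2) / sqrt m"
        proof -
          have "exp (v x) = (exp (v x / 2))\<^sup>2" by (simp add: power2_eq_square exp_add[symmetric])
          then show ?thesis by (simp add: tilt_density_def v_def[symmetric] m_def[symmetric] real_sqrt_divide)
        qed
        have i: "\<bar>1 / sqrt m - 1\<bar> \<le> m - 1"
        proof -
          have "sqrt m \<ge> 1" using mge by simp
          then have a: "1 / sqrt m \<le> 1" by simp
          have "sqrt m * 1 \<le> sqrt m * sqrt m" using \<open>sqrt m \<ge> 1\<close> by (intro mult_left_mono) auto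
          then have "sqrt m \<le> m" using mge by simp
          then have "1 / m \<le> 1 / sqrt m" using mge by (intro divide_left_mono) auto
          moreover have "2 - m \<le> 1 / m" using mge zero_le_square[of "m - 1"] by (simp add: field_simps)
          ultimately show ?thesis using a by linarith
        qed
        \<comment> \<open>The error splits into the Taylor remainder of exp (v / 2) and the effect
          of dividing by sqrt m, where 1 / sqrt m differs from 1 by at most m - 1.\<close>
        have "sqrt (tilt_density \<theta> n h x) - 1 - v x / 2 = (exp (v x / 2) - 1 - v x / 2) + exp (v x / 2) * (1 / sqrt m - 1)"
          unfolding sq by (simp add: algebra_simps)
        then have "(sqrt (tilt_density \<theta> n h x) - 1 - v x / 2)\<^sup>2 \<le> 2 * (exp (v x / 2) - 1 - v x / 2)\<^sup>2 + 2 * (exp (v x / 2) * (1 / sqrt m - 1))\<^sup>2"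
          using norm_add_sq_le[of "exp (v x / 2) - 1 - v x / 2" "exp (v x / 2) * (1 / sqrt m - 1)"]
          unfolding real_norm_def power2_abs by (simp only:)
        also have "\<dots> \<le> ?R x"
        proof (rule add_mono)
          have "(exp (v x / 2) - 1 - v x / 2)\<^sup>2 \<le> ((v x / 2)\<^sup>2 * exp \<bar>v x / 2\<bar>)\<^sup>2"
            using power_mono[OF exp_taylor2_bound[of "v x / 2"], of 2] by simp
          also have "\<dots> = \<bar>v x\<bar> ^ 4 * exp \<bar>v x\<bar> / 16"
            by (simp add: power_mult_distrib power_divide exp_double[symmetric] flip: power_mult)
          finally show "2 * (exp (v x / 2) - 1 - v x / 2)\<^sup>2 \<le> (1/8) * (\<bar>v x\<bar> ^ 4 * exp \<bar>v x\<bar>)" by simp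
          have "(exp (v x / 2) * (1 / sqrt m - 1))\<^sup>2 = exp (v x) * (1 / sqrt m - 1)\<^sup>2"
            by (simp add: power_mult_distrib exp_double[symmetric])
          also have "\<dots> \<le> exp \<bar>v x\<bar> * (m - 1)\<^sup>2"
            using power_mono[OF i, of 2] by (intro mult_mono) auto
          finally show "2 * (exp (v x / 2) * (1 / sqrt m - 1))\<^sup>2 \<le> (2 * (m - 1)\<^sup>2) * (\<bar>v x\<bar> ^ 0 * exp \<bar>v x\<bar>)"
            by (simp add: mult.commute)
        qed
        finally show ?thesis .
      qed
      have tm: "tilt_density \<theta> n h \<in> borel_measurable \<mu>" unfolding tilt_density_def by measurable
      show ?thesis
      proof (rule integral_mono[OF _ Ri le])
        show "integrable (P \<theta>) (\<lambda>x. (sqrt (tilt_density \<theta> n h x) - 1 - v x / 2)\<^sup>2)"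
          using tm le by (intro Bochner_Integration.integrable_bound[OF Ri]) (auto intro!: AE_I2 intro: order_trans[OF _ abs_ge_self])
      qed
    qed
    also have "\<dots> = (1/8) * (\<integral>x. \<bar>v x\<bar> ^ 4 * exp \<bar>v x\<bar> \<partial>P \<theta>) + (2 * (m - 1)\<^sup>2) * (\<integral>x. \<bar>v x\<bar> ^ 0 * exp \<bar>v x\<bar> \<partial>P \<theta>)"
      by (subst Bochner_Integration.integral_add)
         (intro integrable_mult_right vint refl | simp only: integral_mult_right_zero)+
    also have "\<dots> \<le> (1/8) * ((B' / sqrt (real n)) ^ 4 * C 4) + (2 * (C2 / real n)\<^sup>2) * ((B' / sqrt (real n)) ^ 0 * C 0)"
      using mle mge nn by (intro add_mono mult_left_mono divide_right_mono mult_mono vbound power_mono) auto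
    also have "(B' / sqrt (real n)) ^ 4 = B' ^ 4 / (real n)\<^sup>2"
    proof -
      have "sqrt (real n) ^ 4 = ((sqrt (real n))\<^sup>2)\<^sup>2" unfolding power_mult[symmetric] by simp
      then show ?thesis by (simp add: power_divide)
    qed
    also have "(1/8) * (B' ^ 4 / (real n)\<^sup>2 * C 4) + (2 * (C2 / real n)\<^sup>2) * ((B' / sqrt (real n)) ^ 0 * C 0) \<le> C3 / (real n)\<^sup>2"
    proof -
      have "0 \<le> C 4 * (B' ^ 4 * (real n)\<^sup>2)" using B' C(1)[of 4] by simp
      then show ?thesis using n by (simp add: C3_def power_divide field_simps)
    qed
    finally have "real n * (\<integral>x. (sqrt (tilt_density \<theta> n h x) - 1 - v x / 2)\<^sup>2 \<partial>P \<theta>) \<le> real n * (C3 / (real n)\<^sup>2)"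
      by (intro mult_left_mono) auto
    then have e3: "real n * (\<integral>x. (sqrt (tilt_density \<theta> n h x) - 1 - v x / 2)\<^sup>2 \<partial>P \<theta>) \<le> C3 / real n"
      using n by (simp add: power2_eq_square)
    show ?thesis using eint mge e1 e2 e3 unfolding m_def v_def by blast
  qed
  show ?thesis
  proof (rule that[of CC])
    show "CC \<ge> 0" using nn by (simp add: CC_def)
    fix \<theta> n and h :: "real^'m" assume *: "\<theta> \<in> K" "norm h \<le> B" "(n::nat) \<ge> 1"
    note c = core[OF *(1) B'(2)[OF *(2)] *(3)]
    show "integrable (P \<theta>) (\<lambda>x. exp ((h \<bullet> l \<theta> x) / sqrt (real n)))" "tilt_mass \<theta> n h \<ge> 1" using c by blast+
    have "C1 / sqrt (real n) \<le> CC / sqrt (real n)" "C3 / real n \<le> CC / real n" "C2 \<le> CC"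
      using nn by (auto simp: CC_def intro!: divide_right_mono)
    then show "\<bar>real n * (tilt_mass \<theta> n h - 1) - (h \<bullet> (J \<theta> *v h)) / 2\<bar> \<le> CC / sqrt (real n)"
      "real n * (tilt_mass \<theta> n h - 1) \<le> CC"
      "real n * (\<integral>x. (sqrt (tilt_density \<theta> n h x) - 1 - (h \<bullet> l \<theta> x) / sqrt (real n) / 2)\<^sup>2 \<partial>P \<theta>) \<le> CC / real n"
      using c by linarith+
  qed
qed

end

section \<open>Smoothing the score sum\<close>

lemma exp_minus_quadratic_bound: "\<bar>exp (- x) - (1 - x)\<bar> \<le> x\<^sup>2" if "x \<ge> 0" for x :: real
proof -
  have "1 - x \<le> exp (-x)" using exp_ge_add_one_self[of "-x"] by simp
  have "exp (-x) \<le> 1 / (1 + x)"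
    using exp_ge_add_one_self[of x] that by (simp add: exp_minus divide_simps mult.commute)
  then have "exp (-x) - (1 - x) \<le> x\<^sup>2 / (1 + x)" using that by (simp add: field_simps power2_eq_square)
  also have "\<dots> \<le> x\<^sup>2" using that by (simp add: field_simps)
  finally show ?thesis using \<open>1 - x \<le> exp (-x)\<close> by simp
qed

text \<open>The exponent t^2 / 4 is half of the Gaussian exponent t^2 / 2, so after absorbing the
  quartic an integrable Gaussian factor remains. The bound itself is the quadratic Taylor minorant
  of exp.\<close>

lemma quartic_le_exp: "1 + t ^ 4 \<le> 32 * exp (t\<^sup>2 / 4)" for t :: real
proof -
  have "1 + y + y\<^sup>2 / 2 \<le> exp y" if "y \<ge> 0" for y :: real
    using exp_lower_Taylor_quadratic[OF that] .
  from this[of "t\<^sup>2 / 4"] have "1 + t\<^sup>2 / 4 + t ^ 4 / 32 \<le> exp (t\<^sup>2 / 4)"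
    by (simp add: power_divide flip: power_mult)
  then show ?thesis using zero_le_power2[of t] by linarith
qed

context regular_model begin

text \<open>The exponent is chosen so that the power \<open>CARD('m) + 4\<close> of the noise level
  is n^(-1/4): this power is what the Fourier integral of the quartic error costs, and it must be
  beaten by 1 / sqrt n.\<close>

definition noise :: "nat \<Rightarrow> real" where
  "noise n = real n powr (- 1 / (4 * (real CARD('m) + 4)))"

definition score_sum :: "real^'m \<Rightarrow> nat \<Rightarrow> (nat \<Rightarrow> 'a) \<Rightarrow> real^'m" where
  "score_sum \<theta> n \<omega> = (1 / sqrt (real n)) *\<^sub>R (\<Sum>i<n. l \<theta> (\<omega> i))"

abbreviation Pn where "Pn \<theta> n \<equiv> PiM {..<n} (\<lambda>_. P \<theta>)"

text \<open>The density of the score sum plus noise, evaluated at \<open>J \<theta> *v x\<close>. As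
  a density in x it still lacks the Jacobian det J, so its limit is the Gaussian density divided by
  det J.\<close>

definition smoothed_density :: "real^'m \<Rightarrow> nat \<Rightarrow> real^'m \<Rightarrow> real" where
  "smoothed_density \<theta> n x = (\<integral>\<omega>. scaled_gauss (noise n) (J \<theta> *v x - score_sum \<theta> n \<omega>) \<partial>Pn \<theta> n)"

lemma score_sum_measurable [measurable]:
  assumes [measurable]: "\<theta> \<in> \<Theta>"
  shows "score_sum \<theta> n \<in> borel_measurable (Pn \<theta> n)"
  unfolding score_sum_def by measurable

lemma prob_space_Pn: "\<theta> \<in> \<Theta> \<Longrightarrow> prob_space (Pn \<theta> n)"
  by (intro prob_space_PiM prob_space_P)

lemma noise_pos: "n \<ge> 1 \<Longrightarrow> noise n > 0"
  by (simp add: noise_def)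

lemma noise_le_1: "n \<ge> 1 \<Longrightarrow> noise n \<le> 1"
  unfolding noise_def using powr_mono[of "- 1 / (4 * (real CARD('m) + 4))" 0 "real n"] by simp

lemma noise_power: "n \<ge> 1 \<Longrightarrow> noise n ^ (CARD('m) + 4) = real n powr (- 1 / 4)"
proof -
  assume n: "n \<ge> 1"
  have "noise n ^ (CARD('m) + 4) = noise n powr (real (CARD('m) + 4))"
    by (simp only: powr_realpow[OF noise_pos[OF n]])
  also have "\<dots> = real n powr (- 1 / 4)"
  proof -
    have "- 1 / (4 * (real CARD('m) + 4)) * real (CARD('m) + 4) = - 1 / 4"
      by (simp add: divide_simps)
    then show ?thesis unfolding noise_def powr_powr by (simp only:)
  qed
  finally show ?thesis .
qed

lemma noise_tendsto_0:
  assumes "filterlim n at_top sequentially"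
  shows "(\<lambda>k. noise (n k)) \<longlonglongrightarrow> 0"
proof -
  have "((\<lambda>x::real. x powr (- 1 / (4 * (real CARD('m) + 4)))) \<longlongrightarrow> 0) at_top"
    by (rule tendsto_neg_powr) (auto simp: filterlim_ident divide_less_0_iff)
  then show ?thesis
    unfolding noise_def
    by (rule filterlim_compose[OF _ filterlim_compose[OF filterlim_real_sequentially assms]])
qed

section \<open>A quantitative central limit theorem for characteristic functions\<close>

lemma char_score_sum:
  assumes \<theta>: "\<theta> \<in> \<Theta>"
  shows "(\<integral>\<omega>. iexp (u \<bullet> score_sum \<theta> n \<omega>) \<partial>Pn \<theta> n) = (char (distr (P \<theta>) borel (\<lambda>x. u \<bullet> l \<theta> x)) (1 / sqrt (real n))) ^ n"
proof -
  have [measurable]: "\<theta> \<in> \<Theta>" by fact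
  interpret Q: prob_space "P \<theta>" by (rule prob_space_P[OF \<theta>])
  interpret product_prob_space "\<lambda>_::nat. P \<theta>" by (intro product_prob_spaceI prob_space_P \<theta>)
  let ?f = "\<lambda>x. iexp ((1 / sqrt (real n)) * (u \<bullet> l \<theta> x))"
  have "iexp (u \<bullet> score_sum \<theta> n \<omega>) = (\<Prod>i<n. ?f (\<omega> i))" for \<omega>
  proof -
    have "u \<bullet> score_sum \<theta> n \<omega> = (\<Sum>i<n. (1 / sqrt (real n)) * (u \<bullet> l \<theta> (\<omega> i)))"
      by (simp add: score_sum_def inner_sum_right sum_divide_distrib)
    then show ?thesis by (simp add: sum_distrib_left exp_sum)
  qed
  then have "(\<integral>\<omega>. iexp (u \<bullet> score_sum \<theta> n \<omega>) \<partial>Pn \<theta> n) = (\<integral>\<omega>. (\<Prod>i<n. ?f (\<omega> i)) \<partial>Pn \<theta> n)" by presburger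
  also have "\<dots> = (\<Prod>i<n. \<integral>x. ?f x \<partial>P \<theta>)"
    by (rule product_integral_prod) (auto intro!: Q.integrable_const_bound[where B=1])
  also have "\<dots> = (\<integral>x. ?f x \<partial>P \<theta>) ^ n" by simp
  also have "(\<integral>x. ?f x \<partial>P \<theta>) = char (distr (P \<theta>) borel (\<lambda>x. u \<bullet> l \<theta> x)) (1 / sqrt (real n))"
    unfolding char_def by (subst integral_distr) auto
  finally show ?thesis .
qed

text \<open>Both the characteristic function of one summand and exp (-q / (2 n)) are close to 1 - q
  / (2 n), up to a third moment of order n^(-3/2) and q^2 / n^2. The dependence on u is kept
  explicit because the bound is integrated over all u, and only second and third moments enter, so
  it is uniform over compact parameter sets.\<close>

lemma char_score_sum_bound:
  assumes \<theta>: "\<theta> \<in> \<Theta>" and n: "n \<ge> 1"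
    and C2: "(\<integral>x. norm (l \<theta> x) ^ 2 \<partial>P \<theta>) \<le> C2" and C3: "(\<integral>x. norm (l \<theta> x) ^ 3 \<partial>P \<theta>) \<le> C3"
  shows "cmod ((\<integral>\<omega>. iexp (u \<bullet> score_sum \<theta> n \<omega>) \<partial>Pn \<theta> n) - exp (- (u \<bullet> (J \<theta> *v u)) / 2))
     \<le> (C3 + C2\<^sup>2) * (1 + norm u ^ 4) / sqrt (real n)"
proof -
  have [measurable]: "\<theta> \<in> \<Theta>" by fact
  interpret prob_space "P \<theta>" by (rule prob_space_P[OF \<theta>])
  define t where "t = 1 / sqrt (real n)"
  define q where "q = u \<bullet> (J \<theta> *v u)"
  let ?X = "\<lambda>x. u \<bullet> l \<theta> x"
  let ?D = "distr (P \<theta>) borel ?X"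
  have t: "t > 0" "t\<^sup>2 = 1 / real n" "t \<le> 1" using n by (auto simp: t_def power_divide)
  have X1: "integrable (P \<theta>) ?X" "expectation ?X = 0"
    by (auto intro: integrable_inner_score[OF \<theta>] simp: score_mean_zero[OF \<theta>])
  have X2: "integrable (P \<theta>) (\<lambda>x. (?X x)\<^sup>2)" "expectation (\<lambda>x. (?X x)\<^sup>2) = q"
    using integrable_score_product[OF \<theta>, of u u] by (auto simp: q_def fisher_bilinear[OF \<theta>] power2_eq_square)
  have q0: "q \<ge> 0" using X2(2) by (metis Bochner_Integration.integral_nonneg zero_le_power2)
  have C20: "C2 \<ge> 0" and C30: "C3 \<ge> 0"
    using C2 C3 order_trans[OF Bochner_Integration.integral_nonneg] by (metis norm_ge_zero zero_le_power)+
  have q: "q \<le> (norm u)\<^sup>2 * C2"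
  proof -
    have "q \<le> (\<integral>x. (norm u)\<^sup>2 * norm (l \<theta> x) ^ 2 \<partial>P \<theta>)"
      unfolding X2(2)[symmetric]
    proof (rule integral_mono[OF X2(1)])
      show "integrable (P \<theta>) (\<lambda>x. (norm u)\<^sup>2 * norm (l \<theta> x) ^ 2)" using integrable_moment[OF \<theta>, of 2] by auto
      show "(?X x)\<^sup>2 \<le> (norm u)\<^sup>2 * norm (l \<theta> x) ^ 2" for x
        using power_mono[OF Cauchy_Schwarz_ineq2, of u "l \<theta> x" 2] by (auto simp: power_mult_distrib)
    qed
    also have "\<dots> \<le> (norm u)\<^sup>2 * C2" using C2 by (simp add: mult_left_mono)
    finally show ?thesis .
  qed
  have a1: "cmod (char ?D t - (1 - t\<^sup>2 * q / 2)) \<le> (t\<^sup>2 / 6) * expectation (\<lambda>x. min (6 * (?X x)\<^sup>2) (\<bar>t\<bar> * \<bar>?X x\<bar> ^ 3))"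
    by (rule char_approx3'[OF _ X1(1) X2(1) X1(2)]) (auto simp: X1 X2)
  have "expectation (\<lambda>x. min (6 * (?X x)\<^sup>2) (\<bar>t\<bar> * \<bar>?X x\<bar> ^ 3)) \<le> (\<integral>x. t * norm u ^ 3 * norm (l \<theta> x) ^ 3 \<partial>P \<theta>)"
  proof (rule integral_mono)
    show "integrable (P \<theta>) (\<lambda>x. min (6 * (?X x)\<^sup>2) (\<bar>t\<bar> * \<bar>?X x\<bar> ^ 3))"
      by (rule Bochner_Integration.integrable_bound[of _ "\<lambda>x. 6 * (?X x)\<^sup>2"]) (use X2 in auto)
    show "integrable (P \<theta>) (\<lambda>x. t * norm u ^ 3 * norm (l \<theta> x) ^ 3)" using integrable_moment[OF \<theta>, of 3] by auto
    fix x
    have "\<bar>?X x\<bar> ^ 3 \<le> (norm u * norm (l \<theta> x)) ^ 3" by (intro power_mono Cauchy_Schwarz_ineq2) auto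
    then have "\<bar>t\<bar> * \<bar>?X x\<bar> ^ 3 \<le> t * (norm u * norm (l \<theta> x)) ^ 3" using t(1) by simp
    then show "min (6 * (?X x)\<^sup>2) (\<bar>t\<bar> * \<bar>?X x\<bar> ^ 3) \<le> t * norm u ^ 3 * norm (l \<theta> x) ^ 3"
      by (simp add: power_mult_distrib mult.assoc min.coboundedI2)
  qed
  also have "\<dots> \<le> t * norm u ^ 3 * C3" using C3 t(1) by (simp add: mult_left_mono)
  finally have a2: "cmod (char ?D t - (1 - t\<^sup>2 * q / 2)) \<le> (t\<^sup>2 / 6) * (t * norm u ^ 3 * C3)"
    using a1 by (smt (verit) divide_nonneg_nonneg mult_left_mono zero_le_power2)
  have b: "\<bar>exp (- (t\<^sup>2 * q / 2)) - (1 - t\<^sup>2 * q / 2)\<bar> \<le> (t\<^sup>2 * q / 2)\<^sup>2"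
    using q0 by (intro exp_minus_quadratic_bound) auto
  have "cmod (char ?D t - exp (- (t\<^sup>2 * q / 2))) \<le> cmod (char ?D t - (1 - t\<^sup>2 * q / 2)) + cmod (complex_of_real (1 - t\<^sup>2 * q / 2) - exp (- (t\<^sup>2 * q / 2)))"
    using norm_triangle_ineq[of "char ?D t - (1 - t\<^sup>2 * q / 2)" "complex_of_real (1 - t\<^sup>2 * q / 2) - exp (- (t\<^sup>2 * q / 2))"] by simp
  also have "cmod (complex_of_real (1 - t\<^sup>2 * q / 2) - exp (- (t\<^sup>2 * q / 2))) = \<bar>exp (- (t\<^sup>2 * q / 2)) - (1 - t\<^sup>2 * q / 2)\<bar>"
    by (simp only: norm_of_real of_real_diff[symmetric] abs_minus_commute)
  finally have d: "cmod (char ?D t - exp (- (t\<^sup>2 * q / 2))) \<le> (t\<^sup>2 / 6) * (t * norm u ^ 3 * C3) + (t\<^sup>2 * q / 2)\<^sup>2"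
    using a2 b by linarith
  interpret D: real_distribution ?D by (intro real_distribution_distr) measurable
  \<comment> \<open>Both bases have modulus at most 1, so the n-th powers differ by at most n times
    the difference of the bases.\<close>
  have "cmod (char ?D t ^ n - complex_of_real (exp (- (t\<^sup>2 * q / 2))) ^ n) \<le> n * cmod (char ?D t - exp (- (t\<^sup>2 * q / 2)))"
    using q0 by (intro norm_power_diff D.cmod_char_le_1) (auto simp: norm_exp)
  also have "\<dots> \<le> n * ((t\<^sup>2 / 6) * (t * norm u ^ 3 * C3) + (t\<^sup>2 * q / 2)\<^sup>2)"
    using d by (intro mult_left_mono) auto
  also have "\<dots> = t * (norm u ^ 3 * C3 / 6) + t\<^sup>2 * (q\<^sup>2 / 4)"
    using n by (simp add: t(2) power_divide power_mult_distrib field_simps power2_eq_square[of "real n"])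
  also have "\<dots> \<le> t * (norm u ^ 3 * C3 / 6) + t * (q\<^sup>2 / 4)"
  proof (intro add_left_mono mult_right_mono)
    show "t\<^sup>2 \<le> t" unfolding power2_eq_square using t(1,3) by (simp add: mult_left_le)
  qed simp
  also have "\<dots> \<le> t * ((1 + norm u ^ 4) * C3) + t * ((1 + norm u ^ 4) * C2\<^sup>2)"
  proof (intro add_mono mult_left_mono)
    have u3: "norm u ^ 3 \<le> 1 + norm u ^ 4"
    proof (cases "norm u \<le> 1")
      case True then have "norm u ^ 3 \<le> 1" by (simp add: power_le_one)
      then show ?thesis using zero_le_power[OF norm_ge_zero[of u], of 4] by linarith
    next
      case False then have "norm u ^ 3 \<le> norm u ^ 4" by (intro power_increasing) auto
      then show ?thesis by simp
    qed
    have "norm u ^ 3 * C3 / 6 \<le> norm u ^ 3 * C3" using C30 by simp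
    also have "\<dots> \<le> (1 + norm u ^ 4) * C3" using u3 C30 by (intro mult_right_mono)
    finally show "norm u ^ 3 * C3 / 6 \<le> (1 + norm u ^ 4) * C3" .
    have "q\<^sup>2 \<le> ((norm u)\<^sup>2 * C2)\<^sup>2" using q q0 by (intro power_mono)
    also have "\<dots> = norm u ^ 4 * C2\<^sup>2" by (simp add: power_mult_distrib flip: power_mult)
    also have "\<dots> \<le> (1 + norm u ^ 4) * C2\<^sup>2" by (intro mult_right_mono) auto
    finally show "q\<^sup>2 / 4 \<le> (1 + norm u ^ 4) * C2\<^sup>2" using zero_le_power2[of q] by linarith
  qed (use t in auto)
  also have "\<dots> = (C3 + C2\<^sup>2) * (1 + norm u ^ 4) / sqrt (real n)"
    by (simp add: t_def add_divide_distrib algebra_simps)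
  also have "complex_of_real (exp (- (t\<^sup>2 * q / 2))) ^ n = exp (- q / 2)"
  proof -
    have "exp (- (t\<^sup>2 * q / 2)) ^ n = exp (real n * - (t\<^sup>2 * q / 2))" by (rule exp_of_nat_mult[symmetric])
    also have "real n * - (t\<^sup>2 * q / 2) = - q / 2" using n by (simp add: t(2))
    finally show ?thesis by (simp flip: of_real_power of_real_exp)
  qed
  finally show ?thesis
    unfolding char_score_sum[OF \<theta>] t_def[symmetric] q_def[symmetric] by simp
qed

end

text \<open>The Fourier formula for \<open>scaled_gauss\<close> at the origin, solved for the
  integral.\<close>

lemma integral_exp_norm_sq:
  assumes d: "d > 0"
  shows "(\<integral>u. exp (- (d\<^sup>2 * (norm u)\<^sup>2) / 2) \<partial>(lborel :: (real^'n::finite) measure))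
    = (2 * pi) ^ CARD('n) * std_gauss (0 :: real^'n) / d ^ CARD('n)"
proof -
  have "complex_of_real (scaled_gauss d (0::real^'n)) = complex_of_real (1 / (2 * pi) ^ CARD('n) * (\<integral>u. exp (- (d\<^sup>2 * (norm u)\<^sup>2) / 2) \<partial>(lborel :: (real^'n) measure)))"
    unfolding scaled_gauss_fourier(2)[OF d, of 0] by (simp flip: of_real_exp)
  then have "scaled_gauss d (0::real^'n) = 1 / (2 * pi) ^ CARD('n) * (\<integral>u. exp (- (d\<^sup>2 * (norm u)\<^sup>2) / 2) \<partial>(lborel :: (real^'n) measure))"
    by (simp only: of_real_eq_iff)
  then show ?thesis by (simp add: scaled_gauss_def field_simps)
qed

lemma pos_def_lower_bound:
  fixes J :: "real^'n::finite^'n"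
  assumes pd: "\<And>x. x \<noteq> 0 \<Longrightarrow> x \<bullet> (J *v x) > 0"
  obtains \<kappa> where "\<kappa> > 0" "\<And>x. x \<bullet> (J *v x) \<ge> \<kappa> * (norm x)\<^sup>2"
proof -
  have "continuous_on (sphere (0::real^'n) 1) (\<lambda>x. x \<bullet> (J *v x))"
    by (intro continuous_intros linear_continuous_on matrix_vector_mul_bounded_linear)
  moreover have "sphere (0::real^'n) 1 \<noteq> {}" by simp
  ultimately obtain x0 where x0: "x0 \<in> sphere 0 1" "\<And>x. x \<in> sphere 0 1 \<Longrightarrow> x0 \<bullet> (J *v x0) \<le> x \<bullet> (J *v x)"
    using continuous_attains_inf[OF compact_sphere, of 0 1 "\<lambda>x. x \<bullet> (J *v x)"] by blast
  show ?thesis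
  proof (rule that[of "x0 \<bullet> (J *v x0)"])
    have "x0 \<noteq> 0" using x0(1) by auto
    then show "x0 \<bullet> (J *v x0) > 0" by (rule pd)
    fix x :: "real^'n"
    show "x \<bullet> (J *v x) \<ge> (x0 \<bullet> (J *v x0)) * (norm x)\<^sup>2"
    proof (cases "x = 0")
      case False
      have "x0 \<bullet> (J *v x0) \<le> ((1 / norm x) *\<^sub>R x) \<bullet> (J *v ((1 / norm x) *\<^sub>R x))"
        using False by (intro x0(2)) auto
      also have "\<dots> = (x \<bullet> (J *v x)) / (norm x)\<^sup>2"
        by (simp add: matrix_vector_mult_scaleR power2_eq_square)
      finally show ?thesis using False by (simp add: pos_le_divide_eq)
    qed simp
  qed
qed

lemma tendsto_matrix_vector_mult:
  fixes A :: "nat \<Rightarrow> real^'n::finite^'m::finite"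
  assumes "A \<longlonglongrightarrow> B" "x \<longlonglongrightarrow> y"
  shows "(\<lambda>k. A k *v x k) \<longlonglongrightarrow> B *v y"
  unfolding matrix_vector_mult_def
  by (intro vec_tendstoI) (auto intro!: tendsto_intros tendsto_vec_nth assms)

lemma tendsto_det:
  fixes A :: "nat \<Rightarrow> real^'n::finite^'n"
  assumes "A \<longlonglongrightarrow> B"
  shows "(\<lambda>k. det (A k)) \<longlonglongrightarrow> det B"
  unfolding det_def by (intro tendsto_intros tendsto_vec_nth assms)

text \<open>Entrywise convergence of matrices thus controls their quadratic forms uniformly in the
  direction.\<close>

lemma quadratic_form_perturbation:
  fixes A :: "real^'n::finite^'n"
  shows "\<bar>u \<bullet> (A *v u)\<bar> \<le> (\<Sum>i\<in>UNIV. \<Sum>j\<in>UNIV. \<bar>A $ i $ j\<bar>) * (norm u)\<^sup>2"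
proof -
  have "\<bar>u \<bullet> (A *v u)\<bar> = \<bar>\<Sum>i\<in>UNIV. \<Sum>j\<in>UNIV. u $ i * (A $ i $ j * u $ j)\<bar>"
    by (simp add: inner_vec_def matrix_vector_mult_def sum_distrib_left)
  also have "\<dots> \<le> (\<Sum>i\<in>UNIV. \<Sum>j\<in>UNIV. \<bar>u $ i * (A $ i $ j * u $ j)\<bar>)"
    by (intro order_trans[OF sum_abs] sum_mono sum_abs)
  also have "\<dots> \<le> (\<Sum>i\<in>UNIV. \<Sum>j\<in>UNIV. \<bar>A $ i $ j\<bar> * (norm u)\<^sup>2)"
  proof (intro sum_mono)
    fix i j
    have "\<bar>u $ i\<bar> * \<bar>u $ j\<bar> \<le> norm u * norm u"
      by (intro mult_mono component_le_norm_cart) auto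
    then have "\<bar>A $ i $ j\<bar> * (\<bar>u $ i\<bar> * \<bar>u $ j\<bar>) \<le> \<bar>A $ i $ j\<bar> * (norm u)\<^sup>2"
      unfolding power2_eq_square by (intro mult_left_mono) auto
    then show "\<bar>u $ i * (A $ i $ j * u $ j)\<bar> \<le> \<bar>A $ i $ j\<bar> * (norm u)\<^sup>2"
      by (simp add: abs_mult mult_ac)
  qed
  finally show ?thesis by (simp add: sum_distrib_right)
qed

context regular_model begin

section \<open>Fourier inversion for the smoothed score density\<close>

text \<open>Fubini applies because the transform of the noise is integrable in u and the data enter
  only through factors of modulus 1. The characteristic function of the score sum itself need not be
  integrable.\<close>

lemma smoothed_density_fourier:
  assumes \<theta>: "\<theta> \<in> \<Theta>" and n: "n \<ge> 1"
  shows "complex_of_real (smoothed_density \<theta> n x) = (1 / (2 * pi) ^ CARD('m)) *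
     (\<integral>u. complex_of_real (exp (- ((noise n)\<^sup>2 * (norm u)\<^sup>2) / 2)) * iexp (- (u \<bullet> (J \<theta> *v x)))
        * (\<integral>\<omega>. iexp (u \<bullet> score_sum \<theta> n \<omega>) \<partial>Pn \<theta> n) \<partial>lborel)"
proof -
  have [measurable]: "\<theta> \<in> \<Theta>" by fact
  interpret N: prob_space "Pn \<theta> n" by (rule prob_space_Pn[OF \<theta>])
  interpret L: pair_sigma_finite "Pn \<theta> n" "lborel :: (real^'m) measure" ..
  let ?e = "\<lambda>u. complex_of_real (exp (- ((noise n)\<^sup>2 * (norm u)\<^sup>2) / 2))"
  let ?y = "J \<theta> *v x"
  let ?S = "score_sum \<theta> n"
  let ?g = "\<lambda>\<omega> u. ?e u * iexp (- (u \<bullet> (?y - ?S \<omega>)))"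
  have ei: "integrable lborel (\<lambda>u::real^'m. exp (- ((noise n)\<^sup>2 * (norm u)\<^sup>2) / 2))"
    by (rule scaled_gauss_fourier(1)[OF noise_pos[OF n]])
  have gi: "integrable (Pn \<theta> n \<Otimes>\<^sub>M lborel) (case_prod ?g)"
  proof (rule L.Fubini_integrable)
    show "case_prod ?g \<in> borel_measurable (Pn \<theta> n \<Otimes>\<^sub>M lborel)" by measurable
    have n1: "norm (case_prod ?g (\<omega>, u)) = exp (- ((noise n)\<^sup>2 * (norm u)\<^sup>2) / 2)" for \<omega> u
      by (simp add: norm_mult)
    show "integrable (Pn \<theta> n) (\<lambda>\<omega>. \<integral>u. norm (case_prod ?g (\<omega>, u)) \<partial>lborel)"
      unfolding n1 by simp
    show "AE \<omega> in Pn \<theta> n. integrable lborel (\<lambda>u. case_prod ?g (\<omega>, u))"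
    proof (rule AE_I2)
      fix \<omega> assume "\<omega> \<in> space (Pn \<theta> n)"
      show "integrable lborel (\<lambda>u. case_prod ?g (\<omega>, u))"
        by (rule Bochner_Integration.integrable_bound[OF ei]) (auto simp: norm_mult)
    qed
  qed
  have "complex_of_real (smoothed_density \<theta> n x) = (\<integral>\<omega>. complex_of_real (scaled_gauss (noise n) (?y - ?S \<omega>)) \<partial>Pn \<theta> n)"
    by (simp add: smoothed_density_def)
  also have "\<dots> = (\<integral>\<omega>. (1 / (2 * pi) ^ CARD('m)) * (\<integral>u. ?g \<omega> u \<partial>lborel) \<partial>Pn \<theta> n)"
    by (simp only: scaled_gauss_fourier(2)[OF noise_pos[OF n]])
  also have "\<dots> = (1 / (2 * pi) ^ CARD('m)) * (\<integral>\<omega>. (\<integral>u. ?g \<omega> u \<partial>lborel) \<partial>Pn \<theta> n)"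
    by (rule integral_mult_right_zero)
  also have "(\<integral>\<omega>. (\<integral>u. ?g \<omega> u \<partial>lborel) \<partial>Pn \<theta> n) = (\<integral>u. (\<integral>\<omega>. ?g \<omega> u \<partial>Pn \<theta> n) \<partial>lborel)"
    by (rule L.Fubini_integral[OF gi, symmetric])
  also have "\<dots> = (\<integral>u. ?e u * iexp (- (u \<bullet> ?y)) * (\<integral>\<omega>. iexp (u \<bullet> ?S \<omega>) \<partial>Pn \<theta> n) \<partial>lborel)"
  proof (intro Bochner_Integration.integral_cong refl)
    fix u :: "real^'m"
    have "?g \<omega> u = ?e u * iexp (- (u \<bullet> ?y)) * iexp (u \<bullet> ?S \<omega>)" for \<omega>
      by (simp add: inner_diff_right exp_add[symmetric] algebra_simps)
    then show "(\<integral>\<omega>. ?g \<omega> u \<partial>Pn \<theta> n) = ?e u * iexp (- (u \<bullet> ?y)) * (\<integral>\<omega>. iexp (u \<bullet> ?S \<omega>) \<partial>Pn \<theta> n)"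
      by (simp only: integral_mult_right_zero)
  qed
  finally show ?thesis .
qed

text \<open>The Gaussian volume contributes the noise level to the power -m and the quartic the
  power -4; by the choice of \<open>noise\<close> their product is n^(1/4).\<close>

lemma gauss_quartic_integral_bound:
  assumes n: "n \<ge> 1"
  defines "c \<equiv> 32 * ((2 * pi) ^ CARD('m) * std_gauss (0 :: real^'m) * sqrt 2 ^ CARD('m))"
  shows "integrable lborel (\<lambda>u::real^'m. exp (- ((noise n)\<^sup>2 * (norm u)\<^sup>2) / 2) * (1 + norm u ^ 4))"
    and "(\<integral>u. exp (- ((noise n)\<^sup>2 * (norm u)\<^sup>2) / 2) * (1 + norm u ^ 4) \<partial>(lborel :: (real^'m) measure)) \<le> c * real n powr (1 / 4)"
proof -
  let ?d = "noise n"
  have d: "?d > 0" "?d \<le> 1" using noise_pos[OF n] noise_le_1[OF n] by auto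
  let ?f = "\<lambda>u::real^'m. exp (- (?d\<^sup>2 * (norm u)\<^sup>2) / 2) * (1 + norm u ^ 4)"
  \<comment> \<open>Halving the exponent corresponds to the smaller noise level
    \<open>?d / sqrt 2\<close>; the factor \<open>1 / ?d ^ 4\<close> pays for rescaling the
    quartic.\<close>
  let ?g = "\<lambda>u::real^'m. (32 / ?d ^ 4) * exp (- ((?d / sqrt 2)\<^sup>2 * (norm u)\<^sup>2) / 2)"
  have le: "?f u \<le> ?g u" for u :: "real^'m"
  proof -
    have "?d ^ 4 * (1 + norm u ^ 4) \<le> 1 + (?d * norm u) ^ 4"
      using d by (simp add: distrib_left power_mult_distrib power_le_one)
    also have "\<dots> \<le> 32 * exp ((?d * norm u)\<^sup>2 / 4)" by (rule quartic_le_exp)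
    finally have "1 + norm u ^ 4 \<le> (32 / ?d ^ 4) * exp ((?d * norm u)\<^sup>2 / 4)"
      using d by (simp add: field_simps)
    then have "?f u \<le> exp (- (?d\<^sup>2 * (norm u)\<^sup>2) / 2) * ((32 / ?d ^ 4) * exp ((?d * norm u)\<^sup>2 / 4))"
      by (intro mult_left_mono) auto
    also have "\<dots> = (32 / ?d ^ 4) * exp (- (?d\<^sup>2 * (norm u)\<^sup>2) / 2 + (?d * norm u)\<^sup>2 / 4)"
      unfolding exp_add by (simp only: mult_ac)
    also have "- (?d\<^sup>2 * (norm u)\<^sup>2) / 2 + (?d * norm u)\<^sup>2 / 4 = - ((?d / sqrt 2)\<^sup>2 * (norm u)\<^sup>2) / 2"
      by (simp add: power_mult_distrib power_divide field_simps)
    finally show ?thesis .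
  qed
  have d2: "?d / sqrt 2 > 0" using d by simp
  have gi: "integrable lborel ?g" using scaled_gauss_fourier(1)[OF d2] by (rule integrable_mult_right)
  show fi: "integrable lborel ?f"
  proof (rule Bochner_Integration.integrable_bound[OF gi])
    show "AE u in lborel. norm (?f u) \<le> norm (?g u)"
    proof (rule AE_I2)
      fix u :: "real^'m"
      have "?f u \<ge> 0" by (intro mult_nonneg_nonneg add_nonneg_nonneg) auto
      then show "norm (?f u) \<le> norm (?g u)" using le[of u] unfolding real_norm_def by linarith
    qed
  qed measurable
  have "(\<integral>u. ?f u \<partial>lborel) \<le> (\<integral>u. ?g u \<partial>lborel)" by (rule integral_mono[OF fi gi le])
  also have "\<dots> = (32 / ?d ^ 4) * ((2 * pi) ^ CARD('m) * std_gauss (0 :: real^'m) / (?d / sqrt 2) ^ CARD('m))"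
    unfolding integral_mult_right_zero integral_exp_norm_sq[OF d2] ..
  also have "\<dots> = c / ?d ^ (CARD('m) + 4)"
    unfolding c_def power_divide power_add using d by (simp add: field_simps)
  also have "\<dots> = c * real n powr (1 / 4)"
  proof -
    have "real n powr (- 1 / 4) = 1 / (real n powr (1 / 4))"
      using powr_minus_divide[of "real n" "1 / 4"] by simp
    then show ?thesis by (simp only: noise_power[OF n] divide_divide_eq_right mult_1_right div_by_1)
  qed
  finally show "(\<integral>u. ?f u \<partial>lborel) \<le> c * real n powr (1 / 4)" .
qed

end

text \<open>Gaussian Fourier inversion with B the transposed factor of J = A A^T, for which |B u|^2
  = u . J u and the frequency vector is J x.\<close>

lemma fourier_normal_precision_density:
  fixes J :: "real^'n::finite^'n"
  assumes sym: "transpose J = J" and pd: "\<And>x. x \<noteq> 0 \<Longrightarrow> x \<bullet> (J *v x) > 0"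
  shows "(\<integral>u. iexp (- (u \<bullet> (J *v x))) * complex_of_real (exp (- (u \<bullet> (J *v u)) / 2)) \<partial>lborel)
     = complex_of_real ((2 * pi) ^ CARD('n) * (normal_precision_density J x / det J))"
proof -
  obtain A :: "real^'n^'n" where A: "invertible A" "J = A ** transpose A"
    by (rule pos_def_factorization[OF sym pd])
  have tA: "invertible (transpose A)" using A(1) by (simp add: invertible_det_nz det_transpose)
  have n: "(norm (transpose A *v u))\<^sup>2 = u \<bullet> (J *v u)" for u
    unfolding A(2) by (metis dot_lmul_matrix matrix_vector_mul_assoc power2_norm_eq_inner vector_transpose_matrix transpose_transpose)
  have y: "transpose (transpose A) *v (transpose A *v x) = J *v x"
    unfolding A(2) by (simp only: matrix_vector_mul_assoc transpose_transpose)
  have dA: "det A \<noteq> 0" using A(1) invertible_det_nz by blast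
  have dJ: "det J = \<bar>det A\<bar> * \<bar>det A\<bar>" unfolding A(2) by (simp add: det_mul det_transpose)
  have "(\<integral>u. iexp (- (u \<bullet> (J *v x))) * complex_of_real (exp (- (u \<bullet> (J *v u)) / 2)) \<partial>lborel)
     = complex_of_real ((2 * pi) ^ CARD('n) / \<bar>det A\<bar> * std_gauss (transpose A *v x))"
    using fourier_inversion_gauss(2)[OF tA, of "transpose A *v x"] unfolding n y det_transpose
    by (simp only: mult.commute)
  also have "(2 * pi) ^ CARD('n) / \<bar>det A\<bar> * std_gauss (transpose A *v x) = (2 * pi) ^ CARD('n) * (normal_precision_density J x / det J)"
  proof -
    have "a / D * g = a * (D * g / (D * D))" if "D \<noteq> 0" for a D g :: real using that by simp
    from this[of "\<bar>det A\<bar>"] show ?thesis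
      unfolding dJ using dA normal_precision_density_eq[of A x] unfolding A(2)[symmetric] by (simp only: abs_eq_0 not_False_eq_True)
  qed
  finally show ?thesis .
qed

context regular_model begin

text \<open>A single constant for all late k supplies the integrable Gaussian majorant in the
  passage to the limit under the Fourier integral.\<close>

lemma fisher_eventually_pos_def:
  assumes \<theta>: "\<theta> \<in> \<Theta>" and \<eta>: "\<And>k. \<eta> k \<in> \<Theta>" "\<eta> \<longlonglongrightarrow> \<theta>"
  obtains \<kappa> N where "\<kappa> > 0" "\<And>k u. k \<ge> N \<Longrightarrow> u \<bullet> (J (\<eta> k) *v u) \<ge> \<kappa> * (norm u)\<^sup>2"
proof -
  obtain \<kappa> where \<kappa>: "\<kappa> > 0" "\<And>u. u \<bullet> (J \<theta> *v u) \<ge> \<kappa> * (norm u)\<^sup>2"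
    by (rule pos_def_lower_bound[of "J \<theta>"]) (auto intro: fisher_pos_def[OF \<theta>])
  let ?e = "\<lambda>k. \<Sum>i\<in>UNIV. \<Sum>j\<in>UNIV. \<bar>(J (\<eta> k) - J \<theta>) $ i $ j\<bar>"
  have "(\<lambda>k. J (\<eta> k) - J \<theta>) \<longlonglongrightarrow> J \<theta> - J \<theta>"
    by (intro tendsto_intros fisher_continuous[OF \<theta> \<eta>])
  then have "?e \<longlonglongrightarrow> (\<Sum>i\<in>UNIV. \<Sum>j\<in>UNIV. \<bar>(J \<theta> - J \<theta>) $ i $ j\<bar>)"
    by (intro tendsto_sum tendsto_rabs tendsto_vec_nth)
  then have "?e \<longlonglongrightarrow> 0" by simp
  then have "eventually (\<lambda>k. ?e k < \<kappa> / 2) sequentially"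
    using \<kappa>(1) by (intro order_tendstoD(2)) auto
  then obtain N where N: "\<And>k. k \<ge> N \<Longrightarrow> ?e k < \<kappa> / 2" unfolding eventually_sequentially by blast
  show ?thesis
  proof (rule that[of "\<kappa> / 2" N])
    fix k u assume k: "N \<le> k"
    have "\<bar>u \<bullet> ((J (\<eta> k) - J \<theta>) *v u)\<bar> \<le> ?e k * (norm u)\<^sup>2" by (rule quadratic_form_perturbation)
    also have "\<dots> \<le> \<kappa> / 2 * (norm u)\<^sup>2" using N[OF k] by (intro mult_right_mono) auto
    finally have "\<bar>u \<bullet> (J (\<eta> k) *v u) - u \<bullet> (J \<theta> *v u)\<bar> \<le> \<kappa> / 2 * (norm u)\<^sup>2"
      by (simp add: matrix_vector_mult_diff_rdistrib inner_diff_right)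
    then show "u \<bullet> (J (\<eta> k) *v u) \<ge> \<kappa> / 2 * (norm u)\<^sup>2"
      using \<kappa>(2)[of u] by linarith
  qed (use \<kappa> in auto)
qed

text \<open>The characteristic function \<open>\<psi>\<close> is split as (\<open>\<psi>\<close> -
  \<open>G\<close>) + \<open>G\<close> with \<open>G\<close> the Gaussian one. The first part
  contributes n^(-1/2) times n^(1/4), which vanishes. In the second the noise factor tends to 1, and
  dominated convergence gives the inversion formula of the limit.\<close>

lemma smoothed_density_tendsto:
  assumes \<theta>: "\<theta> \<in> \<Theta>" and \<eta>: "\<And>k. \<eta> k \<in> \<Theta>" "\<eta> \<longlonglongrightarrow> \<theta>"
    and n: "\<And>k. n k \<ge> 1" "filterlim n at_top sequentially"
  shows "(\<lambda>k. smoothed_density (\<eta> k) (n k) x) \<longlonglongrightarrow> normal_precision_density (J \<theta>) x / det (J \<theta>)"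
proof -
  have K1: "compact (insert \<theta> (range \<eta>))" by (rule compact_sequence_with_limit[OF \<eta>(2)])
  have K2: "insert \<theta> (range \<eta>) \<subseteq> \<Theta>" using \<theta> \<eta>(1) by blast
  obtain C2 where C2: "\<And>\<theta>'. \<theta>' \<in> insert \<theta> (range \<eta>) \<Longrightarrow> (\<integral>x. norm (l \<theta>' x) ^ 2 * exp (0 * norm (l \<theta>' x)) \<partial>P \<theta>') \<le> C2"
    by (rule uniform_moments[OF K1 K2 order_refl, where k=2]) (rule that)
  obtain C3 where C3: "\<And>\<theta>'. \<theta>' \<in> insert \<theta> (range \<eta>) \<Longrightarrow> (\<integral>x. norm (l \<theta>' x) ^ 3 * exp (0 * norm (l \<theta>' x)) \<partial>P \<theta>') \<le> C3"
    by (rule uniform_moments[OF K1 K2 order_refl, where k=3]) (rule that)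
  have C2': "(\<integral>x. norm (l (\<eta> k) x) ^ 2 \<partial>P (\<eta> k)) \<le> C2" and C3': "(\<integral>x. norm (l (\<eta> k) x) ^ 3 \<partial>P (\<eta> k)) \<le> C3" for k
    using C2[of "\<eta> k"] C3[of "\<eta> k"] by simp_all
  define C where "C = C3 + C2\<^sup>2"
  define e where "e k u = exp (- ((noise (n k))\<^sup>2 * (norm u)\<^sup>2) / 2)" for k and u :: "real^'m"
  define E where "E k u = complex_of_real (e k u) * iexp (- (u \<bullet> (J (\<eta> k) *v x)))" for k u
  define \<psi> where "\<psi> k u = (\<integral>\<omega>. iexp (u \<bullet> score_sum (\<eta> k) (n k) \<omega>) \<partial>Pn (\<eta> k) (n k))" for k u
  define G where "G k u = complex_of_real (exp (- (u \<bullet> (J (\<eta> k) *v u)) / 2))" for k u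
  have e_int: "integrable lborel (e k)" for k
    unfolding e_def by (rule scaled_gauss_fourier(1)[OF noise_pos[OF n(1)]])
  have [measurable]: "e k \<in> borel_measurable borel" "E k \<in> borel_measurable borel" "G k \<in> borel_measurable borel" for k
    unfolding e_def E_def G_def by measurable
  have \<psi>_meas[measurable]: "\<psi> k \<in> borel_measurable borel" for k
  proof -
    have [measurable]: "\<eta> k \<in> \<Theta>" by (rule \<eta>)
    interpret N: prob_space "Pn (\<eta> k) (n k)" by (rule prob_space_Pn[OF \<eta>(1)])
    show ?thesis unfolding \<psi>_def by measurable
  qed
  have nE: "norm (E k u) = e k u" for k u by (simp add: E_def e_def norm_mult)
  have \<psi>G: "norm (\<psi> k u - G k u) \<le> C * (1 + norm u ^ 4) / sqrt (real (n k))" for k u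
    unfolding \<psi>_def G_def C_def by (rule char_score_sum_bound[OF \<eta>(1) n(1) C2' C3'])
  have bound: "norm (E k u * (\<psi> k u - G k u)) \<le> (C / sqrt (real (n k))) * (e k u * (1 + norm u ^ 4))" for k u
  proof -
    have "norm (E k u * (\<psi> k u - G k u)) \<le> e k u * (C * (1 + norm u ^ 4) / sqrt (real (n k)))"
      unfolding norm_mult nE by (rule mult_left_mono[OF \<psi>G]) (simp add: e_def)
    then show ?thesis by (simp add: mult_ac)
  qed
  note q = gauss_quartic_integral_bound[OF n(1), folded e_def]
  let ?c = "32 * ((2 * pi) ^ CARD('m) * std_gauss (0 :: real^'m) * sqrt 2 ^ CARD('m))"
  have qi: "integrable lborel (\<lambda>u. (C / sqrt (real (n k))) * (e k u * (1 + norm u ^ 4)))" for k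
    using q(1)[of k] by (rule integrable_mult_right)
  have Ai: "integrable lborel (\<lambda>u. E k u * (\<psi> k u - G k u))" for k
  proof (rule Bochner_Integration.integrable_bound[OF qi[of k]])
    show "AE u in lborel. norm (E k u * (\<psi> k u - G k u)) \<le> norm ((C / sqrt (real (n k))) * (e k u * (1 + norm u ^ 4)))"
      unfolding real_norm_def by (intro AE_I2 order_trans[OF bound abs_ge_self])
  qed measurable
  have C0: "C \<ge> 0"
  proof -
    have "C / sqrt (real (n 0)) \<ge> 0" using order_trans[OF norm_ge_zero \<psi>G[of 0 0]] by simp
    then show ?thesis using n(1)[of 0] by (simp add: zero_le_divide_iff)
  qed
  have A: "(\<lambda>k. \<integral>u. E k u * (\<psi> k u - G k u) \<partial>lborel) \<longlonglongrightarrow> 0"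
  proof (rule Lim_null_comparison)
    have "norm (\<integral>u. E k u * (\<psi> k u - G k u) \<partial>lborel) \<le> (C * ?c) * real (n k) powr (- 1 / 4)" for k
    proof -
      have "norm (\<integral>u. E k u * (\<psi> k u - G k u) \<partial>lborel) \<le> (\<integral>u. (C / sqrt (real (n k))) * (e k u * (1 + norm u ^ 4)) \<partial>lborel)"
        by (rule order_trans[OF integral_norm_bound integral_mono[OF integrable_norm[OF Ai] qi bound]])
      also have "\<dots> = (C / sqrt (real (n k))) * (\<integral>u. e k u * (1 + norm u ^ 4) \<partial>lborel)" by simp
      also have "\<dots> \<le> (C / sqrt (real (n k))) * (?c * real (n k) powr (1 / 4))"
        using q(2)[of k] C0 by (intro mult_left_mono) auto
      also have "\<dots> = (C * ?c) * (real (n k) powr (1 / 4) / sqrt (real (n k)))" by simp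
      also have "real (n k) powr (1 / 4) / sqrt (real (n k)) = real (n k) powr (- 1 / 4)"
        using n(1)[of k] by (simp add: powr_half_sqrt[symmetric] powr_diff[symmetric])
      finally show ?thesis .
    qed
    then show "\<forall>\<^sub>F k in sequentially. norm (\<integral>u. E k u * (\<psi> k u - G k u) \<partial>lborel) \<le> (C * ?c) * real (n k) powr (- 1 / 4)" by simp
    have "((\<lambda>x::real. x powr (- 1 / 4)) \<longlongrightarrow> 0) at_top"
      by (rule tendsto_neg_powr) (auto simp: filterlim_ident)
    then have "(\<lambda>k. real (n k) powr (- 1 / 4)) \<longlonglongrightarrow> 0"
      by (rule filterlim_compose[OF _ filterlim_compose[OF filterlim_real_sequentially n(2)]])
    then show "(\<lambda>k. (C * ?c) * real (n k) powr (- 1 / 4)) \<longlonglongrightarrow> 0"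
      by (rule tendsto_mult_right_zero)
  qed
  have nG: "norm (G k u) \<le> 1" for k u
  proof -
    have "u \<bullet> (J (\<eta> k) *v u) \<ge> 0" using fisher_pos_def[OF \<eta>(1), of u k] by (cases "u = 0") auto
    then show ?thesis by (simp add: G_def)
  qed
  have Bi: "integrable lborel (\<lambda>u. E k u * G k u)" for k
    by (rule Bochner_Integration.integrable_bound[OF e_int[of k]])
       (use nG in \<open>auto simp: norm_mult nE mult_left_le e_def\<close>)
  obtain \<kappa> N where \<kappa>: "\<kappa> > 0" "\<And>k u. k \<ge> N \<Longrightarrow> u \<bullet> (J (\<eta> k) *v u) \<ge> \<kappa> * (norm u)\<^sup>2"
    using fisher_eventually_pos_def[OF \<theta> \<eta>] by blast
  let ?L = "\<lambda>u. iexp (- (u \<bullet> (J \<theta> *v x))) * complex_of_real (exp (- (u \<bullet> (J \<theta> *v u)) / 2))"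
  \<comment> \<open>The sequence is shifted by N because the common lower bound for the quadratic
    forms holds only from N on.\<close>
  have "(\<lambda>k. \<integral>u. E (k + N) u * G (k + N) u \<partial>lborel) \<longlonglongrightarrow> (\<integral>u. ?L u \<partial>lborel)"
  proof (rule integral_dominated_convergence)
    show "integrable lborel (\<lambda>u::real^'m. exp (- ((sqrt \<kappa>)\<^sup>2 * (norm u)\<^sup>2) / 2))"
      by (rule scaled_gauss_fourier(1)) (use \<kappa> in auto)
    show "AE u in lborel. norm (E (k + N) u * G (k + N) u) \<le> exp (- ((sqrt \<kappa>)\<^sup>2 * (norm u)\<^sup>2) / 2)" for k
    proof (rule AE_I2)
      fix u :: "real^'m"
      have "norm (E (k + N) u * G (k + N) u) \<le> 1 * norm (G (k + N) u)"
        unfolding norm_mult nE by (rule mult_right_mono) (auto simp: e_def)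
      also have "\<dots> = exp (- (u \<bullet> (J (\<eta> (k + N)) *v u)) / 2)" by (simp add: G_def)
      also have "\<dots> \<le> exp (- ((sqrt \<kappa>)\<^sup>2 * (norm u)\<^sup>2) / 2)"
        using \<kappa>(2)[of "k + N" u] \<kappa>(1) by simp
      finally show "norm (E (k + N) u * G (k + N) u) \<le> exp (- ((sqrt \<kappa>)\<^sup>2 * (norm u)\<^sup>2) / 2)" .
    qed
    show "AE u in lborel. (\<lambda>k. E (k + N) u * G (k + N) u) \<longlonglongrightarrow> ?L u"
    proof (rule AE_I2)
      fix u :: "real^'m"
      note J = fisher_continuous[OF \<theta> \<eta>]
      have "(\<lambda>k. E k u * G k u) \<longlonglongrightarrow> complex_of_real (exp (- (0\<^sup>2 * (norm u)\<^sup>2) / 2)) * iexp (- (u \<bullet> (J \<theta> *v x)))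
          * complex_of_real (exp (- (u \<bullet> (J \<theta> *v u)) / 2))"
        unfolding E_def G_def e_def
        by (intro tendsto_intros noise_tendsto_0[OF n(2)] tendsto_matrix_vector_mult[OF J tendsto_const]) auto
      then show "(\<lambda>k. E (k + N) u * G (k + N) u) \<longlonglongrightarrow> ?L u"
        by (intro LIMSEQ_ignore_initial_segment) simp
    qed
  qed measurable
  then have B: "(\<lambda>k. \<integral>u. E k u * G k u \<partial>lborel) \<longlonglongrightarrow> (\<integral>u. ?L u \<partial>lborel)"
    by (rule LIMSEQ_offset)
  have sd: "complex_of_real (smoothed_density (\<eta> k) (n k) x) = (1 / (2 * pi) ^ CARD('m)) *
     ((\<integral>u. E k u * (\<psi> k u - G k u) \<partial>lborel) + (\<integral>u. E k u * G k u \<partial>lborel))" for k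
  proof -
    have "complex_of_real (smoothed_density (\<eta> k) (n k) x) = (1 / (2 * pi) ^ CARD('m)) * (\<integral>u. E k u * \<psi> k u \<partial>lborel)"
      unfolding smoothed_density_fourier[OF \<eta>(1) n(1)] E_def e_def \<psi>_def ..
    also have "(\<integral>u. E k u * \<psi> k u \<partial>lborel) = (\<integral>u. E k u * (\<psi> k u - G k u) + E k u * G k u \<partial>lborel)"
      by (simp add: right_diff_distrib)
    also have "\<dots> = (\<integral>u. E k u * (\<psi> k u - G k u) \<partial>lborel) + (\<integral>u. E k u * G k u \<partial>lborel)"
      by (rule Bochner_Integration.integral_add[OF Ai Bi])
    finally show ?thesis .
  qed
  have "(\<lambda>k. complex_of_real (smoothed_density (\<eta> k) (n k) x)) \<longlonglongrightarrow> (1 / (2 * pi) ^ CARD('m)) * (0 + (\<integral>u. ?L u \<partial>lborel))"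
    unfolding sd by (intro tendsto_intros A B)
  also have "(1 / (2 * pi) ^ CARD('m)) * (0 + (\<integral>u. ?L u \<partial>lborel)) = complex_of_real (normal_precision_density (J \<theta>) x / det (J \<theta>))"
  proof -
    have F: "(\<integral>u. ?L u \<partial>lborel) = complex_of_real ((2 * pi) ^ CARD('m) * (normal_precision_density (J \<theta>) x / det (J \<theta>)))"
      by (rule fourier_normal_precision_density[OF fisher_symmetric]) (rule fisher_pos_def[OF \<theta>])
    show ?thesis unfolding F by simp
  qed
  finally show ?thesis by (simp only: tendsto_of_real_iff)
qed

end

section \<open>The kernel\<close>

text \<open>Mixing the kernel with weight G returns c T instead of T, so G has mass c. Replacing G
  by the probability density \<open>\<gamma>\<close> costs the L^1 distance, and replacing c T by T
  costs c - 1. No factor is lost over a disjoint family, because each probability measure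
  \<open>K x\<close> gives the family total mass at most 1.\<close>

lemma tv_norm_bind_density_le:
  fixes G \<gamma> :: "'b::euclidean_space \<Rightarrow> real" and K :: "'b \<Rightarrow> 'c measure"
  assumes K: "K \<in> borel \<rightarrow>\<^sub>M prob_algebra N"
    and T: "prob_space T" "sets T = sets N" and c: "c \<ge> 1"
    and [measurable]: "\<gamma> \<in> borel_measurable borel" "G \<in> borel_measurable borel"
    and \<gamma>: "\<And>x. \<gamma> x \<ge> 0" "(\<integral>\<^sup>+x. ennreal (\<gamma> x) \<partial>lborel) = 1" and G: "\<And>x. G x \<ge> 0"
    and eq: "\<And>A. A \<in> sets N \<Longrightarrow> (\<integral>\<^sup>+x. ennreal (G x) * emeasure (K x) A \<partial>lborel) = ennreal c * emeasure T A"
  shows "tv_norm T (bind (density lborel (\<lambda>x. ennreal (\<gamma> x))) K)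
     \<le> ennreal ((\<integral>x. \<bar>G x - \<gamma> x\<bar> \<partial>lborel) + (c - 1))" and "integrable lborel G" and "(\<integral>x. G x \<partial>lborel) = c"
proof -
  interpret T: prob_space T by (rule T(1))
  have Kp: "prob_space (K x)" and Ks: "sets (K x) = sets N" for x
    using measurable_space[OF K, of x] by (auto simp: space_prob_algebra)
  have Ksp: "space (K x) = space N" for x using Ks sets_eq_imp_space_eq by blast
  have Tsp: "space T = space N" using T(2) sets_eq_imp_space_eq by blast
  have Ksub: "K \<in> borel \<rightarrow>\<^sub>M subprob_algebra N" by (rule measurable_prob_algebraD[OF K])
  have [measurable]: "(\<lambda>x. emeasure (K x) A) \<in> borel_measurable borel" if "A \<in> sets N" for A
    by (rule measurable_emeasure_kernel[OF Ksub that])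
  have Gc: "(\<integral>\<^sup>+x. ennreal (G x) \<partial>lborel) = ennreal c"
  proof -
    have "emeasure (K x) (space N) = 1" for x using prob_space.emeasure_space_1[OF Kp[of x]] by (simp add: Ksp)
    moreover have "emeasure T (space N) = 1" using T.emeasure_space_1 by (simp add: Tsp)
    ultimately show ?thesis using eq[of "space N"] by simp
  qed
  show Gi: "integrable lborel G"
    using Gc G by (intro integrableI_bounded) auto
  show "(\<integral>x. G x \<partial>lborel) = c"
    using Gc G c by (subst integral_eq_nn_integral) auto
  have \<gamma>i: "integrable lborel \<gamma>"
    using \<gamma> by (intro integrableI_bounded) auto
  define \<rho> where "\<rho> A x = measure (K x) A" for A x
  have \<rho>: "0 \<le> \<rho> A x" "\<rho> A x \<le> 1" for A x
    unfolding \<rho>_def using prob_space.prob_le_1[OF Kp] by auto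
  have \<rho>e: "emeasure (K x) A = ennreal (\<rho> A x)" for A x
    unfolding \<rho>_def using finite_measure.emeasure_eq_measure prob_space_def Kp prob_space.finite_measure by metis
  have \<rho>m[measurable]: "\<rho> A \<in> borel_measurable borel" if "A \<in> sets N" for A
    unfolding \<rho>_def measure_def using that by measurable
  have fi: "integrable lborel (\<lambda>x. f x * \<rho> A x)" if "integrable lborel f" "A \<in> sets N" for f A
  proof (rule Bochner_Integration.integrable_bound[OF that(1)])
    show "AE x in lborel. norm (f x * \<rho> A x) \<le> norm (f x)"
      using \<rho> by (intro AE_I2) (simp add: abs_mult mult_left_le)
  qed (use that in measurable)
  let ?D = "density lborel (\<lambda>x. ennreal (\<gamma> x))"
  let ?Q = "bind ?D K"
  have Q: "measure ?Q A = (\<integral>x. \<gamma> x * \<rho> A x \<partial>lborel)" if A: "A \<in> sets N" for A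
  proof -
    have "emeasure ?Q A = (\<integral>\<^sup>+x. emeasure (K x) A \<partial>?D)"
      using Ksub A by (intro emeasure_bind[where N=N]) auto
    also have "\<dots> = (\<integral>\<^sup>+x. ennreal (\<gamma> x) * emeasure (K x) A \<partial>lborel)"
      using A by (subst nn_integral_density) auto
    also have "\<dots> = (\<integral>\<^sup>+x. ennreal (\<gamma> x * \<rho> A x) \<partial>lborel)"
      using \<gamma>(1) by (simp add: \<rho>e ennreal_mult')
    also have "\<dots> = ennreal (\<integral>x. \<gamma> x * \<rho> A x \<partial>lborel)"
      using fi[OF \<gamma>i A] \<gamma>(1) \<rho> by (intro nn_integral_eq_integral) auto
    finally show ?thesis using \<gamma>(1) \<rho> by (simp add: measure_def Bochner_Integration.integral_nonneg)
  qed
  have TA: "c * measure T A = (\<integral>x. G x * \<rho> A x \<partial>lborel)" if A: "A \<in> sets N" for A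
  proof -
    have "ennreal (c * measure T A) = (\<integral>\<^sup>+x. ennreal (G x * \<rho> A x) \<partial>lborel)"
      using eq[OF A] G c by (simp add: T.emeasure_eq_measure \<rho>e ennreal_mult')
    also have "\<dots> = ennreal (\<integral>x. G x * \<rho> A x \<partial>lborel)"
      using fi[OF Gi A] G \<rho> by (intro nn_integral_eq_integral) auto
    finally show ?thesis using c G \<rho> by (subst (asm) ennreal_inj) (auto intro!: Bochner_Integration.integral_nonneg)
  qed
  show "tv_norm T ?Q \<le> ennreal ((\<integral>x. \<bar>G x - \<gamma> x\<bar> \<partial>lborel) + (c - 1))"
  proof (rule tv_norm_leI)
    fix \<A> assume A: "finite \<A>" "\<A> \<subseteq> sets T" "disjoint \<A>"
    have AN: "A \<in> sets N" if "A \<in> \<A>" for A using A T(2) that by auto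
    have sum_le: "(\<Sum>A\<in>\<A>. measure M A) \<le> 1" if M: "prob_space M" "sets M = sets N" for M
    proof -
      interpret M: prob_space M by (rule M(1))
      have "(\<Sum>A\<in>\<A>. measure M A) = measure M (\<Union>A\<in>\<A>. A)"
        using A AN M(2) by (intro M.finite_measure_finite_Union[symmetric]) (auto simp: disjoint_family_on_def disjoint_def)
      then show ?thesis by simp
    qed
    \<comment> \<open>The triangle inequality through \<open>c * measure T A\<close>, the quantity
      represented exactly by G.\<close>
    have "\<bar>measure T A - measure ?Q A\<bar> \<le> (\<integral>x. \<bar>G x - \<gamma> x\<bar> * \<rho> A x \<partial>lborel) + (c - 1) * measure T A" if AA: "A \<in> \<A>" for A
    proof -
      have "\<bar>c * measure T A - measure ?Q A\<bar> = \<bar>\<integral>x. (G x - \<gamma> x) * \<rho> A x \<partial>lborel\<bar>"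
        unfolding TA[OF AN[OF AA]] Q[OF AN[OF AA]]
        using fi[OF Gi AN[OF AA]] fi[OF \<gamma>i AN[OF AA]] by (simp add: left_diff_distrib)
      also have "\<dots> \<le> (\<integral>x. \<bar>(G x - \<gamma> x) * \<rho> A x\<bar> \<partial>lborel)" by (rule integral_abs_bound)
      also have "\<dots> = (\<integral>x. \<bar>G x - \<gamma> x\<bar> * \<rho> A x \<partial>lborel)" using \<rho> by (simp add: abs_mult)
      finally have 1: "\<bar>c * measure T A - measure ?Q A\<bar> \<le> (\<integral>x. \<bar>G x - \<gamma> x\<bar> * \<rho> A x \<partial>lborel)" .
      have "0 \<le> (c - 1) * measure T A" using c by simp
      with 1 show ?thesis by (simp add: algebra_simps)
    qed
    then have "(\<Sum>A\<in>\<A>. \<bar>measure T A - measure ?Q A\<bar>) \<le> (\<Sum>A\<in>\<A>. (\<integral>x. \<bar>G x - \<gamma> x\<bar> * \<rho> A x \<partial>lborel) + (c - 1) * measure T A)"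
      by (rule sum_mono)
    also have "\<dots> = (\<integral>x. \<bar>G x - \<gamma> x\<bar> * (\<Sum>A\<in>\<A>. \<rho> A x) \<partial>lborel) + (c - 1) * (\<Sum>A\<in>\<A>. measure T A)"
      unfolding sum.distrib sum_distrib_left
      by (subst Bochner_Integration.integral_sum) (auto intro!: fi AN Gi \<gamma>i)
    also have "\<dots> \<le> (\<integral>x. \<bar>G x - \<gamma> x\<bar> \<partial>lborel) + (c - 1) * 1"
    proof (intro add_mono mult_left_mono integral_mono)
      show "integrable lborel (\<lambda>x. \<bar>G x - \<gamma> x\<bar> * (\<Sum>A\<in>\<A>. \<rho> A x))"
        unfolding sum_distrib_left by (intro Bochner_Integration.integrable_sum fi AN) (auto intro!: Gi \<gamma>i)
      show "integrable lborel (\<lambda>x. \<bar>G x - \<gamma> x\<bar>)" using Gi \<gamma>i by auto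
      show "\<bar>G x - \<gamma> x\<bar> * (\<Sum>A\<in>\<A>. \<rho> A x) \<le> \<bar>G x - \<gamma> x\<bar>" for x
        using sum_le[OF Kp[of x] Ks[of x]] unfolding \<rho>_def by (intro mult_left_le) (auto intro: sum_nonneg)
      show "(\<Sum>A\<in>\<A>. measure T A) \<le> 1" by (rule sum_le[OF T])
    qed (use c in auto)
    finally show "(\<Sum>A\<in>\<A>. \<bar>measure T A - measure ?Q A\<bar>) \<le> (\<integral>x. \<bar>G x - \<gamma> x\<bar> \<partial>lborel) + (c - 1)" by simp
  qed
qed

context regular_model begin

abbreviation \<mu>n where "\<mu>n n \<equiv> PiM {..<n} (\<lambda>_. \<mu>)"

lemma sets_Pn [simp, measurable_cong]: "sets (Pn \<theta> n) = sets (\<mu>n n)"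
  by (intro sets_PiM_cong) auto

definition score_kernel :: "real^'m \<Rightarrow> nat \<Rightarrow> real^'m \<Rightarrow> (nat \<Rightarrow> 'a) measure" where
  "score_kernel \<theta> n x = density (Pn \<theta> n) (\<lambda>\<omega>. ennreal (scaled_gauss (noise n) (J \<theta> *v x - score_sum \<theta> n \<omega>) / smoothed_density \<theta> n x))"

text \<open>The Gaussian noise density is strictly positive and bounded. Its average is therefore
  positive and finite at every x, so the normalized density below defines a probability measure for
  each x with no exceptional null set.\<close>

lemma smoothed_density_props:
  assumes \<theta>: "\<theta> \<in> \<Theta>" and n: "n \<ge> 1"
  shows "smoothed_density \<theta> n x > 0"
    and "(\<integral>\<^sup>+\<omega>. ennreal (scaled_gauss (noise n) (J \<theta> *v x - score_sum \<theta> n \<omega>)) \<partial>Pn \<theta> n) = ennreal (smoothed_density \<theta> n x)"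
    and "smoothed_density \<theta> n \<in> borel_measurable borel"
proof -
  have [measurable]: "\<theta> \<in> \<Theta>" by fact
  interpret N: prob_space "Pn \<theta> n" by (rule prob_space_Pn[OF \<theta>])
  let ?f = "\<lambda>\<omega>. scaled_gauss (noise n) (J \<theta> *v x - score_sum \<theta> n \<omega>)"
  have pos: "?f \<omega> > 0" for \<omega> by (rule scaled_gauss_pos[OF noise_pos[OF n]])
  have int: "integrable (Pn \<theta> n) ?f"
  proof (rule N.integrable_const_bound)
    show "AE \<omega> in Pn \<theta> n. norm (?f \<omega>) \<le> (2 * pi) powr (- real DIM(real^'m) / 2) / noise n ^ DIM(real^'m)"
    proof (rule AE_I2)
      fix \<omega>
      have "norm (?f \<omega>) = ?f \<omega>" using pos[of \<omega>] by simp
      also have "\<dots> \<le> (2 * pi) powr (- real DIM(real^'m) / 2) / noise n ^ DIM(real^'m)"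
        unfolding scaled_gauss_def using noise_pos[OF n] by (intro divide_right_mono std_gauss_le) simp
      finally show "norm (?f \<omega>) \<le> (2 * pi) powr (- real DIM(real^'m) / 2) / noise n ^ DIM(real^'m)" .
    qed
  qed measurable
  have "smoothed_density \<theta> n x \<ge> 0" unfolding smoothed_density_def
    using pos by (intro Bochner_Integration.integral_nonneg) (simp add: less_imp_le)
  moreover have "smoothed_density \<theta> n x \<noteq> 0"
  proof
    assume "smoothed_density \<theta> n x = 0"
    then have "AE \<omega> in Pn \<theta> n. ?f \<omega> = 0" unfolding smoothed_density_def
      using int pos by (subst (asm) integral_nonneg_eq_0_iff_AE) (auto simp: less_imp_le)
    then have "AE \<omega> in Pn \<theta> n. False" using pos by (auto simp: less_le)
    then show False by simp
  qed
  ultimately show "smoothed_density \<theta> n x > 0" by simp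
  show "(\<integral>\<^sup>+\<omega>. ennreal (?f \<omega>) \<partial>Pn \<theta> n) = ennreal (smoothed_density \<theta> n x)"
    unfolding smoothed_density_def using int pos by (intro nn_integral_eq_integral) (auto simp: less_imp_le)
  show "smoothed_density \<theta> n \<in> borel_measurable borel"
    unfolding smoothed_density_def by measurable
qed

lemma score_kernel_measurable:
  assumes \<theta>: "\<theta> \<in> \<Theta>" and n: "n \<ge> 1"
  shows "score_kernel \<theta> n \<in> borel \<rightarrow>\<^sub>M prob_algebra (\<mu>n n)"
proof -
  have [measurable]: "\<theta> \<in> \<Theta>" by fact
  interpret N: prob_space "Pn \<theta> n" by (rule prob_space_Pn[OF \<theta>])
  note sd[measurable] = smoothed_density_props(3)[OF \<theta> n]
  have prob: "prob_space (score_kernel \<theta> n x)" for x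
  proof (rule prob_spaceI)
    have "emeasure (score_kernel \<theta> n x) (space (score_kernel \<theta> n x))
        = (\<integral>\<^sup>+\<omega>. ennreal (1 / smoothed_density \<theta> n x) * ennreal (scaled_gauss (noise n) (J \<theta> *v x - score_sum \<theta> n \<omega>)) \<partial>Pn \<theta> n)"
      unfolding score_kernel_def space_density using smoothed_density_props(1)[OF \<theta> n, of x]
      by (subst emeasure_density)
         (use sets.top[of "Pn \<theta> n"] in \<open>auto intro!: nn_integral_cong simp: ennreal_mult'[symmetric] simp del: sets.top\<close>)
    also have "\<dots> = ennreal (1 / smoothed_density \<theta> n x) * ennreal (smoothed_density \<theta> n x)"
      by (subst nn_integral_cmult) (simp_all add: smoothed_density_props(2)[OF \<theta> n])
    also have "\<dots> = 1" using smoothed_density_props(1)[OF \<theta> n, of x] by (simp flip: ennreal_mult')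
    finally show "emeasure (score_kernel \<theta> n x) (space (score_kernel \<theta> n x)) = 1" .
  qed
  show ?thesis
  proof (rule measurable_prob_algebraI[OF prob], rule measurable_subprob_algebra)
    show "subprob_space (score_kernel \<theta> n x)" for x using prob prob_space_imp_subprob_space by blast
    show "sets (score_kernel \<theta> n x) = sets (\<mu>n n)" for x by (simp add: score_kernel_def)
    fix A assume A: "A \<in> sets (\<mu>n n)"
    then have [measurable]: "A \<in> sets (Pn \<theta> n)" by simp
    have "emeasure (score_kernel \<theta> n x) A = (\<integral>\<^sup>+\<omega>. ennreal (scaled_gauss (noise n) (J \<theta> *v x - score_sum \<theta> n \<omega>) / smoothed_density \<theta> n x) * indicator A \<omega> \<partial>Pn \<theta> n)" for x
      unfolding score_kernel_def by (subst emeasure_density) (use A in auto)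
    then show "(\<lambda>x. emeasure (score_kernel \<theta> n x) A) \<in> borel_measurable borel" by simp
  qed
qed


section \<open>Tilted products and their representation through the kernel\<close>

definition tilted_product :: "real^'m \<Rightarrow> nat \<Rightarrow> real^'m \<Rightarrow> (nat \<Rightarrow> 'a) measure" where
  "tilted_product \<theta> n h = PiM {..<n} (\<lambda>_. density (P \<theta>) (\<lambda>x. ennreal (tilt_density \<theta> n h x)))"

lemma tilt_integrable:
  assumes \<theta>: "\<theta> \<in> \<Theta>" and n: "n \<ge> 1"
  shows "integrable (P \<theta>) (\<lambda>x. exp ((h \<bullet> l \<theta> x) / sqrt (real n)))" "tilt_mass \<theta> n h \<ge> 1"
proof -
  obtain C where "\<And>\<theta>' n h'. \<theta>' \<in> {\<theta>} \<Longrightarrow> norm h' \<le> norm h \<Longrightarrow> n \<ge> 1 \<Longrightarrow> integrable (P \<theta>') (\<lambda>x. exp ((h' \<bullet> l \<theta>' x) / sqrt (real n)))"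
   "\<And>\<theta>' n h'. \<theta>' \<in> {\<theta>} \<Longrightarrow> norm h' \<le> norm h \<Longrightarrow> n \<ge> 1 \<Longrightarrow> tilt_mass \<theta>' n h' \<ge> 1"
    by (rule tilt_expansion[of "{\<theta>}" "norm h"]) (use \<theta> in \<open>simp, simp, blast\<close>)
  from this[of \<theta> h n] n show "integrable (P \<theta>) (\<lambda>x. exp ((h \<bullet> l \<theta> x) / sqrt (real n)))" "tilt_mass \<theta> n h \<ge> 1"
    by simp_all
qed

lemma tilt_density_props:
  assumes \<theta>: "\<theta> \<in> \<Theta>" and n: "n \<ge> 1"
  shows "tilt_density \<theta> n h \<in> borel_measurable \<mu>" "tilt_density \<theta> n h x \<ge> 0"
    "integrable (P \<theta>) (tilt_density \<theta> n h)" "(\<integral>x. tilt_density \<theta> n h x \<partial>P \<theta>) = 1"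
    "prob_space (density (P \<theta>) (\<lambda>x. ennreal (tilt_density \<theta> n h x)))"
proof -
  have [measurable]: "\<theta> \<in> \<Theta>" by fact
  note t = tilt_integrable[OF \<theta> n, of h]
  show m[measurable]: "tilt_density \<theta> n h \<in> borel_measurable \<mu>" unfolding tilt_density_def by measurable
  show nn: "tilt_density \<theta> n h x \<ge> 0" for x using t(2) by (simp add: tilt_density_def)
  show i: "integrable (P \<theta>) (tilt_density \<theta> n h)" unfolding tilt_density_def using t(1) by simp
  show e: "(\<integral>x. tilt_density \<theta> n h x \<partial>P \<theta>) = 1"
    unfolding tilt_density_def using t(2) by (simp add: tilt_mass_def[symmetric])
  show "prob_space (density (P \<theta>) (\<lambda>x. ennreal (tilt_density \<theta> n h x)))"
  proof (rule prob_spaceI)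
    have "(\<integral>\<^sup>+x. ennreal (tilt_density \<theta> n h x) \<partial>P \<theta>) = 1"
      using nn_integral_eq_integral[OF i] nn e by simp
    moreover have "(\<integral>\<^sup>+x. ennreal (tilt_density \<theta> n h x) * indicator (space (P \<theta>)) x \<partial>P \<theta>) = (\<integral>\<^sup>+x. ennreal (tilt_density \<theta> n h x) \<partial>P \<theta>)"
      by (rule nn_integral_cong) simp
    ultimately show "emeasure (density (P \<theta>) (\<lambda>x. ennreal (tilt_density \<theta> n h x))) (space (density (P \<theta>) (\<lambda>x. ennreal (tilt_density \<theta> n h x)))) = 1"
      unfolding space_density by (subst emeasure_density) auto
  qed
qed

text \<open>The exponents add up to \<open>h \<bullet> score_sum \<theta> n \<omega>\<close>: the
  score sum is a sufficient statistic for h in the tilted family. This is the reason why a kernel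
  independent of h can work.\<close>

lemma tilted_product_eq:
  assumes \<theta>: "\<theta> \<in> \<Theta>" and n: "n \<ge> 1"
  shows "tilted_product \<theta> n h = density (Pn \<theta> n) (\<lambda>\<omega>. ennreal (exp (h \<bullet> score_sum \<theta> n \<omega>) / tilt_mass \<theta> n h ^ n))"
proof -
  note t = tilt_density_props[OF \<theta> n, of h]
  have tm: "(\<lambda>x. ennreal (tilt_density \<theta> n h x)) \<in> borel_measurable (P \<theta>)" using t(1) by simp
  have "tilted_product \<theta> n h = density (Pn \<theta> n) (\<lambda>\<omega>. \<Prod>i<n. ennreal (tilt_density \<theta> n h (\<omega> i)))"
    unfolding tilted_product_def by (rule PiM_density[OF prob_space_P[OF \<theta>] t(5) tm]) simp
  also have "(\<lambda>\<omega>. \<Prod>i<n. ennreal (tilt_density \<theta> n h (\<omega> i))) = (\<lambda>\<omega>. ennreal (exp (h \<bullet> score_sum \<theta> n \<omega>) / tilt_mass \<theta> n h ^ n))"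
  proof
    fix \<omega>
    have "(\<Prod>i<n. ennreal (tilt_density \<theta> n h (\<omega> i))) = ennreal (\<Prod>i<n. tilt_density \<theta> n h (\<omega> i))"
      using t(2) by (rule prod_ennreal)
    also have "(\<Prod>i<n. tilt_density \<theta> n h (\<omega> i)) = exp (\<Sum>i<n. (h \<bullet> l \<theta> (\<omega> i)) / sqrt (real n)) / tilt_mass \<theta> n h ^ n"
      by (simp add: tilt_density_def prod_dividef exp_sum)
    also have "(\<Sum>i<n. (h \<bullet> l \<theta> (\<omega> i)) / sqrt (real n)) = h \<bullet> score_sum \<theta> n \<omega>"
      by (simp add: score_sum_def inner_sum_right sum_divide_distrib)
    finally show "(\<Prod>i<n. ennreal (tilt_density \<theta> n h (\<omega> i))) = ennreal (exp (h \<bullet> score_sum \<theta> n \<omega>) / tilt_mass \<theta> n h ^ n)" .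
  qed
  finally show ?thesis .
qed

text \<open>The density of J^-1 (score sum + noise), reweighted by the tilt read at the noisy value
  J x instead of at the score sum itself. Because of this substitution its total mass is the
  exponential moment of the noise rather than 1.\<close>

definition tilted_smoothed_density :: "real^'m \<Rightarrow> nat \<Rightarrow> real^'m \<Rightarrow> real^'m \<Rightarrow> real" where
  "tilted_smoothed_density \<theta> n h x = det (J \<theta>) * (exp (h \<bullet> (J \<theta> *v x)) / tilt_mass \<theta> n h ^ n) * smoothed_density \<theta> n x"

lemma det_fisher_pos: "\<theta> \<in> \<Theta> \<Longrightarrow> det (J \<theta>) > 0"
  by (rule det_pos_def[OF fisher_symmetric]) (rule fisher_pos_def)

text \<open>Sampling \<open>x\<close> from the tilted smoothed density and then \<open>\<omega>\<close> from the kernel adds Gaussian noise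
  to the score sum and forgets it again, so that only the exponential moment of the noise remains.\<close>

lemma tilted_smoothed_density_kernel:
  assumes \<theta>: "\<theta> \<in> \<Theta>" and n: "n \<ge> 1" and A: "A \<in> sets (\<mu>n n)"
  shows "(\<integral>\<^sup>+x. ennreal (tilted_smoothed_density \<theta> n h x) * emeasure (score_kernel \<theta> n x) A \<partial>lborel)
    = ennreal (exp ((noise n)\<^sup>2 * (norm h)\<^sup>2 / 2)) * emeasure (tilted_product \<theta> n h) A"
proof -
  have [measurable]: "\<theta> \<in> \<Theta>" by fact
  have [measurable]: "A \<in> sets (Pn \<theta> n)" using A by simp
  interpret N: prob_space "Pn \<theta> n" by (rule prob_space_Pn[OF \<theta>])
  interpret L: pair_sigma_finite "Pn \<theta> n" "lborel :: (real^'m) measure" ..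
  let ?d = "noise n" and ?M = "tilt_mass \<theta> n h ^ n" and ?S = "score_sum \<theta> n"
  have d: "?d > 0" by (rule noise_pos[OF n])
  have M: "?M > 0" using tilt_integrable(2)[OF \<theta> n, of h] by (intro zero_less_power) linarith
  have D: "det (J \<theta>) > 0" by (rule det_fisher_pos[OF \<theta>])
  define F where "F y z = scaled_gauss ?d (y - z) * exp (h \<bullet> y)" for y z :: "real^'m"
  have [measurable]: "case_prod F \<in> borel_measurable (borel \<Otimes>\<^sub>M borel)" unfolding F_def by measurable
  have F0: "F y z \<ge> 0" for y z unfolding F_def by (intro mult_nonneg_nonneg less_imp_le[OF scaled_gauss_pos[OF d]]) simp
  have 1: "ennreal (tilted_smoothed_density \<theta> n h x) * emeasure (score_kernel \<theta> n x) A
      = (\<integral>\<^sup>+\<omega>. (ennreal (1 / ?M) * indicator A \<omega>) * (ennreal (det (J \<theta>)) * ennreal (F (J \<theta> *v x) (?S \<omega>))) \<partial>Pn \<theta> n)" for x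
  proof -
    have sd: "smoothed_density \<theta> n x > 0" by (rule smoothed_density_props(1)[OF \<theta> n])
    have t0: "tilted_smoothed_density \<theta> n h x \<ge> 0" using D M sd by (simp add: tilted_smoothed_density_def less_imp_le)
    have "ennreal (tilted_smoothed_density \<theta> n h x) * emeasure (score_kernel \<theta> n x) A
      = (\<integral>\<^sup>+\<omega>. ennreal (tilted_smoothed_density \<theta> n h x) * (ennreal (scaled_gauss ?d (J \<theta> *v x - ?S \<omega>) / smoothed_density \<theta> n x) * indicator A \<omega>) \<partial>Pn \<theta> n)"
      unfolding score_kernel_def by (subst emeasure_density) (use A in \<open>auto simp: nn_integral_cmult\<close>)
    also have "\<dots> = (\<integral>\<^sup>+\<omega>. (ennreal (1 / ?M) * indicator A \<omega>) * (ennreal (det (J \<theta>)) * ennreal (F (J \<theta> *v x) (?S \<omega>))) \<partial>Pn \<theta> n)"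
    proof (rule nn_integral_cong)
      fix \<omega>
      have "tilted_smoothed_density \<theta> n h x * (scaled_gauss ?d (J \<theta> *v x - ?S \<omega>) / smoothed_density \<theta> n x)
          = 1 / ?M * (det (J \<theta>) * F (J \<theta> *v x) (?S \<omega>))"
        using sd M by (simp add: tilted_smoothed_density_def F_def)
      then have "ennreal (tilted_smoothed_density \<theta> n h x) * ennreal (scaled_gauss ?d (J \<theta> *v x - ?S \<omega>) / smoothed_density \<theta> n x)
          = ennreal (1 / ?M) * (ennreal (det (J \<theta>)) * ennreal (F (J \<theta> *v x) (?S \<omega>)))"
        using D M t0 by (simp only: ennreal_mult'[symmetric] ennreal_mult''[symmetric] F0 less_imp_le divide_nonneg_nonneg zero_le_one mult_nonneg_nonneg)
      then show "ennreal (tilted_smoothed_density \<theta> n h x) * (ennreal (scaled_gauss ?d (J \<theta> *v x - ?S \<omega>) / smoothed_density \<theta> n x) * indicator A \<omega>)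
        = (ennreal (1 / ?M) * indicator A \<omega>) * (ennreal (det (J \<theta>)) * ennreal (F (J \<theta> *v x) (?S \<omega>)))"
        by (simp add: mult_ac)
    qed
    finally show ?thesis .
  qed
  \<comment> \<open>Substituting y = J x uses up the Jacobian det J, and the exponential moment of
    the noise then returns the tilt at the true score sum.\<close>
  have 2: "(\<integral>\<^sup>+x. ennreal (det (J \<theta>)) * ennreal (F (J \<theta> *v x) z) \<partial>lborel) = ennreal (exp (h \<bullet> z) * exp (?d\<^sup>2 * (norm h)\<^sup>2 / 2))" for z
  proof -
    have "(\<integral>\<^sup>+x. ennreal (det (J \<theta>)) * ennreal (F (J \<theta> *v x) z) \<partial>lborel) = ennreal \<bar>det (J \<theta>)\<bar> * (\<integral>\<^sup>+x. ennreal (F (J \<theta> *v x) z) \<partial>lborel)"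
      using D by (subst nn_integral_cmult) (auto simp: F_def)
    also have "\<dots> = (\<integral>\<^sup>+y. ennreal (F y z) \<partial>lborel)"
      by (rule nn_integral_lborel_matrix[OF fisher_invertible[OF \<theta>], symmetric]) (simp add: F_def)
    also have "\<dots> = ennreal (exp (h \<bullet> z) * exp (?d\<^sup>2 * (norm h)\<^sup>2 / 2))"
      unfolding F_def by (rule nn_integral_scaled_gauss_exp[OF d])
    finally show ?thesis .
  qed
  have "(\<integral>\<^sup>+x. ennreal (tilted_smoothed_density \<theta> n h x) * emeasure (score_kernel \<theta> n x) A \<partial>lborel)
     = (\<integral>\<^sup>+x. \<integral>\<^sup>+\<omega>. (ennreal (1 / ?M) * indicator A \<omega>) * (ennreal (det (J \<theta>)) * ennreal (F (J \<theta> *v x) (?S \<omega>))) \<partial>Pn \<theta> n \<partial>lborel)"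
    unfolding 1 ..
  also have "\<dots> = (\<integral>\<^sup>+\<omega>. \<integral>\<^sup>+x. (ennreal (1 / ?M) * indicator A \<omega>) * (ennreal (det (J \<theta>)) * ennreal (F (J \<theta> *v x) (?S \<omega>))) \<partial>lborel \<partial>Pn \<theta> n)"
    by (rule L.Fubini') measurable
  also have "\<dots> = (\<integral>\<^sup>+\<omega>. (ennreal (1 / ?M) * indicator A \<omega>) * ennreal (exp (h \<bullet> ?S \<omega>) * exp (?d\<^sup>2 * (norm h)\<^sup>2 / 2)) \<partial>Pn \<theta> n)"
  proof (rule nn_integral_cong)
    fix \<omega> assume "\<omega> \<in> space (Pn \<theta> n)"
    have "(\<integral>\<^sup>+x. (ennreal (1 / ?M) * indicator A \<omega>) * (ennreal (det (J \<theta>)) * ennreal (F (J \<theta> *v x) (?S \<omega>))) \<partial>lborel)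
      = (ennreal (1 / ?M) * indicator A \<omega>) * (\<integral>\<^sup>+x. ennreal (det (J \<theta>)) * ennreal (F (J \<theta> *v x) (?S \<omega>)) \<partial>lborel)"
      by (rule nn_integral_cmult) (simp add: F_def)
    then show "(\<integral>\<^sup>+x. (ennreal (1 / ?M) * indicator A \<omega>) * (ennreal (det (J \<theta>)) * ennreal (F (J \<theta> *v x) (?S \<omega>))) \<partial>lborel)
      = (ennreal (1 / ?M) * indicator A \<omega>) * ennreal (exp (h \<bullet> ?S \<omega>) * exp (?d\<^sup>2 * (norm h)\<^sup>2 / 2))"
      unfolding 2 .
  qed
  also have "\<dots> = (\<integral>\<^sup>+\<omega>. ennreal (exp (?d\<^sup>2 * (norm h)\<^sup>2 / 2)) * (ennreal (exp (h \<bullet> ?S \<omega>) / ?M) * indicator A \<omega>) \<partial>Pn \<theta> n)"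
  proof (rule nn_integral_cong)
    fix \<omega>
    have "ennreal (1 / ?M) * ennreal (exp (h \<bullet> ?S \<omega>) * exp (?d\<^sup>2 * (norm h)\<^sup>2 / 2)) = ennreal (exp (?d\<^sup>2 * (norm h)\<^sup>2 / 2)) * ennreal (exp (h \<bullet> ?S \<omega>) / ?M)"
      using M by (simp add: ennreal_mult'[symmetric] mult.commute)
    then show "(ennreal (1 / ?M) * indicator A \<omega>) * ennreal (exp (h \<bullet> ?S \<omega>) * exp (?d\<^sup>2 * (norm h)\<^sup>2 / 2))
      = ennreal (exp (?d\<^sup>2 * (norm h)\<^sup>2 / 2)) * (ennreal (exp (h \<bullet> ?S \<omega>) / ?M) * indicator A \<omega>)"
      by (simp add: indicator_def)
  qed
  also have "\<dots> = ennreal (exp (?d\<^sup>2 * (norm h)\<^sup>2 / 2)) * emeasure (tilted_product \<theta> n h) A"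
    unfolding tilted_product_eq[OF \<theta> n] by (subst emeasure_density) (use A in \<open>auto simp: nn_integral_cmult\<close>)
  finally show ?thesis .
qed


text \<open>The mixing bound with T the tilted product, G the tilted smoothed density,
  \<open>\<gamma>\<close> the density of N(h, J^-1), and c the exponential moment of the
  noise.\<close>

lemma tv_tilted_product_kernel:
  fixes h :: "real^'m"
  assumes \<theta>: "\<theta> \<in> \<Theta>" and n: "n \<ge> 1"
  defines "c \<equiv> exp ((noise n)\<^sup>2 * (norm h)\<^sup>2 / 2)"
  shows "tv_norm (tilted_product \<theta> n h) (bind (gaussian h (matrix_inv (J \<theta>))) (score_kernel \<theta> n))
     \<le> ennreal ((\<integral>x. \<bar>tilted_smoothed_density \<theta> n h x - normal_precision_density (J \<theta>) (x - h)\<bar> \<partial>lborel) + (c - 1))"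
    and "integrable lborel (tilted_smoothed_density \<theta> n h)" and "(\<integral>x. tilted_smoothed_density \<theta> n h x \<partial>lborel) = c"
    and "\<And>x. tilted_smoothed_density \<theta> n h x \<ge> 0"
proof -
  have [measurable]: "\<theta> \<in> \<Theta>" by fact
  note sd[measurable] = smoothed_density_props(3)[OF \<theta> n]
  note D = det_fisher_pos[OF \<theta>]
  have g: "gaussian h (matrix_inv (J \<theta>)) = density lborel (\<lambda>x. ennreal (normal_precision_density (J \<theta>) (x - h)))"
    by (rule gaussian_matrix_inv[OF fisher_invertible[OF \<theta>] D])
  show tn: "\<And>x. tilted_smoothed_density \<theta> n h x \<ge> 0"
    using D tilt_integrable(2)[OF \<theta> n, of h] smoothed_density_props(1)[OF \<theta> n]
    by (auto simp: tilted_smoothed_density_def intro!: mult_nonneg_nonneg divide_nonneg_nonneg less_imp_le)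
  have tp: "prob_space (tilted_product \<theta> n h)"
    unfolding tilted_product_def by (intro prob_space_PiM tilt_density_props(5)[OF \<theta> n])
  have ts: "sets (tilted_product \<theta> n h) = sets (\<mu>n n)"
    unfolding tilted_product_def by (intro sets_PiM_cong) auto
  have c1: "c \<ge> 1" unfolding c_def by simp
  have i1: "(\<integral>\<^sup>+x. ennreal (normal_precision_density (J \<theta>) (x - h)) \<partial>lborel) = 1"
    by (rule nn_integral_normal_precision_density[OF fisher_symmetric]) (rule fisher_pos_def[OF \<theta>])
  have m1: "(\<lambda>x. normal_precision_density (J \<theta>) (x - h)) \<in> borel_measurable borel" by measurable
  have m2: "tilted_smoothed_density \<theta> n h \<in> borel_measurable borel" unfolding tilted_smoothed_density_def by measurable
  have nd0: "normal_precision_density (J \<theta>) (x - h) \<ge> 0" for x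
    by (rule normal_precision_density_nonneg) (use D in simp)
  have tk: "(\<integral>\<^sup>+x. ennreal (tilted_smoothed_density \<theta> n h x) * emeasure (score_kernel \<theta> n x) A \<partial>lborel)
      = ennreal c * emeasure (tilted_product \<theta> n h) A" if "A \<in> sets (\<mu>n n)" for A
    unfolding c_def by (rule tilted_smoothed_density_kernel[OF \<theta> n that])
  note R = tv_norm_bind_density_le[OF score_kernel_measurable[OF \<theta> n] tp ts c1 m1 m2 nd0 i1 tn tk]
  show "tv_norm (tilted_product \<theta> n h) (bind (gaussian h (matrix_inv (J \<theta>))) (score_kernel \<theta> n))
     \<le> ennreal ((\<integral>x. \<bar>tilted_smoothed_density \<theta> n h x - normal_precision_density (J \<theta>) (x - h)\<bar> \<partial>lborel) + (c - 1))"
    unfolding g by (rule R(1))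
  show "integrable lborel (tilted_smoothed_density \<theta> n h)" by (rule R(2))
  show "(\<integral>x. tilted_smoothed_density \<theta> n h x \<partial>lborel) = c" by (rule R(3))
qed

end

section \<open>Limits along convergent sequences of parameters\<close>

lemma tendsto_divide_index_0:
  fixes C :: real
  assumes n: "filterlim n at_top sequentially"
  shows "(\<lambda>k. C / sqrt (real (n k))) \<longlonglongrightarrow> 0" "(\<lambda>k. C / real (n k)) \<longlonglongrightarrow> 0"
proof -
  have r: "filterlim (\<lambda>k. real (n k)) at_top sequentially"
    by (rule filterlim_compose[OF filterlim_real_sequentially n])
  show "(\<lambda>k. C / real (n k)) \<longlonglongrightarrow> 0" by (rule tendsto_divide_0[OF tendsto_const filterlim_at_top_imp_at_infinity[OF r]])
  show "(\<lambda>k. C / sqrt (real (n k))) \<longlonglongrightarrow> 0"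
    by (rule tendsto_divide_0[OF tendsto_const filterlim_at_top_imp_at_infinity[OF filterlim_compose[OF sqrt_at_top r]]])
qed

lemma Scheffe_densities:
  fixes F :: "nat \<Rightarrow> 'b::euclidean_space \<Rightarrow> real"
  assumes F: "\<And>k. integrable lborel (F k)" "\<And>k x. F k x \<ge> 0" and f: "integrable lborel f" "\<And>x. f x \<ge> 0"
    and lim: "\<And>x. (\<lambda>k. F k x) \<longlonglongrightarrow> f x" and int: "(\<lambda>k. \<integral>x. F k x \<partial>lborel) \<longlonglongrightarrow> (\<integral>x. f x \<partial>lborel)"
  shows "(\<lambda>k. \<integral>x. \<bar>F k x - f x\<bar> \<partial>lborel) \<longlonglongrightarrow> 0"
proof -
  have nF: "(\<integral>\<^sup>+x. ennreal (norm (F k x)) \<partial>lborel) = ennreal (\<integral>x. F k x \<partial>lborel)" for k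
    using nn_integral_eq_integral[OF F(1)[of k]] F(2)[of k] by simp
  have nf: "(\<integral>\<^sup>+x. ennreal (norm (f x)) \<partial>lborel) = ennreal (\<integral>x. f x \<partial>lborel)"
    using nn_integral_eq_integral[OF f(1)] f(2) by simp
  have "(\<lambda>k. \<integral>\<^sup>+x. ennreal (norm (F k x - f x)) \<partial>lborel) \<longlonglongrightarrow> 0"
  proof (rule Scheffe_lemma1[OF F(1) f(1)])
    show "AE x in lborel. (\<lambda>k. F k x) \<longlonglongrightarrow> f x" using lim by simp
    have "(\<lambda>k. ennreal (\<integral>x. F k x \<partial>lborel)) \<longlonglongrightarrow> ennreal (\<integral>x. f x \<partial>lborel)"
      by (rule tendsto_ennrealI[OF int])
    then show "limsup (\<lambda>k. \<integral>\<^sup>+x. ennreal (norm (F k x)) \<partial>lborel) \<le> (\<integral>\<^sup>+x. ennreal (norm (f x)) \<partial>lborel)"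
      unfolding nF nf by (subst lim_imp_Limsup) auto
  qed
  moreover have "(\<integral>\<^sup>+x. ennreal (norm (F k x - f x)) \<partial>lborel) = ennreal (\<integral>x. \<bar>F k x - f x\<bar> \<partial>lborel)" for k
    unfolding real_norm_def using F(1) f(1) by (intro nn_integral_eq_integral) auto
  ultimately have "(\<lambda>k. ennreal (\<integral>x. \<bar>F k x - f x\<bar> \<partial>lborel)) \<longlonglongrightarrow> ennreal 0" by simp
  then show ?thesis by (subst (asm) tendsto_ennreal_iff) auto
qed

context regular_model begin

context
  fixes \<theta> h :: "real^'m" and \<eta> H :: "nat \<Rightarrow> real^'m" and n :: "nat \<Rightarrow> nat"
  assumes \<theta>: "\<theta> \<in> \<Theta>" and \<eta>: "\<And>k. \<eta> k \<in> \<Theta>" "\<eta> \<longlonglongrightarrow> \<theta>" and H: "H \<longlonglongrightarrow> h"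
    and n: "\<And>k. n k \<ge> 1" "filterlim n at_top sequentially"
begin

text \<open>A convergent sequence together with its limit is compact and the convergent sequence H
  is bounded, so one constant serves all k.\<close>

lemma tilt_expansion_along:
  obtains C B where "C \<ge> 0" "B > 0" "\<And>k. norm (H k) \<le> B" "\<And>k. tilt_mass (\<eta> k) (n k) (H k) \<ge> 1"
   "\<And>k. \<bar>real (n k) * (tilt_mass (\<eta> k) (n k) (H k) - 1) - (H k \<bullet> (J (\<eta> k) *v H k)) / 2\<bar> \<le> C / sqrt (real (n k))"
   "\<And>k. real (n k) * (tilt_mass (\<eta> k) (n k) (H k) - 1) \<le> C"
   "\<And>k. real (n k) * (\<integral>x. (sqrt (tilt_density (\<eta> k) (n k) (H k) x) - 1 - (H k \<bullet> l (\<eta> k) x) / sqrt (real (n k)) / 2)\<^sup>2 \<partial>P (\<eta> k)) \<le> C / real (n k)"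
proof -
  have K1: "compact (insert \<theta> (range \<eta>))" by (rule compact_sequence_with_limit[OF \<eta>(2)])
  have K2: "insert \<theta> (range \<eta>) \<subseteq> \<Theta>" using \<theta> \<eta>(1) by blast
  obtain B where B: "B > 0" "\<And>k. norm (H k) \<le> B"
    using convergent_imp_Bseq[OF convergentI[OF H]] unfolding Bseq_def by blast
  have \<eta>K: "\<eta> k \<in> insert \<theta> (range \<eta>)" for k by blast
  show ?thesis
  proof (rule tilt_expansion[OF K1 K2, of B], goal_cases)
    case (1 C)
    note F = 1(2-)[OF \<eta>K B(2) n(1)]
    show ?case by (rule that[OF 1(1) B(1,2) F(2-5)])
  qed
qed

text \<open>By the expansion, n (mass - 1) tends to (h . J h) / 2, and n-th powers turn this into
  the exponential: the normalizing constant of the Gaussian shift.\<close>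

lemma tilt_mass_power_tendsto:
  "(\<lambda>k. tilt_mass (\<eta> k) (n k) (H k) ^ n k) \<longlonglongrightarrow> exp ((h \<bullet> (J \<theta> *v h)) / 2)"
proof -
  obtain C B where C: "C \<ge> 0" "B > 0" "\<And>k. norm (H k) \<le> B" "\<And>k. tilt_mass (\<eta> k) (n k) (H k) \<ge> 1"
   "\<And>k. \<bar>real (n k) * (tilt_mass (\<eta> k) (n k) (H k) - 1) - (H k \<bullet> (J (\<eta> k) *v H k)) / 2\<bar> \<le> C / sqrt (real (n k))"
   "\<And>k. real (n k) * (tilt_mass (\<eta> k) (n k) (H k) - 1) \<le> C"
    by (rule tilt_expansion_along) blast
  show ?thesis
  proof (rule power_tendsto_exp[OF C(4)])
    have "(\<lambda>k. tilt_mass (\<eta> k) (n k) (H k) - 1) \<longlonglongrightarrow> 0"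
    proof (rule tendsto_sandwich[OF _ _ tendsto_const tendsto_divide_index_0(2)[OF n(2), of C]])
      show "\<forall>\<^sub>F k in sequentially. tilt_mass (\<eta> k) (n k) (H k) - 1 \<le> C / real (n k)"
      proof (intro always_eventually allI)
        fix k
        have "real (n k) > 0" using n(1)[of k] by simp
        then show "tilt_mass (\<eta> k) (n k) (H k) - 1 \<le> C / real (n k)"
          using C(6)[of k] by (simp add: pos_le_divide_eq mult.commute)
      qed
    qed (use C(4) in auto)
    then show "(\<lambda>k. tilt_mass (\<eta> k) (n k) (H k)) \<longlonglongrightarrow> 1" by (simp add: LIM_zero_iff)
    have "(\<lambda>k. real (n k) * (tilt_mass (\<eta> k) (n k) (H k) - 1) - (H k \<bullet> (J (\<eta> k) *v H k)) / 2) \<longlonglongrightarrow> 0"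
      by (rule Lim_null_comparison[OF _ tendsto_divide_index_0(1)[OF n(2), of C]]) (use C(5) in simp)
    moreover have "(\<lambda>k. (H k \<bullet> (J (\<eta> k) *v H k)) / 2) \<longlonglongrightarrow> (h \<bullet> (J \<theta> *v h)) / 2"
      by (intro tendsto_intros H tendsto_matrix_vector_mult fisher_continuous[OF \<theta> \<eta>]) simp
    ultimately have "(\<lambda>k. (real (n k) * (tilt_mass (\<eta> k) (n k) (H k) - 1) - (H k \<bullet> (J (\<eta> k) *v H k)) / 2) + (H k \<bullet> (J (\<eta> k) *v H k)) / 2)
       \<longlonglongrightarrow> 0 + (h \<bullet> (J \<theta> *v h)) / 2" by (rule tendsto_add)
    then show "(\<lambda>k. real (n k) * (tilt_mass (\<eta> k) (n k) (H k) - 1)) \<longlonglongrightarrow> (h \<bullet> (J \<theta> *v h)) / 2" by simp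
  qed
qed

text \<open>In the limit the Jacobian cancels the 1 / det J of
  \<open>smoothed_density_tendsto\<close>, and tilting N(0, J^-1) by exp (h . J x - h . J h / 2) is
  the same as shifting it by h.\<close>

lemma tilted_smoothed_density_tendsto:
  "(\<lambda>k. tilted_smoothed_density (\<eta> k) (n k) (H k) x) \<longlonglongrightarrow> normal_precision_density (J \<theta>) (x - h)"
proof -
  note J = fisher_continuous[OF \<theta> \<eta>] and D = det_fisher_pos[OF \<theta>]
  have "(\<lambda>k. tilted_smoothed_density (\<eta> k) (n k) (H k) x) \<longlonglongrightarrow>
    det (J \<theta>) * (exp (h \<bullet> (J \<theta> *v x)) / exp ((h \<bullet> (J \<theta> *v h)) / 2)) * (normal_precision_density (J \<theta>) x / det (J \<theta>))"
    unfolding tilted_smoothed_density_def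
    by (intro tendsto_intros tendsto_det[OF J] tendsto_matrix_vector_mult[OF J tendsto_const] H tilt_mass_power_tendsto
        smoothed_density_tendsto[OF \<theta> \<eta> n]) simp
  also have "det (J \<theta>) * (exp (h \<bullet> (J \<theta> *v x)) / exp ((h \<bullet> (J \<theta> *v h)) / 2)) * (normal_precision_density (J \<theta>) x / det (J \<theta>))
     = exp (h \<bullet> (J \<theta> *v x) - (h \<bullet> (J \<theta> *v h)) / 2) * normal_precision_density (J \<theta>) x"
    using D by (simp add: exp_diff)
  also have "\<dots> = normal_precision_density (J \<theta>) (x - h)"
  proof -
    have sym: "x \<bullet> (J \<theta> *v h) = h \<bullet> (J \<theta> *v x)"
      unfolding fisher_bilinear[OF \<theta>] by (simp add: mult.commute)
    have "h \<bullet> (J \<theta> *v x) - (h \<bullet> (J \<theta> *v h)) / 2 + - (x \<bullet> (J \<theta> *v x)) / 2 = - ((x - h) \<bullet> (J \<theta> *v (x - h))) / 2"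
      using sym by (simp add: matrix_vector_mult_diff_distrib inner_diff_left inner_diff_right field_simps)
    then show ?thesis
      unfolding normal_precision_density_def by (simp flip: exp_add)
  qed
  finally show ?thesis .
qed

lemma normal_precision_density_along:
  "(\<lambda>k. normal_precision_density (J (\<eta> k)) (x - H k)) \<longlonglongrightarrow> normal_precision_density (J \<theta>) (x - h)"
  unfolding normal_precision_density_def
  by (intro tendsto_intros tendsto_det tendsto_matrix_vector_mult fisher_continuous[OF \<theta> \<eta>] H) simp

lemma normal_precision_density_fisher:
  assumes "\<theta>' \<in> \<Theta>"
  shows "integrable lborel (\<lambda>x. normal_precision_density (J \<theta>') (x - h'))" "(\<integral>x. normal_precision_density (J \<theta>') (x - h') \<partial>lborel) = 1"
    "normal_precision_density (J \<theta>') y \<ge> 0"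
proof -
  show nn: "normal_precision_density (J \<theta>') y \<ge> 0" for y
    by (rule normal_precision_density_nonneg) (use det_fisher_pos[OF assms] in simp)
  have i: "(\<integral>\<^sup>+x. ennreal (normal_precision_density (J \<theta>') (x - h')) \<partial>lborel) = 1"
    by (rule nn_integral_normal_precision_density[OF fisher_symmetric]) (rule fisher_pos_def[OF assms])
  show "integrable lborel (\<lambda>x. normal_precision_density (J \<theta>') (x - h'))"
    using i nn by (intro integrableI_bounded) auto
  show "(\<integral>x. normal_precision_density (J \<theta>') (x - h') \<partial>lborel) = 1"
    using i nn by (subst integral_eq_nn_integral) auto
qed

text \<open>The Gaussian in the comparison moves with k, so Scheffe is applied twice, to the tilted
  smoothed densities and to the moving Gaussians, both having the same fixed limit density. The
  extra term tends to 0 since the noise vanishes and H stays bounded.\<close>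

lemma tv_tilted_kernel_tendsto:
  "(\<lambda>k. (\<integral>x. \<bar>tilted_smoothed_density (\<eta> k) (n k) (H k) x - normal_precision_density (J (\<eta> k)) (x - H k)\<bar> \<partial>lborel)
     + (exp ((noise (n k))\<^sup>2 * (norm (H k))\<^sup>2 / 2) - 1)) \<longlonglongrightarrow> 0"
proof -
  let ?F = "\<lambda>k. tilted_smoothed_density (\<eta> k) (n k) (H k)" and ?g = "\<lambda>k x. normal_precision_density (J (\<eta> k)) (x - H k)"
  let ?f = "\<lambda>x. normal_precision_density (J \<theta>) (x - h)"
  note fi = normal_precision_density_fisher[OF \<theta>] and gi = normal_precision_density_fisher[OF \<eta>(1)]
  note Fi = tv_tilted_product_kernel[OF \<eta>(1) n(1)]
  have "(\<lambda>k. exp ((noise (n k))\<^sup>2 * (norm (H k))\<^sup>2 / 2)) \<longlonglongrightarrow> exp (0\<^sup>2 * (norm h)\<^sup>2 / 2)"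
    by (intro tendsto_intros noise_tendsto_0[OF n(2)] H) simp
  then have c: "(\<lambda>k. exp ((noise (n k))\<^sup>2 * (norm (H k))\<^sup>2 / 2)) \<longlonglongrightarrow> 1" by simp
  have 1: "(\<lambda>k. \<integral>x. \<bar>?F k x - ?f x\<bar> \<partial>lborel) \<longlonglongrightarrow> 0"
    by (rule Scheffe_densities) (use Fi fi tilted_smoothed_density_tendsto c in auto)
  have 2: "(\<lambda>k. \<integral>x. \<bar>?g k x - ?f x\<bar> \<partial>lborel) \<longlonglongrightarrow> 0"
    by (rule Scheffe_densities) (use gi fi normal_precision_density_along in auto)
  have "(\<lambda>k. \<integral>x. \<bar>?F k x - ?g k x\<bar> \<partial>lborel) \<longlonglongrightarrow> 0"
  proof (rule tendsto_sandwich[OF _ _ tendsto_const])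
    show "(\<lambda>k. (\<integral>x. \<bar>?F k x - ?f x\<bar> \<partial>lborel) + (\<integral>x. \<bar>?g k x - ?f x\<bar> \<partial>lborel)) \<longlonglongrightarrow> 0"
      using tendsto_add[OF 1 2] by simp
    have "(\<integral>x. \<bar>?F k x - ?g k x\<bar> \<partial>lborel) \<le> (\<integral>x. \<bar>?F k x - ?f x\<bar> \<partial>lborel) + (\<integral>x. \<bar>?g k x - ?f x\<bar> \<partial>lborel)" for k
    proof -
      have i: "integrable lborel (?F k)" "integrable lborel (?g k)" "integrable lborel ?f"
        using Fi(2) gi(1) fi(1) by auto
      have "(\<integral>x. \<bar>?F k x - ?g k x\<bar> \<partial>lborel) \<le> (\<integral>x. \<bar>?F k x - ?f x\<bar> + \<bar>?g k x - ?f x\<bar> \<partial>lborel)"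
        using i by (intro integral_mono) auto
      then show ?thesis using i by simp
    qed
    then show "\<forall>\<^sub>F k in sequentially. (\<integral>x. \<bar>?F k x - ?g k x\<bar> \<partial>lborel) \<le> (\<integral>x. \<bar>?F k x - ?f x\<bar> \<partial>lborel) + (\<integral>x. \<bar>?g k x - ?f x\<bar> \<partial>lborel)"
      by simp
  qed simp
  from tendsto_add[OF this tendsto_diff[OF c tendsto_const[of 1]]] show ?thesis by simp
qed

end

section \<open>Comparison of the experiments\<close>

text \<open>Both root densities are compared with the linearization sqrt(p) (1 + h . l / (2 sqrt n))
  at the base parameter. One remainder is that of differentiability in quadratic mean, the other
  that of the exponential tilt, and the Hellinger bound for products needs each to be
  o(1/n).\<close>

lemma tv_product_tilted:
  fixes h :: "real^'m"
  assumes \<theta>: "\<theta> \<in> \<Theta>" and n: "n \<ge> 1"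
  defines "d \<equiv> (1 / sqrt (real n)) *\<^sub>R h"
  assumes \<theta>d: "\<theta> + d \<in> \<Theta>"
  shows "tv_norm (Pn (\<theta> + d) n) (tilted_product \<theta> n h) \<le> ennreal (2 * sqrt (real n * (
       2 * (\<integral>x. (sroot (\<theta> + d) x - sroot \<theta> x - (1/2) * (d \<bullet> grad \<theta> x))\<^sup>2 \<partial>\<mu>)
     + 2 * (\<integral>x. (sqrt (tilt_density \<theta> n h x) - 1 - (h \<bullet> l \<theta> x) / sqrt (real n) / 2)\<^sup>2 \<partial>P \<theta>))))"
proof -
  have [measurable]: "\<theta> \<in> \<Theta>" "\<theta> + d \<in> \<Theta>" by fact+
  note t = tilt_density_props[OF \<theta> n, of h]
  note tm[measurable] = t(1)
  define q where "q x = p \<theta> x * tilt_density \<theta> n h x" for x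
  have q: "integrable \<mu> q" "\<And>x. q x \<ge> 0" "(\<integral>x. q x \<partial>\<mu>) = 1"
  proof -
    show "integrable \<mu> q" using t(3) unfolding integrable_P[OF \<theta> t(1)] q_def[abs_def] .
    show "(\<integral>x. q x \<partial>\<mu>) = 1" using t(4) unfolding integral_P[OF \<theta> t(1)] q_def .
    show "q x \<ge> 0" for x unfolding q_def by (intro mult_nonneg_nonneg p_nonneg[OF \<theta>] t(2))
  qed
  have tp: "tilted_product \<theta> n h = PiM {..<n} (\<lambda>_. density \<mu> (\<lambda>x. ennreal (q x)))"
  proof -
    have "density (P \<theta>) (\<lambda>x. ennreal (tilt_density \<theta> n h x)) = density \<mu> (\<lambda>x. ennreal (p \<theta> x) * ennreal (tilt_density \<theta> n h x))"
      unfolding model_def by (rule density_density_eq) measurable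
    also have "\<dots> = density \<mu> (\<lambda>x. ennreal (q x))"
      using p_nonneg[OF \<theta>] t(2) by (simp add: q_def ennreal_mult')
    finally show ?thesis by (simp add: tilted_product_def)
  qed
  let ?r1 = "\<lambda>x. sroot (\<theta> + d) x - sroot \<theta> x - (1/2) * (d \<bullet> grad \<theta> x)"
  let ?w = "\<lambda>x. sqrt (tilt_density \<theta> n h x) - 1 - (h \<bullet> l \<theta> x) / sqrt (real n) / 2"
  have sq: "sqrt (q x) = sroot \<theta> x * sqrt (tilt_density \<theta> n h x)" for x
    by (simp add: q_def sroot_def real_sqrt_mult)
  have dv: "(1/2) * (d \<bullet> grad \<theta> x) = sroot \<theta> x * ((h \<bullet> l \<theta> x) / sqrt (real n) / 2)" for x
    by (simp add: d_def grad_def)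
  have s1: "square_integrable \<mu> ?r1" by (rule square_integrable_remainder[OF \<theta> \<theta>d])
  have s2: "square_integrable \<mu> (\<lambda>x. sroot \<theta> x * ?w x)"
  proof -
    have "square_integrable \<mu> (\<lambda>x. sqrt (q x))"
      using q by (simp add: square_integrable_def)
    then have "square_integrable \<mu> (\<lambda>x. sqrt (q x) - sroot \<theta> x - (1/2) * (d \<bullet> grad \<theta> x))"
      by (intro square_integrable_diff square_integrable_sroot square_integrable_cmult square_integrable_inner_grad \<theta>)
    then show ?thesis unfolding sq dv by (simp add: right_diff_distrib)
  qed
  have "tv_norm (Pn (\<theta> + d) n) (tilted_product \<theta> n h)
     \<le> ennreal (2 * sqrt (real (card {..<n}) * (\<integral>x. (sqrt (p (\<theta> + d) x) - sqrt (q x))\<^sup>2 \<partial>\<mu>)))"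
    unfolding tp model_def
    by (rule tv_norm_PiM_le_hellinger) (use integrable_p[OF \<theta>d] p_nonneg[OF \<theta>d] integral_p[OF \<theta>d] q in auto)
  also have "\<dots> \<le> ennreal (2 * sqrt (real n * (2 * (\<integral>x. (?r1 x)\<^sup>2 \<partial>\<mu>) + 2 * (\<integral>x. (?w x)\<^sup>2 \<partial>P \<theta>))))"
  proof (intro ennreal_leI mult_left_mono real_sqrt_le_mono)
    have "(\<integral>x. (sqrt (p (\<theta> + d) x) - sqrt (q x))\<^sup>2 \<partial>\<mu>) \<le> (\<integral>x. 2 * (?r1 x)\<^sup>2 + 2 * (sroot \<theta> x * ?w x)\<^sup>2 \<partial>\<mu>)"
    proof (rule integral_mono)
      have "square_integrable \<mu> (\<lambda>x. sqrt (p (\<theta> + d) x) - sqrt (q x))"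
        using square_integrable_diff[OF s1 s2] unfolding sq dv by (simp add: sroot_def algebra_simps)
      then show "integrable \<mu> (\<lambda>x. (sqrt (p (\<theta> + d) x) - sqrt (q x))\<^sup>2)" by (simp add: square_integrable_def)
      show "integrable \<mu> (\<lambda>x. 2 * (?r1 x)\<^sup>2 + 2 * (sroot \<theta> x * ?w x)\<^sup>2)"
        using s1 s2 unfolding square_integrable_def by (intro Bochner_Integration.integrable_add integrable_mult_right) auto
      fix x
      have "sqrt (p (\<theta> + d) x) - sqrt (q x) = ?r1 x + - (sroot \<theta> x * ?w x)"
        unfolding sq dv by (simp add: sroot_def algebra_simps)
      then show "(sqrt (p (\<theta> + d) x) - sqrt (q x))\<^sup>2 \<le> 2 * (?r1 x)\<^sup>2 + 2 * (sroot \<theta> x * ?w x)\<^sup>2"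
        using norm_add_sq_le[of "?r1 x" "- (sroot \<theta> x * ?w x)"] unfolding real_norm_def power2_abs power2_minus by (simp only:)
    qed
    also have "\<dots> = 2 * (\<integral>x. (?r1 x)\<^sup>2 \<partial>\<mu>) + 2 * (\<integral>x. (sroot \<theta> x * ?w x)\<^sup>2 \<partial>\<mu>)"
      using s1 s2 unfolding square_integrable_def by (subst Bochner_Integration.integral_add) auto
    also have "(\<integral>x. (sroot \<theta> x * ?w x)\<^sup>2 \<partial>\<mu>) = (\<integral>x. (?w x)\<^sup>2 \<partial>P \<theta>)"
      by (subst integral_P[OF \<theta>]) (auto simp: power_mult_distrib sroot_sq[OF \<theta>])
    finally show "real (card {..<n}) * (\<integral>x. (sqrt (p (\<theta> + d) x) - sqrt (q x))\<^sup>2 \<partial>\<mu>)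
       \<le> real n * (2 * (\<integral>x. (?r1 x)\<^sup>2 \<partial>\<mu>) + 2 * (\<integral>x. (?w x)\<^sup>2 \<partial>P \<theta>))"
      by (simp add: mult_left_mono)
  qed simp
  finally show ?thesis .
qed

lemma tv_product_kernel_eventually:
  assumes \<theta>: "\<theta> \<in> \<Theta>" and \<eta>: "\<And>k. \<eta> k \<in> \<Theta>" "\<eta> \<longlonglongrightarrow> \<theta>" and H: "H \<longlonglongrightarrow> h"
    and n: "\<And>k. n k \<ge> 1" "filterlim n at_top sequentially" and e: "e > 0"
  shows "eventually (\<lambda>k. tv_norm (Pn (\<eta> k + (1 / sqrt (real (n k))) *\<^sub>R H k) (n k))
      (bind (gaussian (H k) (matrix_inv (J (\<eta> k)))) (score_kernel (\<eta> k) (n k))) < ennreal e) sequentially"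
proof -
  obtain C B where C: "C \<ge> 0" "B > 0" "\<And>k. norm (H k) \<le> B"
   "\<And>k. real (n k) * (\<integral>x. (sqrt (tilt_density (\<eta> k) (n k) (H k) x) - 1 - (H k \<bullet> l (\<eta> k) x) / sqrt (real (n k)) / 2)\<^sup>2 \<partial>P (\<eta> k)) \<le> C / real (n k)"
    by (rule tilt_expansion_along[OF \<theta> \<eta> H n]) (rule that)
  let ?d = "\<lambda>k. (1 / sqrt (real (n k))) *\<^sub>R H k"
  let ?r1 = "\<lambda>k. \<integral>x. (sroot (\<eta> k + ?d k) x - sroot (\<eta> k) x - (1/2) * (?d k \<bullet> grad (\<eta> k) x))\<^sup>2 \<partial>\<mu>"
  let ?w = "\<lambda>k. \<integral>x. (sqrt (tilt_density (\<eta> k) (n k) (H k) x) - 1 - (H k \<bullet> l (\<eta> k) x) / sqrt (real (n k)) / 2)\<^sup>2 \<partial>P (\<eta> k)"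
  \<comment> \<open>Since |d|^2 <= B^2 / n, this makes n times the first remainder at most e^2 /
    128, the same bound as for the second. Their doubled sum is then below e^2 / 16, and 2 sqrt (e^2
    / 16) = e / 2 is one half of the allowance.\<close>
  define \<epsilon> where "\<epsilon> = e\<^sup>2 / (128 * B\<^sup>2)"
  have \<epsilon>: "\<epsilon> > 0" using e C(2) by (simp add: \<epsilon>_def)
  obtain \<rho> where \<rho>: "\<rho> > 0"
    "\<And>\<theta>' d. dist \<theta> \<theta>' < \<rho> \<Longrightarrow> norm d < \<rho> \<Longrightarrow> \<theta>' \<in> \<Theta> \<and> \<theta>' + d \<in> \<Theta> \<and>
       (\<integral>x. (sroot (\<theta>' + d) x - sroot \<theta>' x - (1/2) * (d \<bullet> grad \<theta>' x))\<^sup>2 \<partial>\<mu>) \<le> \<epsilon> * (norm d)\<^sup>2"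
    by (rule uniform_dqm_remainder[OF \<theta> \<epsilon>]) (rule that)
  have nd: "norm (?d k) \<le> B / sqrt (real (n k))" for k
    using C(3)[of k] by (simp add: divide_right_mono)
  note inv = tendsto_divide_index_0[OF n(2)]
  have ev1: "eventually (\<lambda>k. dist \<theta> (\<eta> k) < \<rho>) sequentially"
    using tendstoD[OF \<eta>(2) \<rho>(1)] by (simp add: dist_commute)
  have ev2: "eventually (\<lambda>k. B / sqrt (real (n k)) < \<rho>) sequentially"
    by (rule order_tendstoD(2)[OF inv(1) \<rho>(1)])
  have ev3: "eventually (\<lambda>k. C / real (n k) < e\<^sup>2 / 128) sequentially"
    using e by (intro order_tendstoD(2)[OF inv(2)]) simp
  have ev4: "eventually (\<lambda>k. (\<integral>x. \<bar>tilted_smoothed_density (\<eta> k) (n k) (H k) x - normal_precision_density (J (\<eta> k)) (x - H k)\<bar> \<partial>lborel)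
     + (exp ((noise (n k))\<^sup>2 * (norm (H k))\<^sup>2 / 2) - 1) < e / 2) sequentially"
    by (rule order_tendstoD(2)[OF tv_tilted_kernel_tendsto[OF \<theta> \<eta> H n]]) (use e in simp)
  show ?thesis
    using ev1 ev2 ev3 ev4
  proof eventually_elim
    case (elim k)
    have ndk: "norm (?d k) < \<rho>" using nd[of k] elim(2) by linarith
    note r = \<rho>(2)[OF elim(1) ndk]
    have n0: "real (n k) > 0" using n(1)[of k] by simp
    have "real (n k) * ?r1 k \<le> real (n k) * (\<epsilon> * (norm (?d k))\<^sup>2)"
      using r by (intro mult_left_mono) auto
    also have "\<dots> \<le> real (n k) * (\<epsilon> * (B / sqrt (real (n k)))\<^sup>2)"
      using nd[of k] \<epsilon> by (intro mult_left_mono power_mono) auto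
    also have "\<dots> = e\<^sup>2 / 128"
      using n0 C(2) by (simp add: \<epsilon>_def power_divide)
    finally have R1: "real (n k) * ?r1 k \<le> e\<^sup>2 / 128" .
    have R2: "real (n k) * ?w k \<le> e\<^sup>2 / 128" using C(4)[of k] elim(3) by linarith
    have "tv_norm (Pn (\<eta> k + ?d k) (n k)) (tilted_product (\<eta> k) (n k) (H k))
       \<le> ennreal (2 * sqrt (real (n k) * (2 * ?r1 k + 2 * ?w k)))"
      by (rule tv_product_tilted[OF \<eta>(1) n(1)]) (use r in blast)
    also have "\<dots> \<le> ennreal (2 * sqrt (e\<^sup>2 / 16))"
    proof (intro ennreal_leI mult_left_mono real_sqrt_le_mono)
      have "real (n k) * (2 * ?r1 k + 2 * ?w k) = 2 * (real (n k) * ?r1 k) + 2 * (real (n k) * ?w k)"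
        by (simp only: distrib_left mult.left_commute)
      also have "\<dots> \<le> 2 * (e\<^sup>2 / 128) + 2 * (e\<^sup>2 / 128)" by (intro add_mono mult_left_mono R1 R2) auto
      also have "\<dots> \<le> e\<^sup>2 / 16" by simp
      finally show "real (n k) * (2 * ?r1 k + 2 * ?w k) \<le> e\<^sup>2 / 16" .
    qed simp
    also have "2 * sqrt (e\<^sup>2 / 16) = e / 2"
    proof -
      have "sqrt (e\<^sup>2 / 16) = sqrt ((e / 4)\<^sup>2)" by (simp add: power_divide)
      also have "\<dots> = e / 4" using e by (subst real_sqrt_abs) simp
      finally show ?thesis by simp
    qed
    finally have A: "tv_norm (Pn (\<eta> k + ?d k) (n k)) (tilted_product (\<eta> k) (n k) (H k)) \<le> ennreal (e / 2)" .
    have T: "tv_norm (tilted_product (\<eta> k) (n k) (H k)) (bind (gaussian (H k) (matrix_inv (J (\<eta> k)))) (score_kernel (\<eta> k) (n k))) < ennreal (e / 2)"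
      by (rule le_less_trans[OF tv_tilted_product_kernel(1)[OF \<eta>(1) n(1)]]) (rule ennreal_lessI[OF _ elim(4)], use e in simp)
    have "tv_norm (Pn (\<eta> k + ?d k) (n k)) (tilted_product (\<eta> k) (n k) (H k))
       + tv_norm (tilted_product (\<eta> k) (n k) (H k)) (bind (gaussian (H k) (matrix_inv (J (\<eta> k)))) (score_kernel (\<eta> k) (n k)))
       < ennreal (e / 2) + ennreal (e / 2)"
      by (rule le_less_trans[OF add_right_mono[OF A]]) (use T in \<open>simp add: ennreal_add_left_cancel_less\<close>)
    also have "ennreal (e / 2) + ennreal (e / 2) = ennreal e" using e by (simp flip: ennreal_plus)
    finally have B: "tv_norm (Pn (\<eta> k + ?d k) (n k)) (tilted_product (\<eta> k) (n k) (H k))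
       + tv_norm (tilted_product (\<eta> k) (n k) (H k)) (bind (gaussian (H k) (matrix_inv (J (\<eta> k)))) (score_kernel (\<eta> k) (n k)))
       < ennreal e" .
    show ?case
    proof (rule le_less_trans[OF tv_norm_triangle B])
      show "sets (Pn (\<eta> k + ?d k) (n k)) = sets (tilted_product (\<eta> k) (n k) (H k))"
        unfolding tilted_product_def by (intro sets_PiM_cong) auto
    qed
  qed
qed

text \<open>If uniformity fails, bad pairs (h, \<open>\<theta>\<close>) exist for infinitely many n.
  Compactness of \<open>K' \<times> K\<close> makes them converge along a subsequence, where the
  sequential statement is contradicted.\<close>

lemma tv_product_kernel_uniform:
  assumes K: "compact K" "K \<subseteq> \<Theta>" and K': "compact K'" and e: "e > 0"
  shows "eventually (\<lambda>n. \<forall>h\<in>K'. \<forall>\<theta>\<in>K. tv_norm (Pn (\<theta> + (1 / sqrt (real n)) *\<^sub>R h) n)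
      (bind (gaussian h (matrix_inv (J \<theta>))) (score_kernel \<theta> n)) < ennreal e) sequentially"
proof (rule ccontr)
  let ?T = "\<lambda>n h \<theta>. tv_norm (Pn (\<theta> + (1 / sqrt (real n)) *\<^sub>R h) n) (bind (gaussian h (matrix_inv (J \<theta>))) (score_kernel \<theta> n)) < ennreal e"
  assume "\<not> ?thesis"
  from not_eventually_sequentiallyD[OF this]
  obtain r :: "nat \<Rightarrow> nat" where r: "strict_mono r" "\<And>k. \<not> (\<forall>h\<in>K'. \<forall>\<theta>\<in>K. ?T (r k) h \<theta>)"
    by blast
  \<comment> \<open>The index \<open>Suc k\<close> guarantees sample sizes of at least 1, since a
    strictly increasing r may start at 0.\<close>
  have "\<forall>k. \<exists>x. x \<in> K' \<times> K \<and> \<not> ?T (r (Suc k)) (fst x) (snd x)"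
  proof
    fix k
    from r(2)[of "Suc k"] obtain h \<theta> where "h \<in> K'" "\<theta> \<in> K" "\<not> ?T (r (Suc k)) h \<theta>" by blast
    then show "\<exists>x. x \<in> K' \<times> K \<and> \<not> ?T (r (Suc k)) (fst x) (snd x)" by (intro exI[of _ "(h, \<theta>)"]) simp
  qed
  from choice[OF this] obtain x where x: "\<And>k. x k \<in> K' \<times> K" "\<And>k. \<not> ?T (r (Suc k)) (fst (x k)) (snd (x k))" by blast
  obtain y s where s: "y \<in> K' \<times> K" "strict_mono s" "(x \<circ> s) \<longlonglongrightarrow> y"
    using compact_Times[OF K'(1) K(1)] x(1) unfolding compact_def by blast
  define m where "m k = r (Suc (s k))" for k
  have sm: "strict_mono m"
    unfolding m_def strict_mono_def using r(1) s(2) by (simp add: strict_mono_less)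
  have m1: "m k \<ge> 1" for k
    unfolding m_def using seq_suble[OF r(1), of "Suc (s k)"] by linarith
  have "eventually (\<lambda>k. ?T (m k) (fst (x (s k))) (snd (x (s k)))) sequentially"
  proof (rule tv_product_kernel_eventually[OF _ _ _ _ _ _ e])
    show "snd y \<in> \<Theta>" using s(1) K(2) by auto
    show "snd (x (s k)) \<in> \<Theta>" for k using x(1)[of "s k"] K(2) by auto
    show "(\<lambda>k. snd (x (s k))) \<longlonglongrightarrow> snd y" "(\<lambda>k. fst (x (s k))) \<longlonglongrightarrow> fst y"
      using tendsto_snd[OF s(3)] tendsto_fst[OF s(3)] by (simp_all add: comp_def)
    show "1 \<le> m k" for k by (rule m1)
    show "filterlim m at_top sequentially" by (rule filterlim_subseq[OF sm])
  qed
  then obtain k where "?T (m k) (fst (x (s k))) (snd (x (s k)))"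
    unfolding eventually_sequentially by blast
  then show False using x(2)[of "s k"] unfolding m_def by blast
qed

end

theorem theorem1:
  fixes \<mu> :: "'a::polish_space measure"
    and \<Theta> \<Theta>0 :: "(real^'m::finite) set"
    and p :: "real^'m \<Rightarrow> 'a \<Rightarrow> real"
    and l :: "real^'m \<Rightarrow> 'a \<Rightarrow> real^'m"
  assumes "open \<Theta>"
    and "sets \<mu> = sets borel"
    and "\<And>\<theta>. \<theta> \<in> \<Theta> \<Longrightarrow> p \<theta> \<in> borel_measurable \<mu>"
    and "\<And>\<theta> x. \<theta> \<in> \<Theta> \<Longrightarrow> p \<theta> x \<ge> 0"
    and "\<And>\<theta>. \<theta> \<in> \<Theta> \<Longrightarrow> (\<integral>\<^sup>+ x. ennreal (p \<theta> x) \<partial>\<mu>) = 1"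
    and "\<And>\<theta>. \<theta> \<in> \<Theta> \<Longrightarrow> l \<theta> \<in> borel_measurable \<mu>"
    and "continuous_dqm \<mu> \<Theta> p l"
    and "\<And>K h. compact K \<Longrightarrow> K \<subseteq> \<Theta> \<Longrightarrow>
           (SUP \<theta>\<in>K. \<integral>\<^sup>+ x. ennreal (exp (h \<bullet> l \<theta> x)) \<partial>(model \<mu> p \<theta>)) < \<infinity>"
    and "\<And>\<theta>. \<theta> \<in> \<Theta> \<Longrightarrow> invertible (fisher_info \<mu> p l \<theta>)"
    and "countable \<Theta>0" and "\<Theta>0 \<subseteq> \<Theta>"
  shows "\<exists>(Pt :: real^'m \<Rightarrow> nat \<Rightarrow> ((nat \<Rightarrow> 'a) \<times> ((real^'m) \<times> real)) measure)
          (R :: real^'m \<Rightarrow> nat \<Rightarrow> real^'m \<Rightarrow> ((nat \<Rightarrow> 'a) \<times> ((real^'m) \<times> real)) measure).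
     (\<forall>\<theta>\<in>\<Theta>. \<forall>n\<ge>1.
        prob_space (Pt \<theta> n)
      \<and> sets (Pt \<theta> n) = sets (PiM {..<n} (\<lambda>_. \<mu>) \<Otimes>\<^sub>M (borel \<Otimes>\<^sub>M restrict_space borel {0..1}))
      \<and> distr (Pt \<theta> n) (PiM {..<n} (\<lambda>_. \<mu>)) fst = PiM {..<n} (\<lambda>_. model \<mu> p \<theta>)
      \<and> R \<theta> n \<in> borel \<rightarrow>\<^sub>M
          prob_algebra (PiM {..<n} (\<lambda>_. \<mu>) \<Otimes>\<^sub>M (borel \<Otimes>\<^sub>M restrict_space borel {0..1})))
   \<and> (\<forall>K K'. compact K \<and> K \<subseteq> \<Theta> \<and> compact (K' :: (real^'m) set) \<longrightarrow>
        (\<forall>\<epsilon>>0. \<forall>\<^sub>F n in sequentially. \<forall>h\<in>K'. \<forall>\<theta>\<in>K \<inter> \<Theta>0.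
           tv_norm (Pt (\<theta> + (1 / sqrt (real n)) *\<^sub>R h) n)
                   (bind (gaussian h (matrix_inv (fisher_info \<mu> p l \<theta>))) (R \<theta> n))
           < \<epsilon>))"
proof -
  interpret regular_model \<mu> \<Theta> p l
    by (rule regular_model.intro) (fact assms)+
  let ?S = "\<lambda>n. \<mu>n n \<Otimes>\<^sub>M (borel \<Otimes>\<^sub>M restrict_space borel {0..1}) :: ((nat \<Rightarrow> 'a) \<times> ((real^'m) \<times> real)) measure"
  define \<iota> :: "(nat \<Rightarrow> 'a) \<Rightarrow> (nat \<Rightarrow> 'a) \<times> ((real^'m) \<times> real)" where "\<iota> \<omega> = (\<omega>, 0, 0)" for \<omega>
  have \<iota>[measurable]: "\<iota> \<in> \<mu>n n \<rightarrow>\<^sub>M ?S n" for n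
    unfolding \<iota>_def by (intro measurable_Pair measurable_ident measurable_const) (auto simp: space_pair_measure space_restrict_space)
  \<comment> \<open>No membership of \<open>\<theta>\<close> in \<open>\<Theta>\<close> is required:
    \<open>Pn\<close> always has the sigma-algebra of the product of \<open>\<mu>\<close>. This
    matters because \<open>\<theta> + h / sqrt n\<close> may leave \<open>\<Theta>\<close> for small
    n.\<close>
  have \<iota>P[measurable]: "\<iota> \<in> Pn \<theta> n \<rightarrow>\<^sub>M ?S n" for \<theta> n
    using \<iota> by simp
  define Pt where "Pt \<theta> n = distr (Pn \<theta> n) (?S n) \<iota>" for \<theta> n
  define R where "R \<theta> n x = distr (score_kernel \<theta> n x) (?S n) \<iota>" for \<theta> n x
  have Rm: "R \<theta> n \<in> borel \<rightarrow>\<^sub>M prob_algebra (?S n)" if "\<theta> \<in> \<Theta>" "n \<ge> 1" for \<theta> n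
    unfolding R_def
    by (rule measurable_compose[OF score_kernel_measurable[OF that] measurable_distr_prob_space[OF \<iota>]])
  have props: "prob_space (Pt \<theta> n) \<and> sets (Pt \<theta> n) = sets (?S n) \<and> distr (Pt \<theta> n) (\<mu>n n) fst = Pn \<theta> n \<and> R \<theta> n \<in> borel \<rightarrow>\<^sub>M prob_algebra (?S n)"
    if "\<theta> \<in> \<Theta>" "n \<ge> 1" for \<theta> n
  proof (intro conjI Rm[OF that])
    show "prob_space (Pt \<theta> n)" unfolding Pt_def
      by (rule prob_space.prob_space_distr[OF prob_space_Pn[OF that(1)] \<iota>P])
    show "sets (Pt \<theta> n) = sets (?S n)" by (simp add: Pt_def)
    have "distr (Pt \<theta> n) (\<mu>n n) fst = distr (Pn \<theta> n) (\<mu>n n) (fst \<circ> \<iota>)"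
      unfolding Pt_def by (rule distr_distr) auto
    also have "fst \<circ> \<iota> = (\<lambda>\<omega>. \<omega>)" by (auto simp: \<iota>_def)
    also have "distr (Pn \<theta> n) (\<mu>n n) (\<lambda>\<omega>. \<omega>) = Pn \<theta> n" by (rule distr_id2) simp
    finally show "distr (Pt \<theta> n) (\<mu>n n) fst = Pn \<theta> n" .
  qed
  have lim: "\<forall>\<^sub>F n in sequentially. \<forall>h\<in>K'. \<forall>\<theta>\<in>K \<inter> \<Theta>0.
       tv_norm (Pt (\<theta> + (1 / sqrt (real n)) *\<^sub>R h) n) (bind (gaussian h (matrix_inv (J \<theta>))) (R \<theta> n)) < \<epsilon>"
    if K: "compact K" "K \<subseteq> \<Theta>" "compact K'" and \<epsilon>: "\<epsilon> > 0" for K K' and \<epsilon> :: ennreal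
  proof -
    \<comment> \<open>The tolerance is an extended real; for an infinite one e = 1 serves.\<close>
    obtain e where e: "e > 0" "ennreal e \<le> \<epsilon>"
      using \<epsilon> by (cases \<epsilon>) (auto intro: that[of 1])
    show ?thesis
      using tv_product_kernel_uniform[OF K e(1)] eventually_ge_at_top[of 1]
    proof eventually_elim
      case (elim n)
      show ?case
      proof (intro ballI)
        fix h \<theta> assume h: "h \<in> K'" "\<theta> \<in> K \<inter> \<Theta>0"
        then have \<theta>: "\<theta> \<in> \<Theta>" using K by auto
        let ?g = "gaussian h (matrix_inv (J \<theta>))"
        let ?Q = "bind ?g (score_kernel \<theta> n)"
        have gs: "sets ?g = sets borel" "space ?g \<noteq> {}" by (auto simp: gaussian_def)
        have km: "score_kernel \<theta> n \<in> ?g \<rightarrow>\<^sub>M subprob_algebra (\<mu>n n)"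
          using measurable_prob_algebraD[OF score_kernel_measurable[OF \<theta> elim(2)]] gs(1) by (simp cong: measurable_cong_sets)
        have Qs: "sets ?Q = sets (\<mu>n n)" by (rule sets_bind[OF sets_kernel[OF km] gs(2)])
        \<comment> \<open>Embedding commutes with mixing, so both measures are images under the same
          map \<open>\<iota>\<close>, which cannot increase total variation.\<close>
        have "bind ?g (R \<theta> n) = distr ?Q (?S n) \<iota>"
          unfolding R_def by (rule distr_bind[OF km gs(2) \<iota>, symmetric])
        then have "tv_norm (Pt (\<theta> + (1 / sqrt (real n)) *\<^sub>R h) n) (bind ?g (R \<theta> n))
           \<le> tv_norm (Pn (\<theta> + (1 / sqrt (real n)) *\<^sub>R h) n) ?Q"
          unfolding Pt_def using Qs by (simp add: tv_norm_distr_le[OF \<iota>P])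
        also have "\<dots> < ennreal e" using elim(1) h by blast
        also have "\<dots> \<le> \<epsilon>" by (rule e(2))
        finally show "tv_norm (Pt (\<theta> + (1 / sqrt (real n)) *\<^sub>R h) n) (bind ?g (R \<theta> n)) < \<epsilon>" .
      qed
    qed
  qed
  show ?thesis
    by (rule exI[of _ Pt], rule exI[of _ R]) (use props lim in blast)
qed

end
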